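(* Let $\tilde\nu$ be a positive regular Borel measure on $[0,\infty)$ with $0\in\operatorname{supp}\tilde\nu$ satisfying $\sup_{t>0}\frac{\tilde\nu[0,2t)}{\tilde\nu[0,t)}<\infty$, let $\nu=\tilde\nu\otimes\lambda$ (with $\lambda$ Lebesgue measure on $\mathbb{R}$), and let $w(t)=2\pi\int_0^\infty e^{-2rt}\,d\tilde\nu(r)$ for $t>0$. Let $\mu$ be a positive regular Borel measure on $\mathbb{C}_+$ and let $T>0$. Then the Laplace transform $\mathcal{L}$ defines a bounded linear map from $L^2([0,T],w(t)\,dt)$ into $L^2(\mathbb{C}_+,\mu)$ if and only if there is a constant $k>0$ such that for each Carleson square $Q_{a,h}$ with $a\in\mathbb{R}$ and $h\ge 1$ we have $$\mu(Q_{a,h})\le k\,\nu(Q_{a,h}).$$ Moreover, there is an equivalence between the norm of the embedding and the constant $k$ in the Carleson measure condition: there are constants $c_1,c_2>0$ depending only on $T$ and $\tilde\nu$ such that, if $N$ is the norm of the embedding and $k_*$ is the infimum of the admissible $k$, then $c_1k_*\le N^2\le c_2k_*$.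
   Context: $\mathbb{C}_+=\{s\in\mathbb{C}:\operatorname{Re}s>0\}$. The Laplace transform is $(\mathcal{L}f)(s)=\int_0^\infty f(t)e^{-st}\,dt$; functions on $[0,T]$ are extended by $0$ to $(0,\infty)$. The measure $\nu=\tilde\nu\otimes\lambda$ lives on the closed half-plane $\overline{\mathbb{C}_+}$, identified with $[0,\infty)\times\mathbb{R}$ via $x+iy\leftrightarrow(x,y)$. For $a\in\mathbb{R}$, $h>0$, the Carleson square is $Q_{a,h}=\{x+iy: 0\le x\le h,\ a-h/2\le y\le a+h/2\}$; the measure $\mu$, which lives on the open half-plane $\mathbb{C}_+$, is evaluated on $Q_{a,h}\cap\mathbb{C}_+$. Regular measures are finite on compact sets. $L^2([0,T],w(t)\,dt)$ has norm $\left(\int_0^T|f(t)|^2w(t)\,dt\right)^{1/2}$. *)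

theory Defs
  imports "HOL-Analysis.Analysis"
begin

definition regular_borel_measure_on :: "'a::topological_space set \<Rightarrow> 'a measure \<Rightarrow> bool" where
  "regular_borel_measure_on S M \<longleftrightarrow>
     sets M = sets (restrict_space borel S) \<and>
     (\<forall>K. compact K \<and> K \<subseteq> S \<longrightarrow> emeasure M K < \<infinity>) \<and>
     (\<forall>A\<in>sets M. emeasure M A = (INF U\<in>{U. openin (top_of_set S) U \<and> A \<subseteq> U}. emeasure M U)) \<and>
     (\<forall>A\<in>sets M. emeasure M A = (SUP K\<in>{K. compact K \<and> K \<subseteq> A}. emeasure M K))"

definition measure_support :: "'a::topological_space measure \<Rightarrow> 'a set" where
  "measure_support M =
     {x\<in>space M. \<forall>U. openin (top_of_set (space M)) U \<and> x \<in> U \<longrightarrow> 0 < emeasure M U}"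

text \<open>A class in the usual \<open>L\<^sup>2\<close> is represented by any of its members; \<open>L2_norm\<close> is the
  seminorm on these representatives.\<close>

definition L2_space :: "'a measure \<Rightarrow> ('a \<Rightarrow> complex) set" where
  "L2_space M = {f \<in> borel_measurable M. integrable M (\<lambda>x. (cmod (f x))\<^sup>2)}"

definition L2_norm :: "'a measure \<Rightarrow> ('a \<Rightarrow> complex) \<Rightarrow> real" where
  "L2_norm M f = sqrt (LINT x|M. (cmod (f x))\<^sup>2)"

text \<open>Linearity is required modulo null sets. Together with the norm bound it makes \<open>F\<close>
  respect equality almost everywhere, so \<open>F\<close> descends to the classes.\<close>

definition bounded_linear_L2 ::
    "'a measure \<Rightarrow> 'b measure \<Rightarrow> (('a \<Rightarrow> complex) \<Rightarrow> 'b \<Rightarrow> complex) \<Rightarrow> bool" where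
  "bounded_linear_L2 M N F \<longleftrightarrow>
     (\<forall>f\<in>L2_space M. F f \<in> L2_space N) \<and>
     (\<forall>f\<in>L2_space M. \<forall>g\<in>L2_space M. AE s in N. F (\<lambda>x. f x + g x) s = F f s + F g s) \<and>
     (\<forall>c. \<forall>f\<in>L2_space M. AE s in N. F (\<lambda>x. c * f x) s = c * F f s) \<and>
     (\<exists>C. \<forall>f\<in>L2_space M. L2_norm N (F f) \<le> C * L2_norm M f)"

text \<open>The analogue of \<^const>\<open>onorm\<close>. As there, quotients with denominator \<open>0\<close> count as \<open>0\<close>, and
  the value is meaningful only for bounded maps.\<close>

definition L2_onorm ::
    "'a measure \<Rightarrow> 'b measure \<Rightarrow> (('a \<Rightarrow> complex) \<Rightarrow> 'b \<Rightarrow> complex) \<Rightarrow> real" where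
  "L2_onorm M N F = (SUP f\<in>L2_space M. L2_norm N (F f) / L2_norm M f)"

definition laplace :: "(real \<Rightarrow> complex) \<Rightarrow> complex \<Rightarrow> complex" where
  "laplace f s = (LINT t:{0<..}|lborel. f t * exp (- (s * of_real t)))"

definition laplace_exists :: "(real \<Rightarrow> complex) \<Rightarrow> complex \<Rightarrow> bool" where
  "laplace_exists f s \<longleftrightarrow> set_integrable lborel {0<..} (\<lambda>t. f t * exp (- (s * of_real t)))"

definition zero_ext :: "real \<Rightarrow> (real \<Rightarrow> complex) \<Rightarrow> real \<Rightarrow> complex" where
  "zero_ext T f t = (if t \<in> {0..T} then f t else 0)"

abbreviation open_right_half_plane :: "complex set" ("\<complex>\<^sub>+") where
  "\<complex>\<^sub>+ \<equiv> {s. 0 < Re s}"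

abbreviation closed_right_half_plane :: "complex set" where
  "closed_right_half_plane \<equiv> {s. 0 \<le> Re s}"

definition half_plane_measure :: "real measure \<Rightarrow> complex measure" where
  "half_plane_measure \<nu>t =
     distr (\<nu>t \<Otimes>\<^sub>M lborel) (restrict_space borel closed_right_half_plane) (\<lambda>(x, y). Complex x y)"

text \<open>The value at \<open>t = 0\<close> may be infinite; it plays no role, being taken on a null set.\<close>

definition laplace_weight :: "real measure \<Rightarrow> real \<Rightarrow> ennreal" where
  "laplace_weight \<nu>t t = ennreal (2 * pi) * (\<integral>\<^sup>+ r. ennreal (exp (- 2 * r * t)) \<partial>\<nu>t)"

definition weighted_interval :: "real \<Rightarrow> (real \<Rightarrow> ennreal) \<Rightarrow> real measure" where
  "weighted_interval T w = density (restrict_space lborel {0..T}) w"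

definition carleson_square :: "real \<Rightarrow> real \<Rightarrow> complex set" where
  "carleson_square a h = {s. 0 \<le> Re s \<and> Re s \<le> h \<and> a - h / 2 \<le> Im s \<and> Im s \<le> a + h / 2}"

definition carleson_bound :: "complex measure \<Rightarrow> complex measure \<Rightarrow> real \<Rightarrow> bool" where
  "carleson_bound \<nu> \<mu> k \<longleftrightarrow>
     (\<forall>a h. 1 \<le> h \<longrightarrow>
        emeasure \<mu> (carleson_square a h \<inter> \<complex>\<^sub>+) \<le> ennreal k * emeasure \<nu> (carleson_square a h))"

definition laplace_embedding_bounded :: "real \<Rightarrow> (real \<Rightarrow> ennreal) \<Rightarrow> complex measure \<Rightarrow> bool" where
  "laplace_embedding_bounded T w \<mu> \<longleftrightarrow>
     (\<forall>f\<in>L2_space (weighted_interval T w). \<forall>s\<in>\<complex>\<^sub>+. laplace_exists (zero_ext T f) s) \<and>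
     bounded_linear_L2 (weighted_interval T w) \<mu> (\<lambda>f. laplace (zero_ext T f))"

definition laplace_embedding_norm :: "real \<Rightarrow> (real \<Rightarrow> ennreal) \<Rightarrow> complex measure \<Rightarrow> real" where
  "laplace_embedding_norm T w \<mu> = L2_onorm (weighted_interval T w) \<mu> (\<lambda>f. laplace (zero_ext T f))"

end

theory Submission
  imports Defs "HOL-Probability.Probability"
begin

text \<open>
  The weight is chosen so that \<open>f \<mapsto> \<L> f\<close> does not increase the norm from
  \<open>L\<^sup>2(w)\<close> to \<open>L\<^sup>2(\<nu>)\<close>: Plancherel's inequality on the vertical line \<open>Re s = r\<close>, integrated in
  \<open>r\<close>, is \<^emph>\<open>laplace_zen_norm_le\<close>. Boundedness into \<open>L\<^sup>2(\<mu>)\<close> is therefore a Carleson embedding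
  for the functions \<open>F = \<L> f\<close>, and because \<open>f\<close> lives on \<open>[0, T]\<close> only squares of side at
  least \<open>1\<close> can be felt.

  Necessity. On the square \<open>Q\<^bsub>a,h\<^esub>\<close> the wave packet \<open>exp (i a t)\<close>, cut off to
  \<open>\<delta>/2h \<le> t \<le> \<delta>/h\<close> with \<open>\<delta> = min 1 T\<close>, has a transform of modulus at least \<open>\<delta>/8h\<close>
  (\<^emph>\<open>laplace_wave_packet_ge\<close>), while doubling bounds the decreasing weight by
  \<open>w(\<delta>/2h) = O(\<nu>t[0, h))\<close> (\<^emph>\<open>exp_integral_le\<close>), so that the packet has squared norm
  \<open>O(\<nu>t[0, h)/h)\<close>. Comparing the two is the Carleson condition (\<^emph>\<open>carleson_of_embedding\<close>).

  Sufficiency. Multiplying \<open>f\<close> by \<open>exp (2 t)\<close> costs a factor depending on \<open>T\<close> alone and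
  replaces \<open>F(s)\<close> by \<open>F(s + 2)\<close>, so the values of \<open>F\<close> are only needed at real parts \<open>\<ge> 2\<close>. If
  \<open>2 \<cdot> 2\<^sup>i \<le> Re s < 4 \<cdot> 2\<^sup>i\<close>, then \<open>F(s)\<close> is a Poisson integral of \<open>F\<close> along every line
  \<open>Re = r\<close> with \<open>r < 2\<^sup>i\<close>. Averaging over these \<open>r\<close> with respect to \<open>\<nu>t\<close> bounds \<open>|F(s)|\<close> by a sum
  over \<open>l\<close> of the \<open>\<nu>\<close>-means of \<open>|F|\<close> over the boxes \<open>[0, 2\<^sup>i) \<times> [n 2\<^sup>i, (n + 1) 2\<^sup>i)\<close>,
  where \<open>n = m + l\<close> and \<open>m\<close> is the index of the interval containing \<open>Im s\<close>, with coefficients \<open>O(1/l\<^sup>2)\<close> (\<^emph>\<open>laplace_le_box_sums\<close>). For every fixed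
  displacement \<open>l\<close> these means are controlled by the dyadic Carleson embedding theorem
  (\<^emph>\<open>dyadic_carleson_measure\<close>), proved by a Bellman function argument; displacing the
  cells by \<open>l\<close> worsens the Carleson constant only by the factor \<open>2|l| + 1\<close>
  (\<^emph>\<open>shifted_cells_carleson\<close>), which the decay of the coefficients absorbs
  (\<^emph>\<open>laplace_carleson_embedding\<close>).

  Both directions carry explicit constants, and comparing them over all admissible \<open>k\<close> gives
  the equivalence of \<open>N\<^sup>2\<close> and \<open>k\<^sub>*\<close>.
\<close>

section \<open>Fourier transforms of integrable functions\<close>

definition gauss :: "real \<Rightarrow> real" where
  "gauss x = exp (- x\<^sup>2 / 2)"

lemma gauss_nonneg [simp]: "0 \<le> gauss x" and gauss_le_1 [simp]: "gauss x \<le> 1"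
  and gauss_minus [simp]: "gauss (- x) = gauss x"
  by (auto simp: gauss_def)

lemma gauss_eq: "gauss x = sqrt (2 * pi) * std_normal_density x"
  by (simp add: gauss_def std_normal_density_def)

lemma gauss_measurable [measurable]: "gauss \<in> borel_measurable borel"
  unfolding gauss_def by measurable

lemma integrable_gauss [simp]: "integrable lborel gauss"
  unfolding gauss_eq[abs_def] by simp

lemma integrable_gauss_scaled: "\<epsilon> \<noteq> 0 \<Longrightarrow> integrable lborel (\<lambda>u. gauss (\<epsilon> * u))"
  using lborel_integrable_real_affine[OF integrable_gauss, of \<epsilon> 0] by simp

lemma integral_gauss: "(LINT x|lborel. gauss x) = sqrt (2 * pi)"
  unfolding gauss_eq[abs_def] by simp

lemma fourier_gauss: "(LINT u|lborel. of_real (gauss u) * exp (\<i> * of_real (u * y))) = of_real (sqrt (2 * pi) * gauss y)"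
proof -
  have "of_real (gauss y) = char std_normal_distribution y"
    by (simp add: char_std_normal_distribution gauss_def)
  also have "\<dots> = (LINT x|lborel. std_normal_density x *\<^sub>R iexp (y * x))"
    unfolding char_def by (rule integral_density) auto
  finally have "of_real (sqrt (2 * pi)) * of_real (gauss y) = (LINT x|lborel. of_real (sqrt (2*pi)) * (std_normal_density x *\<^sub>R iexp (y * x)))"
    by (simp only: integral_mult_right_zero)
  also have "\<dots> = (LINT u|lborel. of_real (gauss u) * exp (\<i> * of_real (u * y)))"
    by (rule Bochner_Integration.integral_cong) (auto simp: gauss_eq scaleR_conv_of_real mult_ac)
  finally show ?thesis by simp
qed

lemma fourier_gauss_scaled:
  assumes "0 < \<epsilon>"
  shows "(LINT u|lborel. of_real (gauss (\<epsilon> * u)) * exp (\<i> * of_real (u * y))) = of_real (sqrt (2 * pi) / \<epsilon> * gauss (y / \<epsilon>))"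
proof -
  have "(LINT u|lborel. of_real (gauss u) * exp (\<i> * of_real (u * (y / \<epsilon>))))
      = \<bar>\<epsilon>\<bar> *\<^sub>R (LINT u|lborel. of_real (gauss (0 + \<epsilon> * u)) * exp (\<i> * of_real ((0 + \<epsilon> * u) * (y / \<epsilon>))))"
    using assms by (intro lborel_integral_real_affine) auto
  also have "\<dots> = \<epsilon> *\<^sub>R (LINT u|lborel. of_real (gauss (\<epsilon> * u)) * exp (\<i> * of_real (u * y)))"
    using assms by simp
  finally show ?thesis using assms fourier_gauss[of "y / \<epsilon>"]
    by (simp add: scaleR_conv_of_real field_simps)
qed

text \<open>There is no factor \<open>1 / (2 \<pi>)\<close> in this normalisation; it reappears as the constant \<open>2 \<pi>\<close> in the
  inversion formula and in Plancherel's inequality.\<close>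

definition fourier :: "(real \<Rightarrow> complex) \<Rightarrow> real \<Rightarrow> complex" where
  "fourier f y = (LINT t|lborel. f t * exp (- (\<i> * of_real (y * t))))"

lemma fourier_measurable [measurable]:
  assumes [measurable]: "f \<in> borel_measurable borel"
  shows "fourier f \<in> borel_measurable borel"
  unfolding fourier_def by measurable

lemma norm_fourier_le:
  assumes "integrable lborel f"
  shows "norm (fourier f y) \<le> (LINT t|lborel. norm (f t))"
proof -
  have "norm (fourier f y) \<le> (LINT t|lborel. norm (f t * exp (- (\<i> * of_real (y * t)))))"
    unfolding fourier_def by (rule integral_norm_bound)
  also have "\<dots> = (LINT t|lborel. norm (f t))"
    by (simp add: norm_mult norm_exp_eq_Re)
  finally show ?thesis .
qed

lemma integrable_pair_times_bounded:
  fixes f g :: "real \<Rightarrow> complex"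
  assumes f: "integrable lborel f" and g: "integrable lborel g"
    and [measurable]: "h \<in> borel_measurable (lborel \<Otimes>\<^sub>M lborel)"
    and h: "\<And>x y. norm (h (x, y)) \<le> norm (f x) * norm (g y)"
  shows "integrable (lborel \<Otimes>\<^sub>M lborel) (h :: real \<times> real \<Rightarrow> complex)"
proof (rule Bochner_Integration.integrable_bound)
  have [measurable]: "f \<in> borel_measurable lborel" "g \<in> borel_measurable lborel"
    using f g by auto
  show "integrable (lborel \<Otimes>\<^sub>M lborel) (\<lambda>(x, y). f x * g y)"
    using f g by (intro lborel_pair.Fubini_integrable) (auto simp: norm_mult)
qed (use h in \<open>auto simp: norm_mult\<close>)

text \<open>A Gaussian factor in frequency makes Fubini's theorem applicable, and integrating over the
  frequency first turns it into an approximate identity of width \<open>\<epsilon>\<close>. Inversion and Plancherel's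
  inequality are both obtained from this formula by letting \<open>\<epsilon>\<close> tend to \<open>0\<close>.\<close>

lemma fourier_gauss_smoothing:
  fixes f :: "real \<Rightarrow> complex"
  assumes f: "integrable lborel f" and \<epsilon>: "0 < \<epsilon>"
  shows "(LINT u|lborel. of_real (gauss (\<epsilon> * u)) * fourier f u * exp (\<i> * of_real (u * t)))
    = (LINT s|lborel. f s * of_real (sqrt (2 * pi) / \<epsilon> * gauss ((t - s) / \<epsilon>)))"
proof -
  have [measurable]: "f \<in> borel_measurable lborel" using f by auto
  have "(LINT u|lborel. of_real (gauss (\<epsilon> * u)) * fourier f u * exp (\<i> * of_real (u * t)))
     = (LINT u|lborel. LINT s|lborel. of_real (gauss (\<epsilon> * u)) * f s * exp (\<i> * of_real (u * (t - s))))"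
  proof (rule Bochner_Integration.integral_cong[OF refl])
    fix u
    have "of_real (gauss (\<epsilon> * u)) * fourier f u * exp (\<i> * of_real (u * t))
      = (LINT s|lborel. of_real (gauss (\<epsilon> * u)) * exp (\<i> * of_real (u * t)) * (f s * exp (- (\<i> * of_real (u * s)))))"
      unfolding fourier_def integral_mult_right_zero by (simp only: mult_ac)
    also have "\<dots> = (LINT s|lborel. of_real (gauss (\<epsilon> * u)) * f s * exp (\<i> * of_real (u * (t - s))))"
    proof (rule Bochner_Integration.integral_cong[OF refl])
      fix s
      have "exp (\<i> * of_real (u * (t - s))) = exp (\<i> * of_real (u * t)) * exp (- (\<i> * of_real (u * s)))"
        by (simp add: exp_add[symmetric] right_diff_distrib)
      then show "of_real (gauss (\<epsilon> * u)) * exp (\<i> * of_real (u * t)) * (f s * exp (- (\<i> * of_real (u * s))))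
         = of_real (gauss (\<epsilon> * u)) * f s * exp (\<i> * of_real (u * (t - s)))" by simp
    qed
    finally show "of_real (gauss (\<epsilon> * u)) * fourier f u * exp (\<i> * of_real (u * t))
      = (LINT s|lborel. of_real (gauss (\<epsilon> * u)) * f s * exp (\<i> * of_real (u * (t - s))))" .
  qed
  also have "\<dots> = (LINT s|lborel. LINT u|lborel. of_real (gauss (\<epsilon> * u)) * f s * exp (\<i> * of_real (u * (t - s))))"
  proof (rule lborel_pair.Fubini_integral[symmetric])
    have "integrable lborel (\<lambda>u. complex_of_real (gauss (\<epsilon> * u)))"
      using integrable_gauss_scaled \<epsilon> by (intro integrable_of_real) auto
    then show "integrable (lborel \<Otimes>\<^sub>M lborel) (\<lambda>(u, s). of_real (gauss (\<epsilon> * u)) * f s * exp (\<i> * of_real (u * (t - s))))"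
      by (rule integrable_pair_times_bounded[OF _ f]) (auto simp: norm_mult norm_exp_eq_Re)
  qed
  also have "\<dots> = (LINT s|lborel. f s * of_real (sqrt (2 * pi) / \<epsilon> * gauss ((t - s) / \<epsilon>)))"
  proof (rule Bochner_Integration.integral_cong[OF refl])
    fix s
    have "(LINT u|lborel. of_real (gauss (\<epsilon> * u)) * f s * exp (\<i> * of_real (u * (t - s))))
      = (LINT u|lborel. f s * (of_real (gauss (\<epsilon> * u)) * exp (\<i> * of_real (u * (t - s)))))"
      by (simp only: mult_ac)
    then show "(LINT u|lborel. of_real (gauss (\<epsilon> * u)) * f s * exp (\<i> * of_real (u * (t - s))))
      = f s * of_real (sqrt (2 * pi) / \<epsilon> * gauss ((t - s) / \<epsilon>))"
      by (simp only: integral_mult_right_zero fourier_gauss_scaled[OF \<epsilon>])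
  qed
  finally show ?thesis .
qed

lemma lim_1_over_Suc: "(\<lambda>n. 1 / real (Suc n)) \<longlonglongrightarrow> 0"
  by (rule LIMSEQ_Suc[OF lim_1_over_n])

lemma gauss_scaled_tendsto: "(\<lambda>n. gauss (1 / real (Suc n) * u)) \<longlonglongrightarrow> 1"
proof -
  have "(\<lambda>n. gauss (1 / real (Suc n) * u)) \<longlonglongrightarrow> exp (- (0 * u)\<^sup>2 / 2)"
    unfolding gauss_def by (intro tendsto_intros lim_1_over_Suc) simp
  then show ?thesis by simp
qed

text \<open>In the smoothing formula both sides converge by dominated convergence: the left one because the
  transform is integrable, the right one, after rescaling by \<open>\<epsilon>\<close> around \<open>t\<close>, because \<open>\<psi>\<close> is bounded
  and continuous.\<close>

lemma fourier_inversion: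
  fixes \<psi> :: "real \<Rightarrow> complex"
  assumes \<psi>: "integrable lborel \<psi>" and cont: "continuous_on UNIV \<psi>" and bdd: "\<And>t. norm (\<psi> t) \<le> B"
    and int: "integrable lborel (fourier \<psi>)"
  shows "(LINT u|lborel. fourier \<psi> u * exp (\<i> * of_real (u * t))) = 2 * pi * \<psi> t"
proof (rule LIMSEQ_unique)
  have [measurable]: "\<psi> \<in> borel_measurable lborel" "fourier \<psi> \<in> borel_measurable lborel" using \<psi> int by auto
  let ?J = "\<lambda>n. LINT u|lborel. of_real (gauss (1 / real (Suc n) * u)) * fourier \<psi> u * exp (\<i> * of_real (u * t))"
  show "?J \<longlonglongrightarrow> (LINT u|lborel. fourier \<psi> u * exp (\<i> * of_real (u * t)))"
  proof (rule integral_dominated_convergence)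
    show "integrable lborel (\<lambda>u. norm (fourier \<psi> u))" using int by auto
    show "AE u in lborel. (\<lambda>n. of_real (gauss (1 / real (Suc n) * u)) * fourier \<psi> u * exp (\<i> * of_real (u * t)))
       \<longlonglongrightarrow> fourier \<psi> u * exp (\<i> * of_real (u * t))"
    proof (rule AE_I2)
      fix u
      have "(\<lambda>n. of_real (gauss (1 / real (Suc n) * u)) * fourier \<psi> u * exp (\<i> * of_real (u * t)))
       \<longlonglongrightarrow> of_real 1 * fourier \<psi> u * exp (\<i> * of_real (u * t))"
        by (intro tendsto_mult tendsto_const tendsto_of_real gauss_scaled_tendsto)
      then show "(\<lambda>n. of_real (gauss (1 / real (Suc n) * u)) * fourier \<psi> u * exp (\<i> * of_real (u * t)))
       \<longlonglongrightarrow> fourier \<psi> u * exp (\<i> * of_real (u * t))" by simp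
    qed
    show "AE x in lborel. norm (of_real (gauss (1 / real (Suc n) * x)) * fourier \<psi> x * exp (\<i> * of_real (x * t))) \<le> norm (fourier \<psi> x)" for n
      by (auto simp: norm_mult norm_exp_eq_Re mult_left_le_one_le)
  qed auto
  have J: "?J n = (LINT v|lborel. \<psi> (t + 1 / real (Suc n) * v) * of_real (sqrt (2 * pi) * gauss v))" for n
  proof -
    let ?e = "1 / real (Suc n)"
    have "?J n = (LINT s|lborel. \<psi> s * of_real (sqrt (2 * pi) / ?e * gauss ((t - s) / ?e)))"
      by (rule fourier_gauss_smoothing[OF \<psi>]) simp
    also have "\<dots> = \<bar>?e\<bar> *\<^sub>R (LINT v|lborel. \<psi> (t + ?e * v) * of_real (sqrt (2 * pi) / ?e * gauss ((t - (t + ?e * v)) / ?e)))"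
      by (rule lborel_integral_real_affine) simp
    also have "\<dots> = (LINT v|lborel. ?e *\<^sub>R (\<psi> (t + ?e * v) * of_real (sqrt (2 * pi) / ?e * gauss ((t - (t + ?e * v)) / ?e))))"
      by simp
    also have "\<dots> = (LINT v|lborel. \<psi> (t + ?e * v) * of_real (sqrt (2 * pi) * gauss v))"
    proof (rule Bochner_Integration.integral_cong[OF refl])
      fix v
      have *: "(t - (t + ?e * v)) / ?e = - v" by (simp add: field_simps)
      show "?e *\<^sub>R (\<psi> (t + ?e * v) * of_real (sqrt (2 * pi) / ?e * gauss ((t - (t + ?e * v)) / ?e)))
        = \<psi> (t + ?e * v) * of_real (sqrt (2 * pi) * gauss v)"
        unfolding * by (simp add: scaleR_conv_of_real del: of_nat_Suc)
    qed
    finally show ?thesis .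
  qed
  have "(\<lambda>n. LINT v|lborel. \<psi> (t + 1 / real (Suc n) * v) * of_real (sqrt (2 * pi) * gauss v))
    \<longlonglongrightarrow> (LINT v|lborel. \<psi> t * of_real (sqrt (2 * pi) * gauss v))"
  proof (rule integral_dominated_convergence)
    show "integrable lborel (\<lambda>v. B * (sqrt (2 * pi) * gauss v))" by (intro integrable_mult_right) auto
    show "AE v in lborel. (\<lambda>n. \<psi> (t + 1 / real (Suc n) * v) * of_real (sqrt (2 * pi) * gauss v))
      \<longlonglongrightarrow> \<psi> t * of_real (sqrt (2 * pi) * gauss v)"
    proof (rule AE_I2)
      fix v
      have "(\<lambda>n. t + 1 / real (Suc n) * v) \<longlonglongrightarrow> t + 0 * v"
        by (intro tendsto_intros lim_1_over_Suc)
      then have "(\<lambda>n. \<psi> (t + 1 / real (Suc n) * v)) \<longlonglongrightarrow> \<psi> t"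
        using cont by (intro isCont_tendsto_compose[of t \<psi>]) (auto simp: continuous_on_eq_continuous_at)
      then show "(\<lambda>n. \<psi> (t + 1 / real (Suc n) * v) * of_real (sqrt (2 * pi) * gauss v))
        \<longlonglongrightarrow> \<psi> t * of_real (sqrt (2 * pi) * gauss v)" by (intro tendsto_intros)
    qed
    show "AE x in lborel. norm (\<psi> (t + 1 / real (Suc n) * x) * of_real (sqrt (2 * pi) * gauss x)) \<le> B * (sqrt (2 * pi) * gauss x)" for n
      using bdd by (auto simp: norm_mult intro!: mult_right_mono)
  qed auto
  also have "(LINT v|lborel. \<psi> t * of_real (sqrt (2 * pi) * gauss v)) = \<psi> t * of_real (2 * pi)"
  proof -
    have "(LINT v|lborel. sqrt (2 * pi) * gauss v) = 2 * pi"
      by (simp add: integral_gauss)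
    then show ?thesis
      by (simp only: integral_mult_right_zero integral_complex_of_real)
  qed
  finally show "?J \<longlonglongrightarrow> 2 * pi * \<psi> t" unfolding J by (simp add: mult_ac)
qed

lemma ennreal_norm_integral_le:
  fixes f :: "'a \<Rightarrow> 'b::{banach, second_countable_topology}"
  shows "ennreal (norm (integral\<^sup>L M f)) \<le> (\<integral>\<^sup>+ x. ennreal (norm (f x)) \<partial>M)"
proof (cases "integrable M f")
  case True
  then show ?thesis by (rule integral_norm_bound_ennreal)
qed (simp add: not_integrable_integral_eq)

lemma nn_integral_gauss_kernel:
  assumes "0 < \<epsilon>"
  shows "(\<integral>\<^sup>+ s. ennreal (sqrt (2 * pi) / \<epsilon> * gauss ((t - s) / \<epsilon>)) \<partial>lborel) = ennreal (2 * pi)"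
proof -
  have "(\<integral>\<^sup>+ s. ennreal (sqrt (2 * pi) / \<epsilon> * gauss ((t - s) / \<epsilon>)) \<partial>lborel)
    = \<bar>\<epsilon>\<bar> * (\<integral>\<^sup>+ v. ennreal (sqrt (2 * pi) / \<epsilon> * gauss ((t - (t + \<epsilon> * v)) / \<epsilon>)) \<partial>lborel)"
    using assms by (intro nn_integral_real_affine) auto
  also have "\<dots> = (\<integral>\<^sup>+ v. ennreal \<epsilon> * ennreal (sqrt (2 * pi) / \<epsilon> * gauss ((t - (t + \<epsilon> * v)) / \<epsilon>)) \<partial>lborel)"
    using assms by (subst nn_integral_cmult) auto
  also have "\<dots> = (\<integral>\<^sup>+ v. ennreal (sqrt (2 * pi) * gauss v) \<partial>lborel)"
  proof (rule nn_integral_cong)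
    fix v
    have "(t - (t + \<epsilon> * v)) / \<epsilon> = - v" using assms by (simp add: field_simps)
    then show "ennreal \<epsilon> * ennreal (sqrt (2 * pi) / \<epsilon> * gauss ((t - (t + \<epsilon> * v)) / \<epsilon>)) = ennreal (sqrt (2 * pi) * gauss v)"
      using assms by (simp add: ennreal_mult[symmetric])
  qed
  also have "\<dots> = ennreal (LINT v|lborel. sqrt (2 * pi) * gauss v)"
    by (rule nn_integral_eq_integral) auto
  also have "(LINT v|lborel. sqrt (2 * pi) * gauss v) = 2 * pi"
    by (simp add: integral_gauss)
  finally show ?thesis .
qed

text \<open>Expanding the square and smoothing gives the quadratic form of \<open>f\<close> with the positive kernel
  \<open>k(t - s)\<close> of total mass \<open>2 \<pi>\<close>. The inequality \<open>2 a b \<le> a\<^sup>2 + b\<^sup>2\<close> under the integral is then enough.\<close>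

lemma fourier_square_gauss_le:
  fixes f :: "real \<Rightarrow> complex"
  assumes f: "integrable lborel f" and \<epsilon>: "0 < \<epsilon>"
  shows "(\<integral>\<^sup>+ y. ennreal (gauss (\<epsilon> * y) * (norm (fourier f y))\<^sup>2) \<partial>lborel)
    \<le> ennreal (2 * pi) * (\<integral>\<^sup>+ t. ennreal ((norm (f t))\<^sup>2) \<partial>lborel)"
proof -
  have [measurable]: "f \<in> borel_measurable lborel" "fourier f \<in> borel_measurable borel" using f by auto
  have [measurable]: "cnj \<in> borel_measurable borel"
    by (intro borel_measurable_continuous_onI continuous_intros)
  let ?k = "\<lambda>x. sqrt (2 * pi) / \<epsilon> * gauss (x / \<epsilon>)"
  have k_nonneg: "0 \<le> ?k x" for x using \<epsilon> by auto
  define B where "B = (LINT t|lborel. norm (f t))"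
  have B: "norm (fourier f y) \<le> B" for y using norm_fourier_le[OF f] by (simp add: B_def)
  have ge: "integrable lborel (\<lambda>u. gauss (\<epsilon> * u))" using \<epsilon> by (intro integrable_gauss_scaled) auto
  have gf: "integrable lborel (\<lambda>u. of_real (gauss (\<epsilon> * u)) * fourier f u)"
    by (rule Bochner_Integration.integrable_bound[of _ "\<lambda>u. B * gauss (\<epsilon> * u)"])
       (use ge B order_trans[OF norm_ge_zero B] in \<open>auto simp: norm_mult mult.commute[of B] intro!: mult_left_mono\<close>)
  have gff: "integrable lborel (\<lambda>u. gauss (\<epsilon> * u) * (norm (fourier f u))\<^sup>2)"
    by (rule Bochner_Integration.integrable_bound[of _ "\<lambda>u. B\<^sup>2 * gauss (\<epsilon> * u)"])
       (use ge B in \<open>auto simp: norm_mult mult.commute[of "B\<^sup>2"] power_mono intro!: mult_left_mono\<close>)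
  have cnj_f: "cnj (fourier f u) = (LINT t|lborel. cnj (f t) * exp (\<i> * of_real (u * t)))" for u
  proof -
    have "cnj (fourier f u) = (LINT t|lborel. cnj (f t * exp (- (\<i> * of_real (u * t)))))"
      unfolding fourier_def by (rule Bochner_Integration.integral_cnj[symmetric])
    then show ?thesis by (simp add: exp_cnj)
  qed
  have "of_real (LINT u|lborel. gauss (\<epsilon> * u) * (norm (fourier f u))\<^sup>2)
     = (LINT u|lborel. of_real (gauss (\<epsilon> * u)) * fourier f u * cnj (fourier f u))"
    unfolding integral_complex_of_real[symmetric]
    by (rule Bochner_Integration.integral_cong) (simp_all add: mult.assoc complex_norm_square[symmetric])
  also have "\<dots> = (LINT u|lborel. LINT t|lborel. of_real (gauss (\<epsilon> * u)) * fourier f u * (cnj (f t) * exp (\<i> * of_real (u * t))))"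
    unfolding cnj_f integral_mult_right_zero ..
  also have "\<dots> = (LINT t|lborel. LINT u|lborel. of_real (gauss (\<epsilon> * u)) * fourier f u * (cnj (f t) * exp (\<i> * of_real (u * t))))"
  proof (rule lborel_pair.Fubini_integral[symmetric])
    have "integrable lborel (\<lambda>t. cnj (f t))" using f by auto
    then show "integrable (lborel \<Otimes>\<^sub>M lborel) (\<lambda>(u, t). of_real (gauss (\<epsilon> * u)) * fourier f u * (cnj (f t) * exp (\<i> * of_real (u * t))))"
      by (rule integrable_pair_times_bounded[OF gf]) (auto simp: norm_mult norm_exp_eq_Re)
  qed
  also have "\<dots> = (LINT t|lborel. cnj (f t) * (LINT s|lborel. f s * of_real (?k (t - s))))"
    unfolding fourier_gauss_smoothing[OF f \<epsilon>, symmetric] integral_mult_right_zero[symmetric]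
    by (simp only: mult_ac)
  finally have eq: "of_real (LINT u|lborel. gauss (\<epsilon> * u) * (norm (fourier f u))\<^sup>2)
    = (LINT t|lborel. cnj (f t) * (LINT s|lborel. f s * of_real (?k (t - s))))" .
  have "(\<integral>\<^sup>+ y. ennreal (gauss (\<epsilon> * y) * (norm (fourier f y))\<^sup>2) \<partial>lborel)
    = ennreal (LINT u|lborel. gauss (\<epsilon> * u) * (norm (fourier f u))\<^sup>2)"
    by (rule nn_integral_eq_integral[OF gff]) simp
  also have "\<dots> \<le> ennreal (norm (complex_of_real (LINT u|lborel. gauss (\<epsilon> * u) * (norm (fourier f u))\<^sup>2)))"
    by (intro ennreal_leI) (simp only: norm_of_real abs_ge_self)
  also have "\<dots> \<le> (\<integral>\<^sup>+ t. ennreal (norm (cnj (f t) * (LINT s|lborel. f s * of_real (?k (t - s))))) \<partial>lborel)"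
    unfolding eq by (rule ennreal_norm_integral_le)
  also have "\<dots> \<le> (\<integral>\<^sup>+ t. \<integral>\<^sup>+ s. ennreal (norm (f t)) * ennreal (norm (f s) * ?k (t - s)) \<partial>lborel \<partial>lborel)"
  proof (rule nn_integral_mono)
    fix t
    have "ennreal (norm (LINT s|lborel. f s * of_real (?k (t - s)))) \<le> (\<integral>\<^sup>+ s. ennreal (norm (f s) * ?k (t - s)) \<partial>lborel)"
      by (rule order_trans[OF ennreal_norm_integral_le]) (use \<epsilon> in \<open>simp add: norm_mult norm_divide\<close>)
    then have "ennreal (norm (f t)) * ennreal (norm (LINT s|lborel. f s * of_real (?k (t - s))))
      \<le> ennreal (norm (f t)) * (\<integral>\<^sup>+ s. ennreal (norm (f s) * ?k (t - s)) \<partial>lborel)"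
      by (rule mult_left_mono) simp
    also have "\<dots> = (\<integral>\<^sup>+ s. ennreal (norm (f t)) * ennreal (norm (f s) * ?k (t - s)) \<partial>lborel)"
      by (rule nn_integral_cmult[symmetric]) measurable
    finally show "ennreal (norm (cnj (f t) * (LINT s|lborel. f s * of_real (?k (t - s)))))
      \<le> (\<integral>\<^sup>+ s. ennreal (norm (f t)) * ennreal (norm (f s) * ?k (t - s)) \<partial>lborel)"
      by (simp only: norm_mult complex_mod_cnj ennreal_mult norm_ge_zero)
  qed
  also have "\<dots> \<le> (\<integral>\<^sup>+ t. \<integral>\<^sup>+ s. ennreal (1/2) * (ennreal ((norm (f t))\<^sup>2) * ennreal (?k (t - s)))
      + ennreal (1/2) * (ennreal ((norm (f s))\<^sup>2) * ennreal (?k (t - s))) \<partial>lborel \<partial>lborel)"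
  proof (intro nn_integral_mono)
    fix t s
    have "norm (f t) * norm (f s) \<le> 1/2 * (norm (f t))\<^sup>2 + 1/2 * (norm (f s))\<^sup>2"
      using sum_squares_bound[of "norm (f t)" "norm (f s)"] by simp
    from mult_right_mono[OF this k_nonneg[of "t - s"]]
    have "norm (f t) * (norm (f s) * ?k (t - s)) \<le> 1/2 * ((norm (f t))\<^sup>2 * ?k (t - s)) + 1/2 * ((norm (f s))\<^sup>2 * ?k (t - s))"
      by (simp only: distrib_right mult.assoc)
    then have "ennreal (norm (f t) * (norm (f s) * ?k (t - s)))
      \<le> ennreal (1/2 * ((norm (f t))\<^sup>2 * ?k (t - s)) + 1/2 * ((norm (f s))\<^sup>2 * ?k (t - s)))"
      by (rule ennreal_leI)
    then show "ennreal (norm (f t)) * ennreal (norm (f s) * ?k (t - s))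
      \<le> ennreal (1/2) * (ennreal ((norm (f t))\<^sup>2) * ennreal (?k (t - s)))
      + ennreal (1/2) * (ennreal ((norm (f s))\<^sup>2) * ennreal (?k (t - s)))"
      using k_nonneg[of "t - s"] by (simp only: ennreal_mult'' ennreal_mult' ennreal_plus mult_nonneg_nonneg norm_ge_zero zero_le_power2 zero_le_divide_1_iff zero_le_numeral)
  qed
  also have "\<dots> = ennreal (1/2) * (\<integral>\<^sup>+ t. \<integral>\<^sup>+ s. ennreal ((norm (f t))\<^sup>2) * ennreal (?k (t - s)) \<partial>lborel \<partial>lborel)
     + ennreal (1/2) * (\<integral>\<^sup>+ t. \<integral>\<^sup>+ s. ennreal ((norm (f s))\<^sup>2) * ennreal (?k (t - s)) \<partial>lborel \<partial>lborel)"
    by (simp add: nn_integral_add nn_integral_cmult)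
  also have "(\<integral>\<^sup>+ t. \<integral>\<^sup>+ s. ennreal ((norm (f s))\<^sup>2) * ennreal (?k (t - s)) \<partial>lborel \<partial>lborel)
     = (\<integral>\<^sup>+ s. \<integral>\<^sup>+ t. ennreal ((norm (f s))\<^sup>2) * ennreal (?k (t - s)) \<partial>lborel \<partial>lborel)"
    by (rule lborel_pair.Fubini') measurable
  also have "\<dots> = (\<integral>\<^sup>+ t. \<integral>\<^sup>+ s. ennreal ((norm (f t))\<^sup>2) * ennreal (?k (t - s)) \<partial>lborel \<partial>lborel)"
  proof (intro nn_integral_cong)
    fix t s :: real
    have "(t - s) / \<epsilon> = - ((s - t) / \<epsilon>)" using \<epsilon> by (simp add: field_simps)
    then show "ennreal ((norm (f s))\<^sup>2) * ennreal (?k (t - s)) = ennreal ((norm (f s))\<^sup>2) * ennreal (?k (s - t))"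
      by (simp only: gauss_minus)
  qed
  also have "(\<integral>\<^sup>+ t. \<integral>\<^sup>+ s. ennreal ((norm (f t))\<^sup>2) * ennreal (?k (t - s)) \<partial>lborel \<partial>lborel)
    = ennreal (2 * pi) * (\<integral>\<^sup>+ t. ennreal ((norm (f t))\<^sup>2) \<partial>lborel)"
  proof -
    have "(\<integral>\<^sup>+ s. ennreal ((norm (f t))\<^sup>2) * ennreal (?k (t - s)) \<partial>lborel) = ennreal ((norm (f t))\<^sup>2) * ennreal (2 * pi)" for t
      unfolding nn_integral_gauss_kernel[OF \<epsilon>, symmetric, of t] by (rule nn_integral_cmult) measurable
    then show ?thesis by (simp add: nn_integral_cmult mult.commute)
  qed
  also have "ennreal (1/2) * I + ennreal (1/2) * I = I" for I
  proof -
    have "ennreal (1/2) * I + ennreal (1/2) * I = ennreal (1/2 + 1/2) * I"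
      by (simp only: distrib_right[symmetric] ennreal_plus[symmetric] zero_le_divide_1_iff zero_le_numeral)
    then show ?thesis by simp
  qed
  finally show ?thesis .
qed

text \<open>Fatou's lemma removes the Gaussian factor.\<close>

theorem plancherel_inequality:
  fixes f :: "real \<Rightarrow> complex"
  assumes f: "integrable lborel f"
  shows "(\<integral>\<^sup>+ y. ennreal ((norm (fourier f y))\<^sup>2) \<partial>lborel)
    \<le> ennreal (2 * pi) * (\<integral>\<^sup>+ t. ennreal ((norm (f t))\<^sup>2) \<partial>lborel)"
proof -
  have [measurable]: "f \<in> borel_measurable lborel" using f by auto
  have "(\<integral>\<^sup>+ y. ennreal ((norm (fourier f y))\<^sup>2) \<partial>lborel)
    = (\<integral>\<^sup>+ y. liminf (\<lambda>n. ennreal (gauss (1 / real (Suc n) * y) * (norm (fourier f y))\<^sup>2)) \<partial>lborel)"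
  proof (rule nn_integral_cong)
    fix y
    have "(\<lambda>n. gauss (1 / real (Suc n) * y) * (norm (fourier f y))\<^sup>2) \<longlonglongrightarrow> 1 * (norm (fourier f y))\<^sup>2"
      by (intro tendsto_mult tendsto_const gauss_scaled_tendsto)
    then have "(\<lambda>n. ennreal (gauss (1 / real (Suc n) * y) * (norm (fourier f y))\<^sup>2)) \<longlonglongrightarrow> ennreal (1 * (norm (fourier f y))\<^sup>2)"
      by (rule tendsto_ennrealI)
    then show "ennreal ((norm (fourier f y))\<^sup>2) = liminf (\<lambda>n. ennreal (gauss (1 / real (Suc n) * y) * (norm (fourier f y))\<^sup>2))"
      unfolding mult_1 by (rule lim_imp_Liminf[OF trivial_limit_sequentially, symmetric])
  qed
  also have "\<dots> \<le> liminf (\<lambda>n. \<integral>\<^sup>+ y. ennreal (gauss (1 / real (Suc n) * y) * (norm (fourier f y))\<^sup>2) \<partial>lborel)"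
    by (rule nn_integral_liminf) measurable
  also have "\<dots> \<le> liminf (\<lambda>n::nat. ennreal (2 * pi) * (\<integral>\<^sup>+ t. ennreal ((norm (f t))\<^sup>2) \<partial>lborel))"
    by (intro Liminf_mono always_eventually allI fourier_square_gauss_le[OF f]) simp
  finally show ?thesis by (simp add: Liminf_const)
qed

section \<open>The Poisson kernel and Laplace transforms\<close>

lemma exp_minus_le_inverse_square:
  fixes x :: real assumes "0 \<le> x"
  shows "exp (- x) \<le> 2 * inverse (1 + x\<^sup>2)"
proof -
  have "1 + x\<^sup>2 \<le> 2 * exp x"
    using exp_lower_Taylor_quadratic[OF assms] assms by simp
  then show ?thesis
    by (simp add: exp_minus field_simps add_pos_nonneg)
qed

lemma integrable_inverse_square: "integrable lborel (\<lambda>x::real. inverse (1 + x\<^sup>2))"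
  using integrable_inverse_1_plus_square by (simp add: set_integrable_def)

lemma integrable_exp_abs:
  assumes "0 < h"
  shows "integrable lborel (\<lambda>s::real. exp (- h * \<bar>s\<bar>))"
proof (rule Bochner_Integration.integrable_bound)
  show "integrable lborel (\<lambda>s. 2 * inverse (1 + (0 + h * s)\<^sup>2))"
    using assms by (intro integrable_mult_right lborel_integrable_real_affine integrable_inverse_square) auto
  show "AE s in lborel. norm (exp (- h * \<bar>s\<bar>)) \<le> norm (2 * inverse (1 + (0 + h * s)\<^sup>2))"
  proof (rule AE_I2)
    fix s
    show "norm (exp (- h * \<bar>s\<bar>)) \<le> norm (2 * inverse (1 + (0 + h * s)\<^sup>2))"
      using exp_minus_le_inverse_square[of "h * \<bar>s\<bar>"] assms by (simp add: power_mult_distrib abs_mult)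
  qed
qed simp

lemma integral_exp_halfline:
  fixes z :: complex
  assumes z: "0 < Re z"
  shows "set_integrable lborel {0<..} (\<lambda>t. exp (- (z * of_real t)))"
    and "(LINT t:{0<..}|lborel. exp (- (z * of_real t))) = 1 / z"
proof -
  have z0: "z \<noteq> 0" using z by auto
  have int: "integrable lborel (\<lambda>s. exp (- Re z * \<bar>s\<bar>))" using integrable_exp_abs[OF z] by simp
  show si: "set_integrable lborel {0<..} (\<lambda>t. exp (- (z * of_real t)))"
    unfolding set_integrable_def
    by (rule Bochner_Integration.integrable_bound[OF int])
       (auto simp: norm_exp_eq_Re indicator_def)
  have ein: "einterval 0 \<infinity> = {0<..}" by (auto simp: einterval_def zero_ereal_def)
  have "(LBINT t=0..\<infinity>. exp (- (z * of_real t))) = 0 - (- 1 / z)"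
  proof (rule interval_integral_FTC_integrable[where F = "\<lambda>t. - exp (- (z * of_real t)) / z"])
    show "((\<lambda>t. - exp (- (z * of_real t)) / z) has_vector_derivative exp (- (z * of_real x))) (at x)" for x :: real
      using z0 by (auto intro!: derivative_eq_intros has_vector_derivative_real_field simp: field_simps)
    show "isCont (\<lambda>t. exp (- (z * of_real t))) x" for x by (intro continuous_intros)
    show "set_integrable lborel (einterval 0 \<infinity>) (\<lambda>t. exp (- (z * of_real t)))" using si by (simp add: ein)
    have "((\<lambda>t. - exp (- (z * of_real t)) / z) \<longlongrightarrow> - exp (- (z * of_real 0)) / z) (at_right 0)"
      using z0 by (intro tendsto_intros)
    then show "(((\<lambda>t. - exp (- (z * of_real t)) / z) \<circ> real_of_ereal) \<longlongrightarrow> - 1 / z) (at_right 0)"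
      by (simp add: zero_ereal_def ereal_tendsto_simps)
    have "((\<lambda>t. - exp (- (z * of_real t)) / z) \<longlongrightarrow> 0) at_top"
    proof (rule Lim_null_comparison)
      show "\<forall>\<^sub>F t in at_top. norm (- exp (- (z * of_real t)) / z) \<le> exp (- (Re z * t)) / norm z"
        by (auto simp: norm_divide norm_exp_eq_Re)
      show "((\<lambda>t. exp (- (Re z * t)) / norm z) \<longlongrightarrow> 0) at_top"
        using z z0 by real_asymp
    qed
    then show "(((\<lambda>t. - exp (- (z * of_real t)) / z) \<circ> real_of_ereal) \<longlongrightarrow> 0) (at_left \<infinity>)"
      by (simp add: ereal_tendsto_simps)
  qed simp
  then show "(LINT t:{0<..}|lborel. exp (- (z * of_real t))) = 1 / z"
    by (simp add: interval_lebesgue_integral_def ein)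
qed

definition poisson_kernel :: "real \<Rightarrow> real \<Rightarrow> real" where
  "poisson_kernel h u = h / (pi * (h\<^sup>2 + u\<^sup>2))"

lemma poisson_kernel_nonneg [simp]: "0 \<le> h \<Longrightarrow> 0 \<le> poisson_kernel h u"
  by (simp add: poisson_kernel_def)

lemma poisson_kernel_measurable [measurable]:
  "poisson_kernel h \<in> borel_measurable borel"
  unfolding poisson_kernel_def by measurable

lemma integrable_poisson_kernel:
  assumes "0 < h"
  shows "integrable lborel (poisson_kernel h)"
proof -
  have "integrable lborel (\<lambda>u. 1 / (pi * h) * inverse (1 + (0 + 1 / h * u)\<^sup>2))"
    using assms by (intro integrable_mult_right lborel_integrable_real_affine integrable_inverse_square) auto
  also have "(\<lambda>u. 1 / (pi * h) * inverse (1 + (0 + 1 / h * u)\<^sup>2)) = poisson_kernel h"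
  proof
    fix u
    have "h\<^sup>2 + u\<^sup>2 > 0" using assms by (simp add: add_pos_nonneg)
    then show "1 / (pi * h) * inverse (1 + (0 + 1 / h * u)\<^sup>2) = poisson_kernel h u"
      using assms by (simp add: poisson_kernel_def divide_simps power2_eq_square)
  qed
  finally show ?thesis .
qed

lemma fourier_exp_abs:
  assumes h: "0 < h"
  shows "fourier (\<lambda>s. of_real (exp (- h * \<bar>s\<bar>))) u = of_real (2 * pi * poisson_kernel h u)"
proof -
  let ?f = "\<lambda>s. of_real (exp (- h * \<bar>s\<bar>)) * exp (- (\<i> * of_real (u * s)))"
  let ?z = "Complex h u"
  let ?w = "Complex h (- u)"
  have zw: "0 < Re ?z" "0 < Re ?w" using h by auto
  have pos: "?f s = exp (- (?z * of_real s))" if "s \<in> {0<..}" for s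
    using that by (simp add: exp_of_real[symmetric] exp_add[symmetric] complex_eq_iff Complex_eq algebra_simps)
  have neg: "?f (- s) = exp (- (?w * of_real s))" if "s \<in> {0<..}" for s
    using that by (simp add: exp_of_real[symmetric] exp_add[symmetric] complex_eq_iff Complex_eq algebra_simps)
  have int: "integrable lborel ?f"
    by (rule Bochner_Integration.integrable_bound[OF integrable_exp_abs[OF h]])
       (auto simp: norm_mult norm_exp_eq_Re)
  have "fourier (\<lambda>s. of_real (exp (- h * \<bar>s\<bar>))) u = (LINT s|lborel. ?f s)"
    by (simp add: fourier_def)
  also have "\<dots> = (LINT s|lborel. indicator {0<..} s *\<^sub>R ?f s + indicator {..<0} s *\<^sub>R ?f s)"
  proof (rule integral_cong_AE)
    show "AE s in lborel. ?f s = indicator {0<..} s *\<^sub>R ?f s + indicator {..<0} s *\<^sub>R ?f s"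
      using AE_lborel_singleton[of 0] by eventually_elim (auto simp: indicator_def)
  qed measurable
  also have "\<dots> = (LINT s|lborel. indicator {0<..} s *\<^sub>R ?f s) + (LINT s|lborel. indicator {..<0} s *\<^sub>R ?f s)"
    by (intro Bochner_Integration.integral_add integrable_mult_indicator int) auto
  also have "(LINT s|lborel. indicator {..<0} s *\<^sub>R ?f s) = (LINT s|lborel. indicator {0<..} s *\<^sub>R ?f (- s))"
    by (subst lborel_integral_real_affine[where c = "-1" and t = 0]) (auto simp: indicator_def intro!: Bochner_Integration.integral_cong)
  also have "(LINT s|lborel. indicator {0<..} s *\<^sub>R ?f s) = 1 / ?z"
    using integral_exp_halfline(2)[OF zw(1)] unfolding set_lebesgue_integral_def
    by (subst Bochner_Integration.integral_cong[OF refl, of _ _ "\<lambda>s. indicator {0<..} s *\<^sub>R exp (- (?z * of_real s))"])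
       (use pos in \<open>auto simp: indicator_def\<close>)
  also have "(LINT s|lborel. indicator {0<..} s *\<^sub>R ?f (- s)) = 1 / ?w"
    using integral_exp_halfline(2)[OF zw(2)] unfolding set_lebesgue_integral_def
    by (subst Bochner_Integration.integral_cong[OF refl, of _ _ "\<lambda>s. indicator {0<..} s *\<^sub>R exp (- (?w * of_real s))"])
       (use neg in \<open>auto simp: indicator_def\<close>)
  also have "1 / ?z + 1 / ?w = of_real (2 * pi * poisson_kernel h u)"
  proof -
    have "h\<^sup>2 + u\<^sup>2 > 0" using h by (simp add: add_pos_nonneg)
    moreover have "1 / ?z = Complex (h / (h\<^sup>2 + u\<^sup>2)) (- u / (h\<^sup>2 + u\<^sup>2))"
      "1 / ?w = Complex (h / (h\<^sup>2 + u\<^sup>2)) (u / (h\<^sup>2 + u\<^sup>2))"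
      by (simp_all add: complex_eq_iff Re_divide Im_divide)
    ultimately show ?thesis
      by (simp add: complex_eq_iff poisson_kernel_def)
  qed
  finally show ?thesis .
qed

text \<open>The Poisson kernel has just been exhibited as a Fourier transform, so its own transform follows
  from the inversion formula.\<close>

lemma poisson_kernel_fourier:
  assumes h: "0 < h"
  shows "(LINT u|lborel. of_real (poisson_kernel h u) * exp (\<i> * of_real (u * t))) = of_real (exp (- h * \<bar>t\<bar>))"
proof -
  let ?\<psi> = "\<lambda>s. complex_of_real (exp (- h * \<bar>s\<bar>))"
  have "(LINT u|lborel. fourier ?\<psi> u * exp (\<i> * of_real (u * t))) = 2 * pi * ?\<psi> t"
  proof (rule fourier_inversion)
    show "integrable lborel ?\<psi>" using integrable_exp_abs[OF h] by (rule integrable_of_real)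
    show "continuous_on UNIV ?\<psi>" by (intro continuous_intros)
    show "norm (?\<psi> t) \<le> 1" for t using h by simp
    show "integrable lborel (fourier ?\<psi>)"
      unfolding fourier_exp_abs[OF h, abs_def]
      by (intro integrable_of_real integrable_mult_right integrable_poisson_kernel h)
  qed
  moreover have "(LINT u|lborel. fourier ?\<psi> u * exp (\<i> * of_real (u * t)))
     = 2 * pi * (LINT u|lborel. of_real (poisson_kernel h u) * exp (\<i> * of_real (u * t)))"
    unfolding fourier_exp_abs[OF h] integral_mult_right_zero[symmetric] of_real_mult
    by (simp only: mult_ac)
  ultimately show ?thesis by simp
qed

lemma laplace_eq_fourier:
  "laplace f (Complex r y) = fourier (\<lambda>t. indicator {0<..} t *\<^sub>R f t * of_real (exp (- r * t))) y"
  unfolding laplace_def set_lebesgue_integral_def fourier_def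
proof (rule Bochner_Integration.integral_cong[OF refl])
  fix t :: real
  have "exp (- (Complex r y * of_real t)) = of_real (exp (- r * t)) * exp (- (\<i> * of_real (y * t)))"
    by (simp add: exp_of_real[symmetric] exp_add[symmetric] Complex_eq algebra_simps)
  then show "indicator {0<..} t *\<^sub>R (f t * exp (- (Complex r y * of_real t)))
    = indicator {0<..} t *\<^sub>R f t * of_real (exp (- r * t)) * exp (- (\<i> * of_real (y * t)))"
    by (simp add: mult.assoc)
qed

lemma integrable_laplace_integrand:
  assumes f: "set_integrable lborel {0<..} f" and r: "0 \<le> r"
  shows "integrable lborel (\<lambda>t. indicator {0<..} t *\<^sub>R f t * complex_of_real (exp (- r * t)))"
proof (rule Bochner_Integration.integrable_bound)
  show i: "integrable lborel (\<lambda>t. indicator {0<..} t *\<^sub>R f t)" using f by (simp add: set_integrable_def)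
  show "(\<lambda>t. indicator {0<..} t *\<^sub>R f t * complex_of_real (exp (- r * t))) \<in> borel_measurable lborel"
    using borel_measurable_integrable[OF i] by measurable
  show "AE t in lborel. norm (indicator {0<..} t *\<^sub>R f t * complex_of_real (exp (- r * t))) \<le> norm (indicator {0<..} t *\<^sub>R f t)"
    using r by (auto simp: norm_mult indicator_def mult_left_le)
qed

text \<open>On the half-line \<open>t > 0\<close> the factor \<open>exp (- (x - r) t)\<close> that leads from the line \<open>Re = r\<close> to the line
  \<open>Re = x\<close> agrees with \<open>exp (- (x - r) \<bar>t\<bar>)\<close>, the transform of the Poisson kernel; a product of
  transforms is the transform of a convolution.\<close>

lemma laplace_poisson:
  assumes f: "set_integrable lborel {0<..} f" and r: "0 \<le> r" and rx: "r < x"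
  shows "laplace f (Complex x y) = (LINT u|lborel. of_real (poisson_kernel (x - r) u) * laplace f (Complex r (y - u)))"
proof -
  define G where "G = (\<lambda>t. indicator {0<..} t *\<^sub>R f t * complex_of_real (exp (- r * t)))"
  have G: "integrable lborel G" unfolding G_def by (rule integrable_laplace_integrand[OF f r])
  then have [measurable]: "G \<in> borel_measurable lborel" by auto
  have h: "0 < x - r" using rx by simp
  have P: "integrable lborel (\<lambda>u. complex_of_real (poisson_kernel (x - r) u))"
    using integrable_poisson_kernel[OF h] by (rule integrable_of_real)
  have "(LINT u|lborel. of_real (poisson_kernel (x - r) u) * laplace f (Complex r (y - u)))
    = (LINT u|lborel. LINT t|lborel. of_real (poisson_kernel (x - r) u) * (G t * exp (- (\<i> * of_real ((y - u) * t)))))"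
    unfolding laplace_eq_fourier fourier_def G_def integral_mult_right_zero ..
  also have "\<dots> = (LINT t|lborel. LINT u|lborel. of_real (poisson_kernel (x - r) u) * (G t * exp (- (\<i> * of_real ((y - u) * t)))))"
    by (rule lborel_pair.Fubini_integral[symmetric], rule integrable_pair_times_bounded[OF P G])
       (auto simp: norm_mult norm_exp_eq_Re)
  also have "\<dots> = (LINT t|lborel. indicator {0<..} t *\<^sub>R f t * of_real (exp (- x * t)) * exp (- (\<i> * of_real (y * t))))"
  proof (rule Bochner_Integration.integral_cong[OF refl])
    fix t
    have "exp (- (\<i> * of_real ((y - u) * t))) = exp (- (\<i> * of_real (y * t))) * exp (\<i> * of_real (u * t))" for u
      by (simp add: exp_add[symmetric] algebra_simps)
    then have "(LINT u|lborel. of_real (poisson_kernel (x - r) u) * (G t * exp (- (\<i> * of_real ((y - u) * t)))))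
      = (LINT u|lborel. G t * exp (- (\<i> * of_real (y * t))) * (of_real (poisson_kernel (x - r) u) * exp (\<i> * of_real (u * t))))"
      by (simp only: mult_ac)
    also have "\<dots> = G t * exp (- (\<i> * of_real (y * t))) * of_real (exp (- (x - r) * \<bar>t\<bar>))"
      by (simp only: integral_mult_right_zero poisson_kernel_fourier[OF h])
    also have "\<dots> = indicator {0<..} t *\<^sub>R f t * of_real (exp (- x * t)) * exp (- (\<i> * of_real (y * t)))"
      by (auto simp: G_def indicator_def exp_add[symmetric] of_real_mult[symmetric] left_diff_distrib simp del: of_real_mult)
    finally show "(LINT u|lborel. of_real (poisson_kernel (x - r) u) * (G t * exp (- (\<i> * of_real ((y - u) * t)))))
      = indicator {0<..} t *\<^sub>R f t * of_real (exp (- x * t)) * exp (- (\<i> * of_real (y * t)))" .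
  qed
  finally show ?thesis by (simp add: laplace_eq_fourier fourier_def)
qed

section \<open>The dyadic Carleson embedding theorem\<close>

text \<open>The node \<open>(i, m)\<close> stands for the dyadic interval \<open>[m 2\<^sup>i, (m + 1) 2\<^sup>i)\<close>, and \<open>tree_sum \<beta> i m\<close> adds \<open>\<beta>\<close> over
  all nodes of level at least \<open>0\<close> whose interval lies in it. The recursion runs over nonnegative levels
  only, which is what makes the subtrees finite.\<close>

primrec tree_sum :: "(nat \<Rightarrow> int \<Rightarrow> 'a::comm_monoid_add) \<Rightarrow> nat \<Rightarrow> int \<Rightarrow> 'a" where
  "tree_sum \<beta> 0 m = \<beta> 0 m"
| "tree_sum \<beta> (Suc i) m = tree_sum \<beta> i (2 * m) + tree_sum \<beta> i (2 * m + 1) + \<beta> (Suc i) m"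

lemma tree_sum_nonneg:
  fixes \<beta> :: "nat \<Rightarrow> int \<Rightarrow> real"
  assumes "\<And>i m. 0 \<le> \<beta> i m"
  shows "0 \<le> tree_sum \<beta> i m"
  by (induction i arbitrary: m) (auto simp: assms)

text \<open>For fixed \<open>b\<close> the maximum of \<open>2 \<theta> g - \<theta>\<^sup>2 b\<close> over \<open>\<theta>\<close> is \<open>g\<^sup>2 / b\<close>. With \<open>g = K a A\<close> and \<open>b = K a + M\<close>, removing the
  mass \<open>\<alpha>\<close> from \<open>M\<close> raises \<open>4 g\<^sup>2 / b\<close> by \<open>4 g\<^sup>2 \<alpha> / (b (b - \<alpha>))\<close>. This pays for \<open>\<alpha> A\<^sup>2\<close> because both \<open>b\<close> and
  \<open>b - \<alpha>\<close> are at most \<open>2 K a\<close>.\<close>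

lemma bellman_step:
  fixes A \<theta> :: real
  assumes a: "0 < a" and \<alpha>: "0 \<le> \<alpha>" and M: "\<alpha> \<le> M" "M \<le> K * a" and K: "0 < K"
  obtains \<theta>' where "\<alpha> * A\<^sup>2 + 8 * K * \<theta> * (a * A) - 4 * \<theta>\<^sup>2 * (K * a + M)
     \<le> 8 * K * \<theta>' * (a * A) - 4 * \<theta>'\<^sup>2 * (K * a + (M - \<alpha>))"
proof -
  define b where "b = K * a + M"
  define c where "c = K * a + (M - \<alpha>)"
  have Ka: "0 < K * a" using K a by simp
  have c0: "0 < c" using M Ka by (simp add: c_def)
  have b0: "0 < b" and bc: "b = c + \<alpha>" and c2: "c \<le> b" and b2: "b \<le> 2 * (K * a)"
    using M Ka \<alpha> by (simp_all add: b_def c_def)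
  let ?\<theta> = "K * a * A / c"
  have bc4: "b * c \<le> 4 * (K * a)\<^sup>2"
  proof -
    have "b * c \<le> (2 * (K * a)) * (2 * (K * a))"
      using b2 c2 c0 b0 by (intro mult_mono) auto
    then show ?thesis by (simp add: power2_eq_square)
  qed
  have sq: "8 * \<theta> * (K * a * A) - 4 * \<theta>\<^sup>2 * b \<le> 4 * (K * a * A)\<^sup>2 / b"
  proof -
    have "0 \<le> 4 * (\<theta> * b - K * a * A)\<^sup>2 / b" using b0 by simp
    also have "\<dots> = 4 * \<theta>\<^sup>2 * b - 8 * \<theta> * (K * a * A) + 4 * (K * a * A)\<^sup>2 / b"
      using b0 by (simp add: field_simps power2_eq_square)
    finally show ?thesis by simp
  qed
  have al: "\<alpha> * A\<^sup>2 \<le> 4 * (K * a * A)\<^sup>2 / c - 4 * (K * a * A)\<^sup>2 / b"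
  proof -
    have "\<alpha> * A\<^sup>2 * (b * c) \<le> \<alpha> * A\<^sup>2 * (4 * (K * a)\<^sup>2)"
      using bc4 \<alpha> by (intro mult_left_mono) auto
    then have "\<alpha> * A\<^sup>2 \<le> 4 * (K * a * A)\<^sup>2 * \<alpha> / (b * c)"
      using b0 c0 by (simp add: pos_le_divide_eq power_mult_distrib mult_ac)
    also have "\<dots> = 4 * (K * a * A)\<^sup>2 / c - 4 * (K * a * A)\<^sup>2 / b"
      using b0 c0 by (simp add: bc field_simps)
    finally show ?thesis .
  qed
  have opt: "8 * ?\<theta> * (K * a * A) - 4 * ?\<theta>\<^sup>2 * c = 4 * (K * a * A)\<^sup>2 / c"
    using c0 by (simp add: field_simps power2_eq_square)
  have "\<alpha> * A\<^sup>2 + 8 * K * \<theta> * (a * A) - 4 * \<theta>\<^sup>2 * b \<le> 8 * K * ?\<theta> * (a * A) - 4 * ?\<theta>\<^sup>2 * c"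
    using sq al opt by (simp only: mult_ac)
  then show ?thesis using that unfolding b_def c_def by blast
qed

text \<open>Here \<open>a\<close>, \<open>g\<close> and \<open>q\<close> stand for the measure of a box and for the integrals of \<open>G\<close> and \<open>G\<^sup>2\<close> over it. The
  induction carries the Bellman function \<open>4 K (q - K g\<^sup>2 / (K a + M))\<close>. It is written with a free
  parameter \<open>\<theta>\<close> in place of the quotient: then the Cauchy-Schwarz inequality \<open>g\<^sup>2 \<le> q a\<close> becomes
  \<open>2 \<theta> g \<le> q + \<theta>\<^sup>2 a\<close>, which can be added over the two children and the remaining part of a box and stays
  meaningful when that part has measure zero.\<close>

theorem dyadic_carleson_embedding:
  fixes a g q \<alpha> :: "nat \<Rightarrow> int \<Rightarrow> real"
  assumes a: "\<And>i m. 0 < a i m" and \<alpha>: "\<And>i m. 0 \<le> \<alpha> i m" and K: "0 < K"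
    and carleson: "\<And>i m. tree_sum \<alpha> i m \<le> K * a i m"
    and leaf: "\<And>m \<theta>. 2 * \<theta> * g 0 m \<le> q 0 m + \<theta>\<^sup>2 * a 0 m"
    and node: "\<And>i m \<theta>. 2 * \<theta> * (g (Suc i) m - g i (2 * m) - g i (2 * m + 1))
      \<le> (q (Suc i) m - q i (2 * m) - q i (2 * m + 1)) + \<theta>\<^sup>2 * (a (Suc i) m - a i (2 * m) - a i (2 * m + 1))"
  shows "tree_sum (\<lambda>i m. \<alpha> i m * (g i m / a i m)\<^sup>2) i m \<le> 4 * K * q i m"
proof -
  let ?S = "tree_sum (\<lambda>i m. \<alpha> i m * (g i m / a i m)\<^sup>2)"
  let ?M = "tree_sum \<alpha>"
  have "?S i m + 8 * K * \<theta> * g i m - 4 * \<theta>\<^sup>2 * (K * a i m + ?M i m) \<le> 4 * K * q i m" for \<theta>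
  proof (induction i arbitrary: m \<theta>)
    case 0
    have g: "a 0 m * (g 0 m / a 0 m) = g 0 m" using a[of 0 m] by simp
    obtain \<theta>' where \<theta>': "\<alpha> 0 m * (g 0 m / a 0 m)\<^sup>2 + 8 * K * \<theta> * g 0 m - 4 * \<theta>\<^sup>2 * (K * a 0 m + ?M 0 m)
     \<le> 8 * K * \<theta>' * g 0 m - 4 * \<theta>'\<^sup>2 * (K * a 0 m + (?M 0 m - \<alpha> 0 m))"
      by (rule bellman_step[of "a 0 m" "\<alpha> 0 m" "?M 0 m" K "g 0 m / a 0 m" \<theta>, unfolded g])
         (use a \<alpha> K carleson[of 0 m] in auto)
    have "4 * K * (2 * \<theta>' * g 0 m) \<le> 4 * K * (q 0 m + \<theta>'\<^sup>2 * a 0 m)"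
      using K by (intro mult_left_mono leaf) auto
    with \<theta>' show ?case by (simp add: algebra_simps)
  next
    case (Suc i)
    let ?A = "g (Suc i) m / a (Suc i) m"
    have g: "a (Suc i) m * ?A = g (Suc i) m" using a[of "Suc i" m] by simp
    have "\<alpha> (Suc i) m \<le> ?M (Suc i) m"
      using tree_sum_nonneg[of \<alpha> i "2 * m"] tree_sum_nonneg[of \<alpha> i "2 * m + 1"] \<alpha> by simp
    then obtain \<theta>' where \<theta>': "\<alpha> (Suc i) m * ?A\<^sup>2 + 8 * K * \<theta> * g (Suc i) m - 4 * \<theta>\<^sup>2 * (K * a (Suc i) m + ?M (Suc i) m)
     \<le> 8 * K * \<theta>' * g (Suc i) m - 4 * \<theta>'\<^sup>2 * (K * a (Suc i) m + (?M (Suc i) m - \<alpha> (Suc i) m))"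
      using bellman_step[of "a (Suc i) m" "\<alpha> (Suc i) m" "?M (Suc i) m" K "?A" \<theta>, unfolded g]
        a[of "Suc i" m] \<alpha>[of "Suc i" m] K carleson[of "Suc i" m] by metis
    have "4 * K * (2 * \<theta>' * (g (Suc i) m - g i (2 * m) - g i (2 * m + 1)))
      \<le> 4 * K * ((q (Suc i) m - q i (2 * m) - q i (2 * m + 1)) + \<theta>'\<^sup>2 * (a (Suc i) m - a i (2 * m) - a i (2 * m + 1)))"
      using K by (intro mult_left_mono node) auto
    with \<theta>' Suc.IH[of "2 * m" \<theta>'] Suc.IH[of "2 * m + 1" \<theta>'] show ?case by (simp add: algebra_simps)
  qed
  from this[of 0] show ?thesis by simp
qed

lemma tree_sum_ennreal:
  assumes "\<And>i m. 0 \<le> \<beta> i m"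
  shows "tree_sum (\<lambda>i m. ennreal (\<beta> i m)) i m = ennreal (tree_sum \<beta> i m)"
  by (induction i arbitrary: m) (simp_all add: assms tree_sum_nonneg add_nonneg_nonneg)

lemma tree_sum_ge: "(\<beta> i m :: ennreal) \<le> tree_sum \<beta> i m"
  by (cases i) (auto intro: add_increasing)

lemma nn_integral_int_even_odd:
  fixes f :: "int \<Rightarrow> ennreal"
  shows "(\<integral>\<^sup>+ m. f (2 * m) + f (2 * m + 1) \<partial>count_space UNIV) = (\<integral>\<^sup>+ n. f n \<partial>count_space UNIV)"
proof -
  have even: "bij_betw (\<lambda>m::int. 2 * m) UNIV {n. even n}"
    by (rule bij_betwI[where g = "\<lambda>n. n div 2"]) auto
  have odd: "bij_betw (\<lambda>m::int. 2 * m + 1) UNIV {n. odd n}"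
    by (rule bij_betwI[where g = "\<lambda>n. n div 2"]) auto
  have "(\<integral>\<^sup>+ m. f (2 * m) + f (2 * m + 1) \<partial>count_space UNIV)
    = (\<integral>\<^sup>+ m. f (2 * m) \<partial>count_space UNIV) + (\<integral>\<^sup>+ m. f (2 * m + 1) \<partial>count_space UNIV)"
    by (rule nn_integral_add) auto
  also have "\<dots> = (\<integral>\<^sup>+ n. f n \<partial>count_space {n. even n}) + (\<integral>\<^sup>+ n. f n \<partial>count_space {n. odd n})"
    by (simp add: nn_integral_bij_count_space[OF even] nn_integral_bij_count_space[OF odd])
  also have "\<dots> = (\<integral>\<^sup>+ n. f n * indicator {n. even n} n + f n * indicator {n. odd n} n \<partial>count_space UNIV)"
    by (subst nn_integral_add) (auto simp: nn_integral_count_space_indicator)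
  also have "\<dots> = (\<integral>\<^sup>+ n. f n \<partial>count_space UNIV)"
    by (rule nn_integral_cong) (auto simp: indicator_def)
  finally show ?thesis .
qed

text \<open>Every node of level at most \<open>N\<close> lies below exactly one node of level \<open>N\<close>.\<close>

lemma nn_integral_tree_sum:
  fixes \<beta> :: "nat \<Rightarrow> int \<Rightarrow> ennreal"
  shows "(\<integral>\<^sup>+ m. tree_sum \<beta> N m \<partial>count_space UNIV) = (\<Sum>i\<le>N. \<integral>\<^sup>+ m. \<beta> i m \<partial>count_space UNIV)"
proof (induction N)
  case (Suc N)
  have "(\<integral>\<^sup>+ m. tree_sum \<beta> (Suc N) m \<partial>count_space UNIV)
    = (\<integral>\<^sup>+ m. tree_sum \<beta> N (2 * m) + tree_sum \<beta> N (2 * m + 1) \<partial>count_space UNIV) + (\<integral>\<^sup>+ m. \<beta> (Suc N) m \<partial>count_space UNIV)"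
    unfolding tree_sum.simps by (rule nn_integral_add) auto
  then show ?case by (simp add: nn_integral_int_even_odd Suc.IH)
qed simp

text \<open>Finite trees suffice: the embedding for the trees rooted at level \<open>N\<close> is added over all roots, whose
  boxes are disjoint, and \<open>N\<close> tends to infinity. The boxes of the children need not exhaust the box of their
  parent; in the application they leave out the half that is farther from the imaginary axis.\<close>

theorem dyadic_carleson_measure:
  fixes M :: "'a measure" and B :: "nat \<Rightarrow> int \<Rightarrow> 'a set" and G :: "'a \<Rightarrow> real"
    and \<alpha> :: "nat \<Rightarrow> int \<Rightarrow> ennreal"
  assumes B[measurable]: "\<And>i m. B i m \<in> sets M"
    and pos: "\<And>i m. 0 < emeasure M (B i m)" and fin: "\<And>i m. emeasure M (B i m) < \<infinity>"
    and children: "\<And>i m. B i (2 * m) \<union> B i (2 * m + 1) \<subseteq> B (Suc i) m"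
    and disj: "\<And>i. disjoint_family (B i)"
    and G[measurable]: "G \<in> borel_measurable M" and G0: "\<And>x. 0 \<le> G x"
    and K: "0 < K" and carleson: "\<And>i m. tree_sum \<alpha> i m \<le> ennreal K * emeasure M (B i m)"
  shows "(\<integral>\<^sup>+ i. \<integral>\<^sup>+ m. \<alpha> i m * ((\<integral>\<^sup>+ x\<in>B i m. ennreal (G x) \<partial>M) / emeasure M (B i m))\<^sup>2 \<partial>count_space UNIV \<partial>count_space UNIV)
    \<le> ennreal (4 * K) * (\<integral>\<^sup>+ x. ennreal ((G x)\<^sup>2) \<partial>M)"
proof (cases "(\<integral>\<^sup>+ x. ennreal ((G x)\<^sup>2) \<partial>M) = \<infinity>")
  case True
  then show ?thesis using K by (simp add: ennreal_mult_top)
next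
  case False
  then have G2: "integrable M (\<lambda>x. (G x)\<^sup>2)"
    by (intro integrableI_nonneg) (auto simp: top.not_eq_extremum)
  have ind: "integrable M (indicat_real (B i m))" for i m
    using fin[of i m] by (intro integrable_real_indicator) auto
  have iG2: "integrable M (\<lambda>x. indicat_real (B i m) x * (G x)\<^sup>2)" for i m
    using integrable_mult_indicator[OF B G2, of i m] by simp
  have iG: "integrable M (\<lambda>x. indicat_real (B i m) x * G x)" for i m
  proof (rule Bochner_Integration.integrable_bound)
    show "integrable M (\<lambda>x. indicat_real (B i m) x + (G x)\<^sup>2)" using ind G2 by (intro Bochner_Integration.integrable_add)
    show "AE x in M. norm (indicat_real (B i m) x * G x) \<le> norm (indicat_real (B i m) x + (G x)\<^sup>2)"
    proof (rule AE_I2)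
      fix x
      have "2 * G x * 1 \<le> (G x)\<^sup>2 + 1\<^sup>2" by (rule sum_squares_bound)
      then show "norm (indicat_real (B i m) x * G x) \<le> norm (indicat_real (B i m) x + (G x)\<^sup>2)"
        using G0[of x] by (auto simp: indicator_def)
    qed
  qed measurable
  define a where "a = (\<lambda>i m. measure M (B i m))"
  define g where "g = (\<lambda>i m. LINT x|M. indicat_real (B i m) x * G x)"
  define q where "q = (\<lambda>i m. LINT x|M. indicat_real (B i m) x * (G x)\<^sup>2)"
  define \<beta> where "\<beta> = (\<lambda>i m. enn2real (\<alpha> i m))"
  have aE: "emeasure M (B i m) = ennreal (a i m)" for i m
    unfolding a_def using fin[of i m] by (intro emeasure_eq_ennreal_measure) auto
  have a0: "0 < a i m" for i m using pos[of i m] by (simp add: aE)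
  have a_int: "a i m = (LINT x|M. indicat_real (B i m) x)" for i m
    unfolding a_def by (simp add: Bochner_Integration.integral_indicator sets.Int_space_eq2)
  have g0: "0 \<le> g i m" for i m unfolding g_def using G0 by (intro Bochner_Integration.integral_nonneg) auto
  have \<alpha>E: "\<alpha> i m = ennreal (\<beta> i m)" for i m
  proof -
    have "\<alpha> i m \<le> ennreal K * ennreal (a i m)" using tree_sum_ge[of \<alpha> i m] carleson[of i m] aE by auto
    also have "\<dots> < \<infinity>" by (simp add: ennreal_mult_less_top)
    finally have "\<alpha> i m < \<infinity>" .
    then show ?thesis by (simp add: \<beta>_def)
  qed
  have \<beta>0: "0 \<le> \<beta> i m" for i m by (simp add: \<beta>_def)
  \<comment> \<open>The pointwise source of the parametrised Cauchy-Schwarz inequalities.\<close>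
  have quad: "2 * \<theta> * G x \<le> (G x)\<^sup>2 + \<theta>\<^sup>2" for \<theta> x
    using sum_squares_bound[of "G x" \<theta>] by (simp add: mult_ac)
  have tree: "tree_sum (\<lambda>i m. \<beta> i m * (g i m / a i m)\<^sup>2) i m \<le> 4 * K * q i m" for i m
  proof (rule dyadic_carleson_embedding)
    show "0 < a i m" "0 \<le> \<beta> i m" "0 < K" for i m by fact+
    show "tree_sum \<beta> i m \<le> K * a i m" for i m
    proof -
      have "ennreal (tree_sum \<beta> i m) \<le> ennreal (K * a i m)"
        using carleson[of i m] K a0[of i m] unfolding \<alpha>E[abs_def] tree_sum_ennreal[OF \<beta>0] aE
        by (simp add: ennreal_mult)
      then show ?thesis using K a0[of i m] by (subst (asm) ennreal_le_iff) auto
    qed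
    show "2 * \<theta> * g 0 m \<le> q 0 m + \<theta>\<^sup>2 * a 0 m" for m \<theta>
    proof -
      have "(LINT x|M. 2 * \<theta> * (indicat_real (B 0 m) x * G x))
        \<le> (LINT x|M. indicat_real (B 0 m) x * (G x)\<^sup>2 + \<theta>\<^sup>2 * indicat_real (B 0 m) x)"
        using quad[of \<theta>] by (intro integral_mono Bochner_Integration.integrable_add integrable_mult_right iG iG2 ind)
          (auto simp: indicator_def)
      also have "\<dots> = q 0 m + \<theta>\<^sup>2 * a 0 m"
        unfolding q_def a_int by (subst Bochner_Integration.integral_add) (auto intro!: iG2 ind)
      finally show ?thesis unfolding g_def by simp
    qed
    show "2 * \<theta> * (g (Suc i) m - g i (2 * m) - g i (2 * m + 1))
      \<le> (q (Suc i) m - q i (2 * m) - q i (2 * m + 1)) + \<theta>\<^sup>2 * (a (Suc i) m - a i (2 * m) - a i (2 * m + 1))" for i m \<theta>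
    proof -
      let ?D = "\<lambda>x. indicat_real (B (Suc i) m) x - indicat_real (B i (2 * m)) x - indicat_real (B i (2 * m + 1)) x"
      have dj: "B i (2 * m) \<inter> B i (2 * m + 1) = {}"
        using disj[of i] by (rule disjoint_family_onD) auto
      have D: "?D x = 0 \<or> ?D x = 1" for x
        using children[of i m] dj by (auto simp: indicator_def)
      have "2 * \<theta> * (g (Suc i) m - g i (2 * m) - g i (2 * m + 1)) = (LINT x|M. 2 * \<theta> * (?D x * G x))"
        unfolding g_def left_diff_distrib by (simp add: iG)
      also have "\<dots> \<le> (LINT x|M. ?D x * (G x)\<^sup>2 + \<theta>\<^sup>2 * ?D x)"
      proof (rule integral_mono)
        show "2 * \<theta> * (?D x * G x) \<le> ?D x * (G x)\<^sup>2 + \<theta>\<^sup>2 * ?D x" for x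
          using D[of x] quad[of \<theta> x] by auto
        show "integrable M (\<lambda>x. 2 * \<theta> * (?D x * G x))" unfolding left_diff_distrib by (simp add: iG)
        show "integrable M (\<lambda>x. ?D x * (G x)\<^sup>2 + \<theta>\<^sup>2 * ?D x)" unfolding left_diff_distrib
          by (intro Bochner_Integration.integrable_add Bochner_Integration.integrable_diff integrable_mult_right iG2 ind)
      qed
      also have "\<dots> = (LINT x|M. ?D x * (G x)\<^sup>2) + \<theta>\<^sup>2 * (LINT x|M. ?D x)"
      proof (subst Bochner_Integration.integral_add)
        show "integrable M (\<lambda>x. ?D x * (G x)\<^sup>2)" unfolding left_diff_distrib by (simp add: iG2)
        show "integrable M (\<lambda>x. \<theta>\<^sup>2 * ?D x)" by (intro Bochner_Integration.integrable_diff integrable_mult_right ind)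
      qed simp
      also have "\<dots> = (q (Suc i) m - q i (2 * m) - q i (2 * m + 1)) + \<theta>\<^sup>2 * (a (Suc i) m - a i (2 * m) - a i (2 * m + 1))"
        unfolding q_def a_int left_diff_distrib by (simp add: iG2 ind del: Bochner_Integration.integral_indicator)
      finally show ?thesis .
    qed
  qed
  have avg: "(\<integral>\<^sup>+ x\<in>B i m. ennreal (G x) \<partial>M) / emeasure M (B i m) = ennreal (g i m / a i m)" for i m
  proof -
    have "(\<integral>\<^sup>+ x\<in>B i m. ennreal (G x) \<partial>M) = (\<integral>\<^sup>+ x. ennreal (indicat_real (B i m) x * G x) \<partial>M)"
      by (rule nn_integral_cong) (simp add: indicator_def)
    also have "\<dots> = ennreal (g i m)"
      unfolding g_def using G0 iG by (intro nn_integral_eq_integral) auto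
    finally show ?thesis using a0[of i m] g0[of i m] by (simp add: aE divide_ennreal)
  qed
  let ?\<gamma> = "\<lambda>i m. \<beta> i m * (g i m / a i m)\<^sup>2"
  have \<gamma>0: "0 \<le> ?\<gamma> i m" for i m using \<beta>0 by simp
  have summand: "\<alpha> i m * ((\<integral>\<^sup>+ x\<in>B i m. ennreal (G x) \<partial>M) / emeasure M (B i m))\<^sup>2 = ennreal (?\<gamma> i m)" for i m
    unfolding avg \<alpha>E using g0[of i m] a0[of i m] \<beta>0[of i m] by (simp add: ennreal_power ennreal_mult)
  have q_sum: "(\<integral>\<^sup>+ m. ennreal (q N m) \<partial>count_space UNIV) \<le> (\<integral>\<^sup>+ x. ennreal ((G x)\<^sup>2) \<partial>M)" for N
  proof -
    have "ennreal (q N m) = (\<integral>\<^sup>+ x. ennreal (indicat_real (B N m) x * (G x)\<^sup>2) \<partial>M)" for m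
      unfolding q_def using iG2 by (intro nn_integral_eq_integral[symmetric]) auto
    then have "(\<integral>\<^sup>+ m. ennreal (q N m) \<partial>count_space UNIV)
      = (\<integral>\<^sup>+ x. \<integral>\<^sup>+ m. ennreal (indicat_real (B N m) x * (G x)\<^sup>2) \<partial>count_space UNIV \<partial>M)"
      by (simp, intro nn_integral_count_space_nn_integral[symmetric]) auto
    also have "\<dots> \<le> (\<integral>\<^sup>+ x. ennreal ((G x)\<^sup>2) \<partial>M)"
    proof (rule nn_integral_mono)
      fix x
      show "(\<integral>\<^sup>+ m. ennreal (indicat_real (B N m) x * (G x)\<^sup>2) \<partial>count_space UNIV) \<le> ennreal ((G x)\<^sup>2)"
      proof (cases "\<exists>m. x \<in> B N m")
        case True
        then obtain m where m: "x \<in> B N m" by blast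
        have "x \<notin> B N m'" if "m' \<noteq> m" for m'
          using disjoint_family_onD[OF disj, of m' m N] that m by auto
        then have "(\<integral>\<^sup>+ m. ennreal (indicat_real (B N m) x * (G x)\<^sup>2) \<partial>count_space UNIV)
          = (\<integral>\<^sup>+ m'. ennreal ((G x)\<^sup>2) * indicator {m} m' \<partial>count_space UNIV)"
          using m by (intro nn_integral_cong) (auto simp: indicator_def)
        then show ?thesis by simp
      qed simp
    qed
    finally show ?thesis .
  qed
  have partial: "(\<Sum>i\<le>N. \<integral>\<^sup>+ m. ennreal (?\<gamma> i m) \<partial>count_space UNIV) \<le> ennreal (4 * K) * (\<integral>\<^sup>+ x. ennreal ((G x)\<^sup>2) \<partial>M)" for N
  proof -
    have "(\<Sum>i\<le>N. \<integral>\<^sup>+ m. ennreal (?\<gamma> i m) \<partial>count_space UNIV) = (\<integral>\<^sup>+ m. ennreal (tree_sum ?\<gamma> N m) \<partial>count_space UNIV)"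
      unfolding nn_integral_tree_sum[symmetric] tree_sum_ennreal[OF \<gamma>0] ..
    also have "\<dots> \<le> (\<integral>\<^sup>+ m. ennreal (4 * K) * ennreal (q N m) \<partial>count_space UNIV)"
      using tree K by (intro nn_integral_mono) (simp add: ennreal_mult'[symmetric] ennreal_leI)
    also have "\<dots> = ennreal (4 * K) * (\<integral>\<^sup>+ m. ennreal (q N m) \<partial>count_space UNIV)"
      by (rule nn_integral_cmult) auto
    also have "\<dots> \<le> ennreal (4 * K) * (\<integral>\<^sup>+ x. ennreal ((G x)\<^sup>2) \<partial>M)"
      by (rule mult_left_mono[OF q_sum]) simp
    finally show ?thesis .
  qed
  have "(\<integral>\<^sup>+ i. \<integral>\<^sup>+ m. ennreal (?\<gamma> i m) \<partial>count_space UNIV \<partial>count_space UNIV) \<le> ennreal (4 * K) * (\<integral>\<^sup>+ x. ennreal ((G x)\<^sup>2) \<partial>M)"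
    unfolding nn_integral_count_space_nat
  proof (rule suminf_le_const[OF summableI])
    fix n
    have "(\<Sum>i<n. \<integral>\<^sup>+ m. ennreal (?\<gamma> i m) \<partial>count_space UNIV) \<le> (\<Sum>i\<le>n. \<integral>\<^sup>+ m. ennreal (?\<gamma> i m) \<partial>count_space UNIV)"
      by (rule sum_mono2) auto
    then show "(\<Sum>i<n. \<integral>\<^sup>+ m. ennreal (?\<gamma> i m) \<partial>count_space UNIV) \<le> ennreal (4 * K) * (\<integral>\<^sup>+ x. ennreal ((G x)\<^sup>2) \<partial>M)"
      using partial[of n] by (rule order_trans)
  qed
  then show ?thesis by (simp only: summand)
qed

section \<open>Doubling measures on the half-line\<close>

text \<open>Positivity of \<open>\<nu>[0, t)\<close> for all \<open>t > 0\<close> is the form in which the support condition at \<open>0\<close> enters.\<close>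

locale doubling_measure =
  fixes \<nu> :: "real measure" and R :: real
  assumes sets_\<nu> [measurable_cong]: "sets \<nu> = sets (restrict_space borel {0..})"
    and pos: "0 < t \<Longrightarrow> 0 < emeasure \<nu> {0..<t}"
    and fin: "emeasure \<nu> {0..<t} < \<infinity>"
    and R_ge_1: "1 \<le> R"
    and doubling: "0 < t \<Longrightarrow> emeasure \<nu> {0..<2 * t} \<le> ennreal R * emeasure \<nu> {0..<t}"
begin

lemma space_\<nu>: "space \<nu> = {0..}"
  using sets_eq_imp_space_eq[OF sets_\<nu>] by (simp add: space_restrict_space)

lemma in_sets_\<nu>: "A \<in> sets borel \<Longrightarrow> A \<subseteq> {0..} \<Longrightarrow> A \<in> sets \<nu>"
  by (simp add: sets_\<nu> sets_restrict_space_iff)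

lemma atLeastLessThan_in_sets_\<nu> [measurable]: "{0..<t} \<in> sets \<nu>"
  by (rule in_sets_\<nu>) auto

lemma measurable_ident_\<nu> [measurable]: "(\<lambda>x. x) \<in> borel_measurable \<nu>"
  by (subst measurable_cong_sets[OF sets_\<nu> refl]) (intro measurable_restrict_space1 measurable_ident_sets refl)

sublocale sigma_finite_measure \<nu>
proof
  show "\<exists>A. countable A \<and> A \<subseteq> sets \<nu> \<and> \<Union> A = space \<nu> \<and> (\<forall>a\<in>A. emeasure \<nu> a \<noteq> \<infinity>)"
  proof (intro exI conjI ballI)
    show "countable (range (\<lambda>n::nat. {0..<real n}))" by simp
    show "range (\<lambda>n::nat. {0..<real n}) \<subseteq> sets \<nu>" by auto
    show "\<Union> (range (\<lambda>n::nat. {0..<real n})) = space \<nu>"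
      unfolding space_\<nu> using reals_Archimedean2 by auto
    show "emeasure \<nu> a \<noteq> \<infinity>" if "a \<in> range (\<lambda>n::nat. {0..<real n})" for a
      using that fin by (auto simp: less_top)
  qed
qed

sublocale pair_sigma_finite \<nu> "lborel :: real measure" ..

lemma doubling_power:
  assumes "0 < t"
  shows "emeasure \<nu> {0..<2 ^ n * t} \<le> ennreal (R ^ n) * emeasure \<nu> {0..<t}"
proof (induction n)
  case (Suc n)
  have "emeasure \<nu> {0..<2 ^ Suc n * t} \<le> ennreal R * emeasure \<nu> {0..<2 ^ n * t}"
    using doubling[of "2 ^ n * t"] assms by (simp add: mult_ac)
  also have "\<dots> \<le> ennreal R * (ennreal (R ^ n) * emeasure \<nu> {0..<t})"
    by (rule mult_left_mono[OF Suc.IH]) simp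
  also have "\<dots> = ennreal (R ^ Suc n) * emeasure \<nu> {0..<t}"
    using R_ge_1 by (simp add: ennreal_mult mult.assoc)
  finally show ?case .
qed simp

text \<open>The mass of \<open>[0, 2\<^sup>n h)\<close> grows at most like \<open>R\<^sup>n\<close>, while on the shell \<open>2\<^bsup>n-1\<^esup> h \<le> r < 2\<^sup>n h\<close> the integrand is
  at most \<open>exp (- c 2\<^bsup>n-1\<^esup>)\<close>; the resulting series converges and its sum does not depend on \<open>h\<close>.\<close>

lemma exp_integral_le:
  assumes c: "0 < c"
  obtains C where "0 < C"
    "\<And>h. 0 < h \<Longrightarrow> (\<integral>\<^sup>+ r. ennreal (exp (- (c * r / h))) \<partial>\<nu>) \<le> ennreal C * emeasure \<nu> {0..<h}"
proof -
  \<comment> \<open>The factor \<open>exp (c / 2)\<close> makes \<open>b 0 = 1\<close>, the bound on the innermost interval.\<close>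
  define b where "b = (\<lambda>n::nat. exp (c / 2 - c * 2 ^ n / 2))"
  have b0: "0 < b n" for n by (simp add: b_def)
  have summable: "summable (\<lambda>n. b n * R ^ n)"
  proof -
    have lim: "(\<lambda>n. R * exp (- (c * 2 ^ n / 2))) \<longlonglongrightarrow> 0"
      using c R_ge_1 by real_asymp
    have "eventually (\<lambda>n. R * exp (- (c * 2 ^ n / 2)) < 1 / 2) sequentially"
      by (rule order_tendstoD(2)[OF lim]) simp
    then obtain N where N: "\<And>n. N \<le> n \<Longrightarrow> R * exp (- (c * 2 ^ n / 2)) < 1 / 2"
      by (auto simp: eventually_sequentially)
    show ?thesis
    proof (rule summable_ratio_test)
      show "1 / 2 < (1::real)" by simp
      fix n assume "N \<le> n"
      have "b (Suc n) * R ^ Suc n = (R * exp (- (c * 2 ^ n / 2))) * (b n * R ^ n)"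
        by (simp add: b_def exp_add[symmetric] mult_ac algebra_simps flip: exp_add)
      also have "\<dots> \<le> 1 / 2 * (b n * R ^ n)"
        using N[OF \<open>N \<le> n\<close>] R_ge_1 b0[of n] by (intro mult_right_mono) auto
      finally show "norm (b (Suc n) * R ^ Suc n) \<le> 1 / 2 * norm (b n * R ^ n)"
        using R_ge_1 b0[of n] b0[of "Suc n"] by simp
    qed
  qed
  let ?C = "\<Sum>n. b n * R ^ n"
  have "0 < ?C"
    by (rule suminf_pos[OF summable]) (use b0 R_ge_1 in auto)
  moreover have "(\<integral>\<^sup>+ r. ennreal (exp (- (c * r / h))) \<partial>\<nu>) \<le> ennreal ?C * emeasure \<nu> {0..<h}" if h: "0 < h" for h
  proof -
    have "(\<integral>\<^sup>+ r. ennreal (exp (- (c * r / h))) \<partial>\<nu>) \<le> (\<integral>\<^sup>+ r. (\<Sum>n. ennreal (b n) * indicator {0..<2 ^ n * h} r) \<partial>\<nu>)"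
    proof (rule nn_integral_mono)
      fix r assume "r \<in> space \<nu>"
      then have r: "0 \<le> r" by (simp add: space_\<nu>)
      obtain k :: nat where "r / h < 2 ^ k" using real_arch_pow[of 2 "r / h"] by auto
      then have k: "r < 2 ^ k * h" using h by (simp add: field_simps)
      define n where "n = (LEAST n. r < 2 ^ n * h)"
      have n: "r < 2 ^ n * h" unfolding n_def by (rule LeastI[of "\<lambda>n. r < 2 ^ n * h", OF k])
      have "exp (- (c * r / h)) \<le> b n"
      proof (cases n)
        case 0
        then show ?thesis using r c h by (simp add: b_def)
      next
        case (Suc j)
        have "\<not> r < 2 ^ j * h" using not_less_Least[of j "\<lambda>n. r < 2 ^ n * h"] Suc by (simp add: n_def)
        then have "2 ^ j \<le> r / h" using h by (simp add: field_simps)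
        then have "c * 2 ^ j \<le> c * (r / h)" using c by (intro mult_left_mono) auto
        then have "- (c * r / h) \<le> c / 2 - c * 2 ^ n / 2" using c Suc by simp
        then show ?thesis by (simp add: b_def)
      qed
      then have "ennreal (exp (- (c * r / h))) \<le> ennreal (b n) * indicator {0..<2 ^ n * h} r"
        using n r by (simp add: ennreal_leI)
      also have "\<dots> \<le> (\<Sum>n. ennreal (b n) * indicator {0..<2 ^ n * h} r)"
      proof -
        define F where "F = (\<lambda>n. ennreal (b n) * indicator {0..<2 ^ n * h} r)"
        have "F n \<le> suminf F" using sum_le_suminf[OF summableI, of "{n}" F] by simp
        then show ?thesis by (simp only: F_def)
      qed
      finally show "ennreal (exp (- (c * r / h))) \<le> (\<Sum>n. ennreal (b n) * indicator {0..<2 ^ n * h} r)" .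
    qed
    also have "\<dots> = (\<Sum>n. ennreal (b n) * emeasure \<nu> {0..<2 ^ n * h})"
      by (subst nn_integral_suminf) (auto simp: nn_integral_cmult_indicator)
    also have "\<dots> \<le> (\<Sum>n. ennreal (b n * R ^ n) * emeasure \<nu> {0..<h})"
    proof (intro suminf_le summableI)
      fix n
      show "ennreal (b n) * emeasure \<nu> {0..<2 ^ n * h} \<le> ennreal (b n * R ^ n) * emeasure \<nu> {0..<h}"
        using mult_left_mono[OF doubling_power[OF h, of n], of "ennreal (b n)"] b0[of n] R_ge_1
        by (simp add: ennreal_mult mult.assoc)
    qed
    also have "\<dots> = ennreal ?C * emeasure \<nu> {0..<h}"
      using b0 R_ge_1 by (simp add: suminf_ennreal2[OF _ summable] less_imp_le)
    finally show ?thesis .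
  qed
  ultimately show ?thesis using that by blast
qed

lemma complex_pair_measurable:
  "(\<lambda>(x, y). Complex x y) \<in> \<nu> \<Otimes>\<^sub>M lborel \<rightarrow>\<^sub>M restrict_space borel closed_right_half_plane"
proof (rule measurable_restrict_space2)
  have "(\<lambda>p. complex_of_real (fst p) + \<i> * complex_of_real (snd p)) \<in> borel_measurable (\<nu> \<Otimes>\<^sub>M lborel)"
    by measurable
  then show "(\<lambda>(x, y). Complex x y) \<in> borel_measurable (\<nu> \<Otimes>\<^sub>M lborel)"
    by (simp add: case_prod_unfold Complex_eq)
qed (auto simp: space_pair_measure space_\<nu>)

lemma emeasure_carleson_square:
  assumes "0 \<le> h"
  shows "emeasure (half_plane_measure \<nu>) (carleson_square a h) = emeasure \<nu> {0..h} * ennreal h"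
proof -
  have cl: "closed (carleson_square a h)"
    unfolding carleson_square_def by (intro closed_Collect_conj closed_Collect_le continuous_intros)
  have sets: "carleson_square a h \<in> sets (restrict_space borel closed_right_half_plane)"
    using cl by (subst sets_restrict_space_iff)
      (auto simp: carleson_square_def intro!: borel_closed closed_Collect_le continuous_intros)
  have "emeasure (half_plane_measure \<nu>) (carleson_square a h)
    = emeasure (\<nu> \<Otimes>\<^sub>M lborel) ((\<lambda>(x, y). Complex x y) -` carleson_square a h \<inter> space (\<nu> \<Otimes>\<^sub>M lborel))"
    unfolding half_plane_measure_def by (rule emeasure_distr[OF complex_pair_measurable sets])
  also have "(\<lambda>(x, y). Complex x y) -` carleson_square a h \<inter> space (\<nu> \<Otimes>\<^sub>M lborel) = {0..h} \<times> {a - h / 2 .. a + h / 2}"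
    by (auto simp: carleson_square_def space_pair_measure space_\<nu>)
  also have "emeasure (\<nu> \<Otimes>\<^sub>M lborel) ({0..h} \<times> {a - h / 2 .. a + h / 2}) = emeasure \<nu> {0..h} * emeasure lborel {a - h / 2 .. a + h / 2}"
    by (rule lborel.emeasure_pair_measure_Times) (auto intro!: in_sets_\<nu>)
  finally show ?thesis using assms by simp
qed

lemma laplace_weight_measurable [measurable]: "laplace_weight \<nu> \<in> borel_measurable borel"
  unfolding laplace_weight_def by measurable

lemma laplace_weight_antimono: "s \<le> t \<Longrightarrow> laplace_weight \<nu> t \<le> laplace_weight \<nu> s"
  unfolding laplace_weight_def
  by (intro mult_left_mono nn_integral_mono ennreal_leI) (auto simp: space_\<nu> mult_left_mono)

lemma laplace_weight_pos: 
  assumes "0 \<le> t" shows "0 < laplace_weight \<nu> t"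
proof -
  have "0 < ennreal (exp (- 2 * t)) * emeasure \<nu> {0..<1}"
    using pos[of 1] by (simp add: ennreal_zero_less_mult_iff)
  also have "\<dots> = (\<integral>\<^sup>+ r. ennreal (exp (- 2 * t)) * indicator {0..<1} r \<partial>\<nu>)"
    by (simp add: nn_integral_cmult_indicator)
  also have "\<dots> \<le> (\<integral>\<^sup>+ r. ennreal (exp (- 2 * r * t)) \<partial>\<nu>)"
    using assms by (intro nn_integral_mono) (auto simp: indicator_def mult_left_le_one_le intro!: ennreal_leI)
  finally show ?thesis unfolding laplace_weight_def by (simp add: ennreal_zero_less_mult_iff)
qed

end

lemma laplace_measurable:
  assumes f: "set_integrable lborel {0<..} f"
  shows "laplace f \<in> borel_measurable borel"
proof -
  define g where "g = (\<lambda>t. indicat_real {0<..} t *\<^sub>R f t)"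
  have [measurable]: "g \<in> borel_measurable lborel" 
    using f by (auto simp: g_def set_integrable_def)
  have eq: "laplace f = (\<lambda>s. LINT t|lborel. g t * exp (- (s * of_real t)))"
    by (intro ext) (simp add: laplace_def set_lebesgue_integral_def g_def)
  show ?thesis unfolding eq by measurable
qed

section \<open>Laplace transforms and averages over dyadic boxes\<close>

definition cell_coeff :: "int \<Rightarrow> real" where
  "cell_coeff l = 4 / (1 + (real_of_int l)\<^sup>2)"

text \<open>Points of intervals of length \<open>d\<close> that are \<open>l\<close> steps apart have distance at least \<open>(\<bar>l\<bar> - 1) d\<close>. As \<open>h\<close>
  itself is at least \<open>d\<close>, the loss of one step only costs the factor \<open>3\<close>, and \<open>3 \<le> \<pi>\<close>.\<close>

lemma poisson_kernel_le_cell_coeff: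
  assumes d: "0 < d" and h: "d \<le> h" "h \<le> 4 * d"
    and y: "of_int m * d \<le> y" "y < (of_int m + 1) * d"
    and y': "of_int (m + l) * d \<le> y'" "y' < (of_int (m + l) + 1) * d"
  shows "poisson_kernel h (y - y') \<le> cell_coeff l / d"
proof -
  let ?l = "real_of_int l"
  have u: "\<bar>y - y' + ?l * d\<bar> \<le> d"
    using y y' by (simp add: algebra_simps abs_le_iff)
  have "\<bar>?l\<bar> * d = \<bar>?l * d\<bar>" using d by (simp add: abs_mult)
  also have "\<dots> \<le> \<bar>y - y'\<bar> + d" using u by linarith
  finally have "(\<bar>?l\<bar> * d)\<^sup>2 \<le> (\<bar>y - y'\<bar> + d)\<^sup>2" using d by (intro power_mono) auto
  also have "\<dots> \<le> 2 * (y - y')\<^sup>2 + 2 * d\<^sup>2"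
    using sum_squares_bound[of "\<bar>y - y'\<bar>" d] by (simp add: power2_sum)
  finally have "(1 + ?l\<^sup>2) * d\<^sup>2 \<le> 3 * (d\<^sup>2 + (y - y')\<^sup>2)"
    by (simp add: power_mult_distrib algebra_simps) (use zero_le_power2[of "y - y'"] in linarith)
  also have "\<dots> \<le> 3 * (h\<^sup>2 + (y - y')\<^sup>2)" using d h by (simp add: power_mono)
  also have "\<dots> \<le> pi * (h\<^sup>2 + (y - y')\<^sup>2)" using pi_gt3 by (intro mult_right_mono) auto
  finally have le: "(1 + ?l\<^sup>2) * d\<^sup>2 \<le> pi * (h\<^sup>2 + (y - y')\<^sup>2)" .
  have p1: "0 < (1 + ?l\<^sup>2) * d\<^sup>2" using d by (simp add: add_pos_nonneg)
  have "poisson_kernel h (y - y') \<le> 4 * d / ((1 + ?l\<^sup>2) * d\<^sup>2)"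
    unfolding poisson_kernel_def using le p1 h d by (intro frac_le) auto
  also have "\<dots> = cell_coeff l / d" using d by (simp add: cell_coeff_def power2_eq_square)
  finally show ?thesis .
qed

context doubling_measure begin

lemma laplace_pair_measurable:
  assumes "set_integrable lborel {0<..} f"
  shows "(\<lambda>(r, y). laplace f (Complex r y)) \<in> borel_measurable (\<nu> \<Otimes>\<^sub>M lborel)"
proof -
  have "(\<lambda>p. complex_of_real (fst p) + \<i> * complex_of_real (snd p)) \<in> borel_measurable (\<nu> \<Otimes>\<^sub>M lborel)"
    by measurable
  from measurable_compose[OF this laplace_measurable[OF assms]] show ?thesis
    by (simp add: case_prod_unfold Complex_eq)
qed

text \<open>Up to its boundary, a Carleson square of side \<open>d\<close> in the coordinates \<open>(Re s, Im s)\<close>.\<close>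

definition dyadic_box :: "real \<Rightarrow> int \<Rightarrow> (real \<times> real) set" where
  "dyadic_box d m = {0..<d} \<times> {of_int m * d..<(of_int m + 1) * d}"

lemma dyadic_box_in_sets [measurable]: "dyadic_box d m \<in> sets (\<nu> \<Otimes>\<^sub>M lborel)"
  unfolding dyadic_box_def by measurable

lemma emeasure_dyadic_box: "0 \<le> d \<Longrightarrow> emeasure (\<nu> \<Otimes>\<^sub>M lborel) (dyadic_box d m) = emeasure \<nu> {0..<d} * ennreal d"
  unfolding dyadic_box_def by (subst lborel.emeasure_pair_measure_Times) (auto simp: algebra_simps)

text \<open>The Poisson formula is applied on every line \<open>Re = r\<close> with \<open>r < d\<close>, where the height \<open>x - r\<close> lies between
  \<open>d\<close> and \<open>4 d\<close> and the kernel is bounded uniformly in \<open>r\<close>. Integrating the resulting bound in \<open>r\<close> produces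
  the integrals of \<open>|F|\<close> over boxes.\<close>

lemma laplace_le_box_sums:
  assumes f: "set_integrable lborel {0<..} f" and d: "0 < d"
    and x: "2 * d \<le> x" "x \<le> 4 * d" and y: "of_int m * d \<le> y" "y < (of_int m + 1) * d"
  shows "emeasure \<nu> {0..<d} * ennreal (norm (laplace f (Complex x y)))
    \<le> (\<integral>\<^sup>+ l. ennreal (cell_coeff l / d) *
        (\<integral>\<^sup>+ z\<in>dyadic_box d (m + l). ennreal (norm (laplace f (Complex (fst z) (snd z)))) \<partial>(\<nu> \<Otimes>\<^sub>M lborel)) \<partial>count_space UNIV)"
proof -
  let ?F = "\<lambda>r y. ennreal (norm (laplace f (Complex r y)))"
  let ?I = "\<lambda>l. {of_int (m + l) * d..<(of_int (m + l) + 1) * d}"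
  have [measurable]: "(\<lambda>z. laplace f (Complex (fst z) (snd z))) \<in> borel_measurable (\<nu> \<Otimes>\<^sub>M lborel)"
    using laplace_pair_measurable[OF f] by (simp add: case_prod_unfold)
  have [measurable]: "(\<lambda>y. laplace f (Complex r y)) \<in> borel_measurable lborel" for r
  proof -
    have "(\<lambda>y. complex_of_real r + \<i> * complex_of_real y) \<in> borel_measurable lborel"
      unfolding measurable_lborel2 by (intro borel_measurable_continuous_onI continuous_intros)
    from measurable_compose[OF this laplace_measurable[OF f]] show ?thesis by (simp add: Complex_eq)
  qed
  have line: "?F x y \<le> (\<integral>\<^sup>+ l. \<integral>\<^sup>+ y'. ennreal (cell_coeff l / d) * (?F r y' * indicator (?I l) y') \<partial>lborel \<partial>count_space UNIV)"
    if r: "0 \<le> r" "r < d" for r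
  proof -
    have "?F x y \<le> (\<integral>\<^sup>+ u. ennreal (poisson_kernel (x - r) u) * ?F r (y - u) \<partial>lborel)"
    proof -
      have rx: "r < x" using x d r by simp
      have "?F x y \<le> (\<integral>\<^sup>+ u. ennreal (norm (of_real (poisson_kernel (x - r) u) * laplace f (Complex r (y - u)))) \<partial>lborel)"
        unfolding laplace_poisson[OF f r(1) rx, of y] by (rule ennreal_norm_integral_le)
      also have "\<dots> = (\<integral>\<^sup>+ u. ennreal (poisson_kernel (x - r) u) * ?F r (y - u) \<partial>lborel)"
        using rx by (intro nn_integral_cong) (simp add: norm_mult ennreal_mult)
      finally show ?thesis .
    qed
    also have "\<dots> = (\<integral>\<^sup>+ y'. ennreal (poisson_kernel (x - r) (y - y')) * ?F r y' \<partial>lborel)"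
      by (subst nn_integral_real_affine[where c = "-1" and t = y]) auto
    also have "\<dots> \<le> (\<integral>\<^sup>+ y'. \<integral>\<^sup>+ l. ennreal (cell_coeff l / d) * (?F r y' * indicator (?I l) y') \<partial>count_space UNIV \<partial>lborel)"
    proof (rule nn_integral_mono)
      fix y'
      define l where "l = \<lfloor>y' / d\<rfloor> - m"
      have l: "y' \<in> ?I l"
        using floor_correct[of "y' / d"] unfolding pos_le_divide_eq[OF d] pos_divide_less_eq[OF d]
        by (simp add: l_def)
      have "poisson_kernel (x - r) (y - y') \<le> cell_coeff l / d"
        using d x y r l by (intro poisson_kernel_le_cell_coeff[of d _ m]) auto
      then have "ennreal (poisson_kernel (x - r) (y - y')) * ?F r y' \<le> ennreal (cell_coeff l / d) * (?F r y' * indicator (?I l) y')"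
        using l by (intro mult_mono ennreal_leI) auto
      also have "\<dots> \<le> (\<integral>\<^sup>+ l. ennreal (cell_coeff l / d) * (?F r y' * indicator (?I l) y') \<partial>count_space UNIV)"
        by (rule nn_integral_ge_point[of l UNIV "\<lambda>l. ennreal (cell_coeff l / d) * (?F r y' * indicator (?I l) y')"]) simp
      finally show "ennreal (poisson_kernel (x - r) (y - y')) * ?F r y'
        \<le> (\<integral>\<^sup>+ l. ennreal (cell_coeff l / d) * (?F r y' * indicator (?I l) y') \<partial>count_space UNIV)" .
    qed
    also have "\<dots> = (\<integral>\<^sup>+ l. \<integral>\<^sup>+ y'. ennreal (cell_coeff l / d) * (?F r y' * indicator (?I l) y') \<partial>lborel \<partial>count_space UNIV)"
      by (rule nn_integral_count_space_nn_integral) auto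
    finally show ?thesis .
  qed
  have "emeasure \<nu> {0..<d} * ?F x y = (\<integral>\<^sup>+ r. ?F x y * indicator {0..<d} r \<partial>\<nu>)"
    by (subst nn_integral_cmult_indicator) (simp_all only: atLeastLessThan_in_sets_\<nu> mult.commute)
  also have "\<dots> \<le> (\<integral>\<^sup>+ r. \<integral>\<^sup>+ l. \<integral>\<^sup>+ y'. ennreal (cell_coeff l / d) * (?F r y' * indicator (dyadic_box d (m + l)) (r, y')) \<partial>lborel \<partial>count_space UNIV \<partial>\<nu>)"
  proof (rule nn_integral_mono)
    fix r
    show "?F x y * indicator {0..<d} r
      \<le> (\<integral>\<^sup>+ l. \<integral>\<^sup>+ y'. ennreal (cell_coeff l / d) * (?F r y' * indicator (dyadic_box d (m + l)) (r, y')) \<partial>lborel \<partial>count_space UNIV)"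
    proof (cases "r \<in> {0..<d}")
      case True
      then have "indicator (dyadic_box d (m + l)) (r, y') = (indicator (?I l) y' :: ennreal)" for l y'
        by (auto simp: dyadic_box_def indicator_def)
      then show ?thesis using line[of r] True by simp
    qed simp
  qed
  also have "\<dots> = (\<integral>\<^sup>+ l. \<integral>\<^sup>+ r. \<integral>\<^sup>+ y'. ennreal (cell_coeff l / d) * (?F r y' * indicator (dyadic_box d (m + l)) (r, y')) \<partial>lborel \<partial>\<nu> \<partial>count_space UNIV)"
  proof (rule nn_integral_count_space_nn_integral)
    fix l
    have "(\<lambda>z. ennreal (cell_coeff l / d) * (?F (fst z) (snd z) * indicator (dyadic_box d (m + l)) z)) \<in> borel_measurable (\<nu> \<Otimes>\<^sub>M lborel)"
      by measurable
    then show "(\<lambda>r. \<integral>\<^sup>+ y'. ennreal (cell_coeff l / d) * (?F r y' * indicator (dyadic_box d (m + l)) (r, y')) \<partial>lborel) \<in> borel_measurable \<nu>"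
      using lborel.borel_measurable_nn_integral_fst by fastforce
  qed simp
  also have "\<dots> = (\<integral>\<^sup>+ l. ennreal (cell_coeff l / d) *
        (\<integral>\<^sup>+ z\<in>dyadic_box d (m + l). ?F (fst z) (snd z) \<partial>(\<nu> \<Otimes>\<^sub>M lborel)) \<partial>count_space UNIV)"
  proof (rule nn_integral_cong)
    fix l
    have "(\<integral>\<^sup>+ r. \<integral>\<^sup>+ y'. ennreal (cell_coeff l / d) * (?F r y' * indicator (dyadic_box d (m + l)) (r, y')) \<partial>lborel \<partial>\<nu>)
      = (\<integral>\<^sup>+ z. ennreal (cell_coeff l / d) * (?F (fst z) (snd z) * indicator (dyadic_box d (m + l)) z) \<partial>(\<nu> \<Otimes>\<^sub>M lborel))"
      by (subst lborel.nn_integral_fst[symmetric]) auto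
    also have "\<dots> = ennreal (cell_coeff l / d) * (\<integral>\<^sup>+ z\<in>dyadic_box d (m + l). ?F (fst z) (snd z) \<partial>(\<nu> \<Otimes>\<^sub>M lborel))"
      by (rule nn_integral_cmult) measurable
    finally show "(\<integral>\<^sup>+ r. \<integral>\<^sup>+ y'. ennreal (cell_coeff l / d) * (?F r y' * indicator (dyadic_box d (m + l)) (r, y')) \<partial>lborel \<partial>\<nu>)
      = ennreal (cell_coeff l / d) * (\<integral>\<^sup>+ z\<in>dyadic_box d (m + l). ?F (fst z) (snd z) \<partial>(\<nu> \<Otimes>\<^sub>M lborel))" .
  qed
  finally show ?thesis .
qed

text \<open>Plancherel's inequality on the line \<open>Re = r\<close> is integrated in \<open>r\<close>; by Tonelli's theorem the weights
  \<open>2 \<pi> exp (- 2 r t)\<close> add up to \<open>w t\<close>.\<close>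

lemma laplace_zen_norm_le:
  assumes f: "set_integrable lborel {0<..} f"
  shows "(\<integral>\<^sup>+ z. ennreal ((norm (laplace f (Complex (fst z) (snd z))))\<^sup>2) \<partial>(\<nu> \<Otimes>\<^sub>M lborel))
    \<le> (\<integral>\<^sup>+ t\<in>{0<..}. ennreal ((norm (f t))\<^sup>2) * laplace_weight \<nu> t \<partial>lborel)"
proof -
  define g where "g = (\<lambda>t. indicat_real {0<..} t *\<^sub>R f t)"
  have g[measurable]: "g \<in> borel_measurable lborel" 
    using f by (auto simp: g_def set_integrable_def)
  have [measurable]: "(\<lambda>z. laplace f (Complex (fst z) (snd z))) \<in> borel_measurable (\<nu> \<Otimes>\<^sub>M lborel)"
    using laplace_pair_measurable[OF f] by (simp add: case_prod_unfold)
  have "(\<integral>\<^sup>+ z. ennreal ((norm (laplace f (Complex (fst z) (snd z))))\<^sup>2) \<partial>(\<nu> \<Otimes>\<^sub>M lborel))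
    = (\<integral>\<^sup>+ r. \<integral>\<^sup>+ y. ennreal ((norm (laplace f (Complex r y)))\<^sup>2) \<partial>lborel \<partial>\<nu>)"
    by (subst lborel.nn_integral_fst[symmetric]) auto
  also have "\<dots> \<le> (\<integral>\<^sup>+ r. \<integral>\<^sup>+ t. ennreal ((norm (g t))\<^sup>2) * (ennreal (2 * pi) * ennreal (exp (- 2 * r * t))) \<partial>lborel \<partial>\<nu>)"
  proof (rule nn_integral_mono)
    fix r assume "r \<in> space \<nu>"
    then have r: "0 \<le> r" by (simp add: space_\<nu>)
    have "(\<integral>\<^sup>+ y. ennreal ((norm (laplace f (Complex r y)))\<^sup>2) \<partial>lborel)
      \<le> ennreal (2 * pi) * (\<integral>\<^sup>+ t. ennreal ((norm (g t * of_real (exp (- r * t))))\<^sup>2) \<partial>lborel)"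
      unfolding laplace_eq_fourier g_def by (rule plancherel_inequality[OF integrable_laplace_integrand[OF f r]])
    also have "\<dots> = (\<integral>\<^sup>+ t. ennreal (2 * pi) * ennreal ((norm (g t * of_real (exp (- r * t))))\<^sup>2) \<partial>lborel)"
    proof (rule nn_integral_cmult[symmetric])
      have [measurable]: "(\<lambda>t. complex_of_real (exp (- r * t))) \<in> borel_measurable lborel"
        unfolding measurable_lborel2 by (intro borel_measurable_continuous_onI continuous_intros)
      show "(\<lambda>t. ennreal ((norm (g t * of_real (exp (- r * t))))\<^sup>2)) \<in> borel_measurable lborel"
        by measurable
    qed
    also have "\<dots> = (\<integral>\<^sup>+ t. ennreal ((norm (g t))\<^sup>2) * (ennreal (2 * pi) * ennreal (exp (- 2 * r * t))) \<partial>lborel)"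
    proof (rule nn_integral_cong)
      fix t
      have "(exp (- r * t))\<^sup>2 = exp (- 2 * r * t)" by (simp add: power2_eq_square exp_add[symmetric])
      then show "ennreal (2 * pi) * ennreal ((norm (g t * of_real (exp (- r * t))))\<^sup>2)
        = ennreal ((norm (g t))\<^sup>2) * (ennreal (2 * pi) * ennreal (exp (- 2 * r * t)))"
        by (simp add: norm_mult power_mult_distrib ennreal_mult mult_ac)
    qed
    finally show "(\<integral>\<^sup>+ y. ennreal ((norm (laplace f (Complex r y)))\<^sup>2) \<partial>lborel)
      \<le> (\<integral>\<^sup>+ t. ennreal ((norm (g t))\<^sup>2) * (ennreal (2 * pi) * ennreal (exp (- 2 * r * t))) \<partial>lborel)" .
  qed
  also have "\<dots> = (\<integral>\<^sup>+ t. \<integral>\<^sup>+ r. ennreal ((norm (g t))\<^sup>2) * (ennreal (2 * pi) * ennreal (exp (- 2 * r * t))) \<partial>\<nu> \<partial>lborel)"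
    by (rule Fubini'[symmetric]) measurable
  also have "\<dots> = (\<integral>\<^sup>+ t. ennreal ((norm (g t))\<^sup>2) * laplace_weight \<nu> t \<partial>lborel)"
    unfolding laplace_weight_def by (intro nn_integral_cong) (simp add: nn_integral_cmult)
  also have "\<dots> = (\<integral>\<^sup>+ t\<in>{0<..}. ennreal ((norm (f t))\<^sup>2) * laplace_weight \<nu> t \<partial>lborel)"
    by (rule nn_integral_cong) (simp add: g_def indicator_def)
  finally show ?thesis .
qed

end

section \<open>Dyadic cells and displaced Carleson conditions\<close>

text \<open>These weights split the coefficients \<open>c\<close> in the Cauchy-Schwarz inequality. They have to be summable,
  and so have the \<open>(2 \<bar>l\<bar> + 1) c\<^sup>2 / u\<close> formed with them; as \<open>c\<close> decays like \<open>1 / l\<^sup>2\<close>, the exponent \<open>- 3/2\<close> balances the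
  two requirements.\<close>

definition shift_weight :: "int \<Rightarrow> real" where
  "shift_weight l = (1 + real_of_int \<bar>l\<bar>) powr (- 3 / 2)"

lemma shift_weight_pos: "0 < shift_weight l"
  by (simp add: shift_weight_def)

lemma nn_integral_shift_weight_finite: "(\<integral>\<^sup>+ l. ennreal (shift_weight l) \<partial>count_space UNIV) < \<infinity>"
proof -
  have sm: "summable (\<lambda>n. real (Suc n) powr (- 3 / 2))"
    by (subst summable_Suc_iff) (simp add: summable_real_powr_iff)
  have fin: "(\<integral>\<^sup>+ n. ennreal (real (Suc n) powr (- 3 / 2)) \<partial>count_space UNIV) < \<infinity>"
    unfolding nn_integral_count_space_nat by (subst suminf_ennreal2[OF _ sm]) auto
  have bij: "bij_betw int UNIV {0..}" "bij_betw (\<lambda>n. - int n) UNIV {..0}"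
    by (rule bij_betwI[where g = nat]; auto) (rule bij_betwI[where g = "\<lambda>z. nat (- z)"]; auto)
  have "(\<integral>\<^sup>+ l. ennreal (shift_weight l) \<partial>count_space UNIV)
    \<le> (\<integral>\<^sup>+ l. ennreal (shift_weight l) * indicator {0..} l + ennreal (shift_weight l) * indicator {..0} l \<partial>count_space UNIV)"
    by (intro nn_integral_mono) (auto simp: indicator_def)
  also have "\<dots> = (\<integral>\<^sup>+ l. ennreal (shift_weight l) \<partial>count_space {0..}) + (\<integral>\<^sup>+ l. ennreal (shift_weight l) \<partial>count_space {..0})"
    by (subst nn_integral_add) (auto simp: nn_integral_count_space_indicator)
  also have "\<dots> = (\<integral>\<^sup>+ n. ennreal (real (Suc n) powr (- 3 / 2)) \<partial>count_space UNIV) + (\<integral>\<^sup>+ n. ennreal (real (Suc n) powr (- 3 / 2)) \<partial>count_space UNIV)"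
    unfolding nn_integral_bij_count_space[OF bij(1), symmetric] nn_integral_bij_count_space[OF bij(2), symmetric]
    by (simp add: shift_weight_def)
  also have "\<dots> < \<infinity>" using fin by simp
  finally show ?thesis .
qed

lemma cell_coeff_pos: "0 < cell_coeff l"
  by (simp add: cell_coeff_def add_pos_nonneg)

lemma cell_coeff_shift_weight:
  "(cell_coeff l)\<^sup>2 / shift_weight l * (2 * real_of_int \<bar>l\<bar> + 1) \<le> 128 * shift_weight l"
proof -
  define a where "a = 1 + real_of_int \<bar>l\<bar>"
  have a: "1 \<le> a" by (simp add: a_def)
  have uu: "(shift_weight l)\<^sup>2 = 1 / a ^ 3"
  proof -
    have "(shift_weight l)\<^sup>2 = a powr (- 3)"
      unfolding shift_weight_def a_def[symmetric] by (simp add: power2_eq_square powr_add[symmetric])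
    also have "\<dots> = 1 / a ^ 3" using a by (simp add: powr_minus powr_realpow' divide_inverse)
    finally show ?thesis .
  qed
  have sq: "a\<^sup>2 \<le> 2 * (1 + (real_of_int l)\<^sup>2)"
    using sum_squares_bound[of 1 "real_of_int \<bar>l\<bar>"] by (simp add: a_def power2_sum)
  have "cell_coeff l \<le> 4 / (a\<^sup>2 / 2)"
    unfolding cell_coeff_def using sq a by (intro divide_left_mono) (auto intro!: mult_pos_pos add_pos_nonneg)
  then have "(cell_coeff l)\<^sup>2 \<le> (8 / a\<^sup>2)\<^sup>2"
    using cell_coeff_pos[of l] by (intro power_mono) auto
  then have "(cell_coeff l)\<^sup>2 * (2 * real_of_int \<bar>l\<bar> + 1) \<le> (8 / a\<^sup>2)\<^sup>2 * (2 * a)"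
    by (intro mult_mono) (auto simp: a_def)
  also have "\<dots> = 128 * (shift_weight l)\<^sup>2"
    unfolding uu using a by (simp add: field_simps power2_eq_square power3_eq_cube)
  finally show ?thesis
    using shift_weight_pos[of l] by (simp add: field_simps power2_eq_square)
qed

lemma weighted_sum_square_le:
  fixes A :: "int \<Rightarrow> ennreal"
  shows "(\<integral>\<^sup>+ l. ennreal (cell_coeff l) * A l \<partial>count_space UNIV)\<^sup>2
    \<le> (\<integral>\<^sup>+ l. ennreal (shift_weight l) \<partial>count_space UNIV)
      * (\<integral>\<^sup>+ l. ennreal ((cell_coeff l)\<^sup>2 / shift_weight l) * (A l)\<^sup>2 \<partial>count_space UNIV)"
proof -
  let ?f = "\<lambda>l. ennreal (sqrt (shift_weight l))"
  let ?g = "\<lambda>l. ennreal (cell_coeff l / sqrt (shift_weight l)) * A l"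
  have "ennreal (cell_coeff l) * A l = ?f l * ?g l" for l
    using shift_weight_pos[of l] cell_coeff_pos[of l]
    by (simp add: mult.assoc[symmetric] ennreal_mult[symmetric])
  moreover have "ennreal (shift_weight l) = (?f l)\<^sup>2" for l
    using shift_weight_pos[of l] by (simp add: ennreal_power)
  moreover have "ennreal ((cell_coeff l)\<^sup>2 / shift_weight l) * (A l)\<^sup>2 = (?g l)\<^sup>2" for l
    using shift_weight_pos[of l] cell_coeff_pos[of l] by (simp add: power_mult_distrib ennreal_power power_divide)
  ultimately show ?thesis
    using Cauchy_Schwarz_nn_integral[of ?f "count_space UNIV" ?g] by simp
qed

text \<open>The real part is raised by \<open>2\<close> because the cells describe where \<open>s + 2\<close> lies. With the scale \<open>2\<^sup>i\<close> of the
  corresponding boxes, \<open>s + 2\<close> has real part between \<open>2 \<cdot> 2\<^sup>i\<close> and \<open>4 \<cdot> 2\<^sup>i\<close>, so that scales below \<open>1\<close> never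
  occur.\<close>

definition layer :: "nat \<Rightarrow> complex set" where
  "layer i = {s. 0 < Re s \<and> 2 ^ (i + 1) \<le> Re s + 2 \<and> Re s + 2 < 2 ^ (i + 2)}"

definition cell :: "nat \<Rightarrow> int \<Rightarrow> complex set" where
  "cell i m = layer i \<inter> {s. of_int m * 2 ^ i \<le> Im s \<and> Im s < (of_int m + 1) * 2 ^ i}"

lemma layer_unique:
  assumes "s \<in> layer i" "s \<in> layer j" shows "i = j"
proof -
  have le: "i \<le> j" if "s \<in> layer i" "s \<in> layer j" for i j
  proof -
    have "(2::real) ^ (i + 1) < 2 ^ (j + 2)" using that by (simp add: layer_def)
    then have "i + 1 < j + 2" by (rule power_less_imp_less_exp[rotated]) simp
    then show ?thesis by simp
  qed
  show ?thesis using le[OF assms] le[OF assms(2,1)] by simp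
qed

lemma layer_exists:
  assumes "0 < Re s" obtains i where "s \<in> layer i"
proof -
  let ?P = "\<lambda>n::nat. Re s + 2 < 2 ^ (n + 2)"
  obtain k where "Re s + 2 < 2 ^ k" using real_arch_pow[of 2 "Re s + 2"] by auto
  then have k: "?P k" by (simp add: power_add) (use assms in linarith)
  define i where "i = (LEAST n. ?P n)"
  have i: "?P i" unfolding i_def by (rule LeastI[of ?P, OF k])
  have "2 ^ (i + 1) \<le> Re s + 2"
  proof (cases i)
    case 0
    then show ?thesis using assms by simp
  next
    case (Suc j)
    then have "\<not> ?P j" using not_less_Least[of j ?P] by (simp add: i_def)
    then show ?thesis using Suc by simp
  qed
  then show ?thesis using that i assms by (auto simp: layer_def)
qed

lemma cell_exists:
  assumes "0 < Re s" obtains i m where "s \<in> cell i m"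
proof -
  obtain i where i: "s \<in> layer i" using layer_exists[OF assms] .
  have d: "0 < (2::real) ^ i" by simp
  have "s \<in> cell i \<lfloor>Im s / 2 ^ i\<rfloor>"
    using i floor_correct[of "Im s / 2 ^ i"]
    unfolding pos_le_divide_eq[OF d] pos_divide_less_eq[OF d] by (simp add: cell_def)
  then show ?thesis using that by blast
qed

lemma dyadic_interval_unique:
  assumes d: "0 < (d::real)"
    and "of_int m * d \<le> y" "y < (of_int m + 1) * d" "of_int n * d \<le> y" "y < (of_int n + 1) * d"
  shows "m = n"
proof -
  have "of_int m * d < (of_int n + 1) * d" "of_int n * d < (of_int m + 1) * d" using assms by linarith+
  then have "real_of_int m < of_int n + 1" "real_of_int n < of_int m + 1"
    using d by (simp_all add: mult_less_cancel_right)
  then show ?thesis by linarith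
qed

text \<open>The union of all cells that, displaced by \<open>l\<close> steps of their own size, lie below the node \<open>(j, m)\<close>.
  The displacement \<open>l 2\<^sup>i\<close> depends on the layer, so the shadow is not a rectangle.\<close>

definition shadow :: "int \<Rightarrow> nat \<Rightarrow> int \<Rightarrow> complex set" where
  "shadow l j m = (\<Union>i\<le>j. layer i \<inter> {s. of_int m * 2 ^ j \<le> Im s + of_int l * 2 ^ i \<and> Im s + of_int l * 2 ^ i < (of_int m + 1) * 2 ^ j})"

lemma layer_borel: "layer i \<in> sets borel"
  unfolding layer_def by measurable

lemma strip_borel: "{s. a \<le> Im s + c \<and> Im s + c < b} \<in> sets borel"
  by auto

lemma cell_borel: "cell i m \<in> sets borel"
  unfolding cell_def using strip_borel[of _ 0] layer_borel by auto

lemma shadow_borel: "shadow l j m \<in> sets borel"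
  unfolding shadow_def by (intro sets.finite_UN sets.Int layer_borel strip_borel) auto

lemma layer_right: "layer i \<subseteq> \<complex>\<^sub>+"
  by (auto simp: layer_def)

text \<open>Within one layer all cells are displaced by the same amount, so the shadows of the two children are
  disjoint; the cell added at a new level lies in a layer of its own.\<close>

lemma tree_sum_cells_le:
  assumes \<mu>: "sets \<mu> = sets (restrict_space borel \<complex>\<^sub>+)"
  shows "tree_sum (\<lambda>i m. emeasure \<mu> (cell i (m - l))) j m \<le> emeasure \<mu> (shadow l j m)"
proof (induction j arbitrary: m)
  case 0
  have "cell 0 (m - l) = shadow l 0 m" by (auto simp: cell_def shadow_def)
  then show ?case by simp
next
  case (Suc j)
  have sub: "A \<in> sets \<mu>" if "A \<in> sets borel" "A \<subseteq> \<complex>\<^sub>+" for A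
    using that unfolding \<mu> by (subst sets_restrict_space_iff) (auto intro!: borel_open open_Collect_less continuous_intros)
  have cs: "cell (Suc j) (m - l) \<in> sets \<mu>" by (rule sub[OF cell_borel]) (use layer_right in \<open>auto simp: cell_def\<close>)
  have ss: "shadow l i n \<in> sets \<mu>" for i n by (rule sub[OF shadow_borel]) (use layer_right in \<open>auto simp: shadow_def\<close>)
  have d1: "shadow l j (2 * m) \<inter> shadow l j (2 * m + 1) = {}"
  proof (rule equals0I)
    fix s assume "s \<in> shadow l j (2 * m) \<inter> shadow l j (2 * m + 1)"
    then obtain i i' where "s \<in> layer i" "s \<in> layer i'"
      and 1: "Im s + of_int l * 2 ^ i < (of_int (2 * m) + 1) * 2 ^ j"
      and 2: "of_int (2 * m + 1) * 2 ^ j \<le> Im s + of_int l * 2 ^ i'"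
      unfolding shadow_def by blast
    then have "i = i'" using layer_unique by blast
    then show False using 1 2 by simp
  qed
  have d2: "(shadow l j (2 * m) \<union> shadow l j (2 * m + 1)) \<inter> cell (Suc j) (m - l) = {}"
    using layer_unique[of _ "Suc j"] by (fastforce simp: shadow_def cell_def)
  have child: "shadow l j n \<subseteq> shadow l (Suc j) m" if n: "n = 2 * m \<or> n = 2 * m + 1" for n
  proof
    fix s assume "s \<in> shadow l j n"
    then obtain i where i: "i \<le> j" "s \<in> layer i" "of_int n * 2 ^ j \<le> Im s + of_int l * 2 ^ i" "Im s + of_int l * 2 ^ i < (of_int n + 1) * 2 ^ j"
      unfolding shadow_def by blast
    have e: "of_int m * 2 ^ Suc j = (2 * of_int m) * (2::real) ^ j" "(of_int m + 1) * 2 ^ Suc j = (2 * of_int m + 2) * (2::real) ^ j"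
      by (simp_all add: algebra_simps)
    have "(2 * of_int m) * 2 ^ j \<le> of_int n * (2::real) ^ j" "(of_int n + 1) * 2 ^ j \<le> (2 * of_int m + 2) * (2::real) ^ j"
      using n by (auto intro!: mult_right_mono)
    then have "of_int m * 2 ^ Suc j \<le> Im s + of_int l * 2 ^ i" "Im s + of_int l * 2 ^ i < (of_int m + 1) * 2 ^ Suc j"
      unfolding e using i by linarith+
    then show "s \<in> shadow l (Suc j) m" unfolding shadow_def using i(1,2) by (intro UN_I[of i]) auto
  qed
  have "cell (Suc j) (m - l) \<subseteq> shadow l (Suc j) m"
    unfolding shadow_def by (rule subset_trans[OF _ UN_upper[of "Suc j"]]) (auto simp: cell_def algebra_simps)
  then have sub: "(shadow l j (2 * m) \<union> shadow l j (2 * m + 1)) \<union> cell (Suc j) (m - l) \<subseteq> shadow l (Suc j) m"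
    using child by blast
  have "tree_sum (\<lambda>i m. emeasure \<mu> (cell i (m - l))) (Suc j) m
    \<le> emeasure \<mu> (shadow l j (2 * m)) + emeasure \<mu> (shadow l j (2 * m + 1)) + emeasure \<mu> (cell (Suc j) (m - l))"
    using Suc.IH by (auto intro!: add_mono)
  also have "\<dots> = emeasure \<mu> ((shadow l j (2 * m) \<union> shadow l j (2 * m + 1)) \<union> cell (Suc j) (m - l))"
    using d1 d2 ss cs by (simp add: plus_emeasure)
  also have "\<dots> \<le> emeasure \<mu> (shadow l (Suc j) m)"
    by (rule emeasure_mono[OF sub ss])
  finally show ?case .
qed

text \<open>A cell below level \<open>j\<close> is displaced by at most \<open>\<bar>l\<bar> 2\<^sup>j\<close>, which is why \<open>2 \<bar>l\<bar> + 1\<close> neighbouring squares of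
  side \<open>4 \<cdot> 2\<^sup>j \<ge> 1\<close> cover the shadow. The factor \<open>4\<close> accounts for the real parts, which go up to \<open>4 \<cdot> 2\<^sup>j\<close>.\<close>

lemma shadow_subset_carleson_squares:
  "shadow l j m \<subseteq> (\<Union>e\<in>{- \<bar>l\<bar>..\<bar>l\<bar>}. carleson_square ((of_int (m + e) + 1 / 2) * 2 ^ j) (4 * 2 ^ j) \<inter> \<complex>\<^sub>+)"
proof
  fix s assume "s \<in> shadow l j m"
  then obtain i where i: "i \<le> j" "s \<in> layer i" "of_int m * 2 ^ j \<le> Im s + of_int l * 2 ^ i" "Im s + of_int l * 2 ^ i < (of_int m + 1) * 2 ^ j"
    unfolding shadow_def by blast
  have d: "0 < (2::real) ^ j" by simp
  have pw: "(2::real) ^ i \<le> 2 ^ j" using i(1) by (intro power_increasing) auto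
  have "\<bar>of_int l * (2::real) ^ i\<bar> \<le> of_int \<bar>l\<bar> * 2 ^ j"
    unfolding abs_mult using pw by (intro mult_mono) auto
  then have im: "of_int (m - \<bar>l\<bar>) * 2 ^ j \<le> Im s" "Im s < of_int (m + 1 + \<bar>l\<bar>) * 2 ^ j"
    using i by (simp_all add: algebra_simps abs_le_iff del: of_int_abs) 
  define n where "n = \<lfloor>Im s / 2 ^ j\<rfloor>"
  have n: "of_int n * 2 ^ j \<le> Im s" "Im s < (of_int n + 1) * 2 ^ j"
    using floor_correct[of "Im s / 2 ^ j"] unfolding pos_le_divide_eq[OF d] pos_divide_less_eq[OF d] by (simp_all add: n_def)
  have "m - \<bar>l\<bar> \<le> n" unfolding n_def le_floor_iff pos_le_divide_eq[OF d] using im(1) .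
  moreover have "n < m + 1 + \<bar>l\<bar>" unfolding n_def floor_less_iff pos_divide_less_eq[OF d] using im(2) .
  ultimately have "n - m \<in> {- \<bar>l\<bar>..\<bar>l\<bar>}" by auto
  moreover have "s \<in> carleson_square ((of_int (m + (n - m)) + 1 / 2) * 2 ^ j) (4 * 2 ^ j) \<inter> \<complex>\<^sub>+"
  proof -
    have "Re s + 2 < 2 ^ (i + 2)" "0 < Re s" using i(2) by (simp_all add: layer_def)
    moreover have "(2::real) ^ (i + 2) = 4 * 2 ^ i" by simp
    ultimately have "Re s \<le> 4 * 2 ^ j" using pw by linarith
    then show ?thesis using n \<open>0 < Re s\<close> d by (simp add: carleson_square_def algebra_simps)
  qed
  ultimately show "s \<in> (\<Union>e\<in>{- \<bar>l\<bar>..\<bar>l\<bar>}. carleson_square ((of_int (m + e) + 1 / 2) * 2 ^ j) (4 * 2 ^ j) \<inter> \<complex>\<^sub>+)"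
    by blast
qed

section \<open>From the Carleson condition to the embedding\<close>

lemma ennreal_mult_assoc2:
  "0 \<le> a \<Longrightarrow> 0 \<le> b \<Longrightarrow> ennreal a * (ennreal b * I) = ennreal (a * b) * I"
  by (simp add: ennreal_mult mult.assoc)

lemma ennreal_mult_assoc3:
  "0 \<le> a \<Longrightarrow> 0 \<le> b \<Longrightarrow> 0 \<le> c \<Longrightarrow> ennreal a * (ennreal b * (ennreal c * I)) = ennreal (a * b * c) * I"
  by (simp add: ennreal_mult mult.assoc)

context doubling_measure begin

text \<open>The Carleson condition is used on each of the squares covering the shadow, and three doublings compare
  the squares with the box: \<open>[0, 4 \<cdot> 2\<^sup>j] \<subseteq> [0, 8 \<cdot> 2\<^sup>j)\<close>.\<close>

lemma shifted_cells_carleson: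
  assumes \<mu>: "sets \<mu> = sets (restrict_space borel \<complex>\<^sub>+)"
    and k: "0 \<le> k" and bound: "carleson_bound (half_plane_measure \<nu>) \<mu> k"
  shows "tree_sum (\<lambda>i m. emeasure \<mu> (cell i (m - l))) j m
    \<le> ennreal ((2 * real_of_int \<bar>l\<bar> + 1) * (4 * R ^ 3 * k)) * emeasure (\<nu> \<Otimes>\<^sub>M lborel) (dyadic_box (2 ^ j) m)"
proof -
  let ?Q = "\<lambda>e. carleson_square ((of_int (m + e) + 1 / 2) * 2 ^ j) (4 * 2 ^ j) \<inter> \<complex>\<^sub>+"
  have Q_sets: "?Q e \<in> sets \<mu>" for e
  proof -
    have "closed (carleson_square a h)" for a h
      unfolding carleson_square_def by (intro closed_Collect_conj closed_Collect_le continuous_intros)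
    moreover have o: "open \<complex>\<^sub>+" by (intro open_Collect_less continuous_intros)
    ultimately have "?Q e \<in> sets borel" by (intro sets.Int borel_closed borel_open)
    then show ?thesis unfolding \<mu> using o by (subst sets_restrict_space_iff) auto
  qed
  have Q_le: "emeasure \<mu> (?Q e) \<le> ennreal (4 * R ^ 3 * k) * emeasure (\<nu> \<Otimes>\<^sub>M lborel) (dyadic_box (2 ^ j) m)" for e
  proof -
    have "(1::real) \<le> 4 * 2 ^ j" using one_le_power[of "2::real" j] by linarith
    then have "emeasure \<mu> (?Q e) \<le> ennreal k * emeasure (half_plane_measure \<nu>) (carleson_square ((of_int (m + e) + 1 / 2) * 2 ^ j) (4 * 2 ^ j))"
      using bound unfolding carleson_bound_def by blast
    also have "\<dots> = ennreal k * (emeasure \<nu> {0..4 * 2 ^ j} * ennreal (4 * 2 ^ j))"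
      by (subst emeasure_carleson_square) auto
    also have "\<dots> \<le> ennreal k * ((ennreal (R ^ 3) * emeasure \<nu> {0..<2 ^ j}) * ennreal (4 * 2 ^ j))"
    proof (intro mult_left_mono mult_right_mono)
      have "emeasure \<nu> {0..4 * 2 ^ j} \<le> emeasure \<nu> {0..<2 ^ 3 * 2 ^ j}"
      proof (rule emeasure_mono[OF subsetI])
        fix x :: real assume x: "x \<in> {0..4 * 2 ^ j}"
        have "(4::real) * 2 ^ j < 2 ^ 3 * 2 ^ j" by simp
        with x show "x \<in> {0..<2 ^ 3 * 2 ^ j}"
          unfolding atLeastAtMost_iff atLeastLessThan_iff by linarith
      qed simp
      also have "\<dots> \<le> ennreal (R ^ 3) * emeasure \<nu> {0..<2 ^ j}" by (rule doubling_power) simp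
      finally show "emeasure \<nu> {0..4 * 2 ^ j} \<le> ennreal (R ^ 3) * emeasure \<nu> {0..<2 ^ j}" .
    qed auto
    also have "\<dots> = ennreal (4 * R ^ 3 * k) * emeasure (\<nu> \<Otimes>\<^sub>M lborel) (dyadic_box (2 ^ j) m)"
      using k R_ge_1 by (simp add: emeasure_dyadic_box ennreal_mult mult_ac)
    finally show ?thesis .
  qed
  have "tree_sum (\<lambda>i m. emeasure \<mu> (cell i (m - l))) j m \<le> emeasure \<mu> (shadow l j m)"
    by (rule tree_sum_cells_le[OF \<mu>])
  also have "\<dots> \<le> emeasure \<mu> (\<Union>e\<in>{- \<bar>l\<bar>..\<bar>l\<bar>}. ?Q e)"
    by (intro emeasure_mono shadow_subset_carleson_squares sets.finite_UN Q_sets finite_atLeastAtMost_int)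
  also have "\<dots> \<le> (\<Sum>e\<in>{- \<bar>l\<bar>..\<bar>l\<bar>}. emeasure \<mu> (?Q e))"
    using Q_sets by (intro emeasure_subadditive_finite) auto
  also have "\<dots> \<le> (\<Sum>e\<in>{- \<bar>l\<bar>..\<bar>l\<bar>}. ennreal (4 * R ^ 3 * k) * emeasure (\<nu> \<Otimes>\<^sub>M lborel) (dyadic_box (2 ^ j) m))"
    by (intro sum_mono Q_le)
  also have "\<dots> = ennreal ((2 * real_of_int \<bar>l\<bar> + 1) * (4 * R ^ 3 * k)) * emeasure (\<nu> \<Otimes>\<^sub>M lborel) (dyadic_box (2 ^ j) m)"
  proof -
    have "real (card {- \<bar>l\<bar>..\<bar>l\<bar>}) = 2 * real_of_int \<bar>l\<bar> + 1" by simp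
    then have "of_nat (card {- \<bar>l\<bar>..\<bar>l\<bar>}) = ennreal (2 * real_of_int \<bar>l\<bar> + 1)"
      by (simp only: ennreal_of_nat_eq_real_of_nat)
    then show ?thesis using k R_ge_1 by (simp add: ennreal_mult mult.assoc)
  qed
  finally show ?thesis .
qed

lemma dyadic_box_children: "dyadic_box d (2 * m) \<union> dyadic_box d (2 * m + 1) \<subseteq> dyadic_box (2 * d) m" if "0 \<le> d"
proof -
  have e: "of_int m * (2 * d) = (2 * of_int m) * d" "(of_int m + 1) * (2 * d) = (2 * of_int m + 2) * d"
    by (simp_all add: algebra_simps)
  have "(2 * of_int m) * d \<le> (2 * of_int m + 1) * d" "(2 * of_int m + 1) * d \<le> (2 * of_int m + 2) * d"
    using that by (intro mult_right_mono; simp)+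
  then show ?thesis unfolding dyadic_box_def e using that by (auto simp: algebra_simps)
qed

lemma disjoint_family_dyadic_box: "0 < d \<Longrightarrow> disjoint_family (dyadic_box d)"
  unfolding disjoint_family_on_def dyadic_box_def using dyadic_interval_unique[of d] by fastforce

text \<open>In each cell the bound by box averages is squared with the weighted Cauchy-Schwarz inequality. For
  fixed \<open>l\<close> the sum over all cells is an instance of the dyadic embedding theorem, with the Carleson constant
  of the cells displaced by \<open>l\<close>; summing over \<open>l\<close> converges by the choice of the weights. The number
  \<open>2048\<close> is \<open>128 \<cdot> 16\<close>, the first factor coming from the weights and the second from the embedding
  constant \<open>4\<close> times the \<open>4\<close> of the displaced Carleson condition.\<close>

theorem laplace_carleson_embedding:
  assumes \<mu>: "sets \<mu> = sets (restrict_space borel \<complex>\<^sub>+)"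
    and k: "0 < k" and bound: "carleson_bound (half_plane_measure \<nu>) \<mu> k"
    and f: "set_integrable lborel {0<..} f"
  defines "S \<equiv> \<integral>\<^sup>+ l. ennreal (shift_weight l) \<partial>count_space UNIV"
  shows "(\<integral>\<^sup>+ s. ennreal ((norm (laplace f (s + 2)))\<^sup>2) \<partial>\<mu>)
    \<le> S * S * ennreal (2048 * R ^ 3 * k) * (\<integral>\<^sup>+ t\<in>{0<..}. ennreal ((norm (f t))\<^sup>2) * laplace_weight \<nu> t \<partial>lborel)"
proof -
  let ?M = "\<nu> \<Otimes>\<^sub>M (lborel :: real measure)"
  let ?F = "\<lambda>s. ennreal (norm (laplace f (s + 2)))"
  let ?G = "\<lambda>z. norm (laplace f (Complex (fst z) (snd z)))"
  let ?w = "\<lambda>l. ennreal ((cell_coeff l)\<^sup>2 / shift_weight l)"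
  define A where "A = (\<lambda>i m. (\<integral>\<^sup>+ z\<in>dyadic_box (2 ^ i) m. ennreal (?G z) \<partial>?M) / emeasure ?M (dyadic_box (2 ^ i) m))"
  define Q where "Q = (\<integral>\<^sup>+ z. ennreal ((?G z)\<^sup>2) \<partial>?M)"
  have [measurable]: "(\<lambda>z. laplace f (Complex (fst z) (snd z))) \<in> borel_measurable ?M"
    using laplace_pair_measurable[OF f] by (simp add: case_prod_unfold)
  have borel_\<mu>: "g \<in> borel_measurable \<mu>" if "g \<in> borel_measurable borel" for g :: "complex \<Rightarrow> ennreal"
    using that by (subst measurable_cong_sets[OF \<mu> refl]) (rule measurable_restrict_space1)
  have cell_sets [measurable]: "cell i m \<in> sets \<mu>" for i m
    unfolding \<mu> using cell_borel[of i m] layer_right[of i]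
    by (subst sets_restrict_space_iff) (auto simp: cell_def intro!: borel_open open_Collect_less continuous_intros)
  have F_meas [measurable]: "?F \<in> borel_measurable \<mu>"
  proof (rule borel_\<mu>)
    have "(\<lambda>s::complex. s + 2) \<in> borel_measurable borel" by measurable
    from measurable_compose[OF this laplace_measurable[OF f]]
    show "?F \<in> borel_measurable borel" by measurable
  qed
  have pointwise: "?F s \<le> (\<integral>\<^sup>+ l. ennreal (cell_coeff l) * A i (m + l) \<partial>count_space UNIV)"
    if s: "s \<in> cell i m" for s i m
  proof -
    let ?d = "(2::real) ^ i"
    let ?J = "\<lambda>l. \<integral>\<^sup>+ z\<in>dyadic_box ?d (m + l). ennreal (?G z) \<partial>?M"
    define n where "n = measure \<nu> {0..<?d}"
    have nE: "emeasure \<nu> {0..<?d} = ennreal n"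
      unfolding n_def using fin[of ?d] by (intro emeasure_eq_ennreal_measure) auto
    have n: "0 < n" using pos[of ?d] by (simp add: nE)
    have x: "2 * ?d \<le> Re s + 2" "Re s + 2 \<le> 4 * ?d" and y: "of_int m * ?d \<le> Im s" "Im s < (of_int m + 1) * ?d"
      using s by (auto simp: cell_def layer_def)
    have "s + 2 = Complex (Re s + 2) (Im s)" by (simp add: complex_eq_iff)
    then have "ennreal n * ?F s \<le> (\<integral>\<^sup>+ l. ennreal (cell_coeff l / ?d) * ?J l \<partial>count_space UNIV)"
      using laplace_le_box_sums[OF f _ x y] by (simp add: nE)
    also have "\<dots> = (\<integral>\<^sup>+ l. ennreal n * (ennreal (cell_coeff l) * A i (m + l)) \<partial>count_space UNIV)"
    proof (rule nn_integral_cong)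
      fix l
      have "A i (m + l) = ennreal (1 / (n * ?d)) * ?J l"
        using n by (simp add: A_def emeasure_dyadic_box nE ennreal_mult[symmetric] divide_ennreal_def inverse_ennreal divide_inverse mult.commute)
      then have "ennreal n * (ennreal (cell_coeff l) * A i (m + l)) = ennreal (n * cell_coeff l * (1 / (n * ?d))) * ?J l"
        using n cell_coeff_pos[of l] by (simp only: ennreal_mult_assoc3 less_imp_le divide_nonneg_pos zero_le_one mult_pos_pos zero_less_power zero_less_numeral)
      also have "n * cell_coeff l * (1 / (n * ?d)) = cell_coeff l / ?d" using n by simp
      finally show "ennreal (cell_coeff l / ?d) * ?J l = ennreal n * (ennreal (cell_coeff l) * A i (m + l))" ..
    qed
    also have "\<dots> = ennreal n * (\<integral>\<^sup>+ l. ennreal (cell_coeff l) * A i (m + l) \<partial>count_space UNIV)"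
      by (rule nn_integral_cmult) simp
    finally show ?thesis using n by (simp add: ennreal_mult_le_mult_iff)
  qed
  have square: "(?F s)\<^sup>2 \<le> S * (\<integral>\<^sup>+ l. ?w l * (A i (m + l))\<^sup>2 \<partial>count_space UNIV)" if s: "s \<in> cell i m" for s i m
    using power_mono[OF pointwise[OF s], of 2] weighted_sum_square_le[of "\<lambda>l. A i (m + l)"]
    unfolding S_def by (meson order_trans zero_le)
  have shifted: "(\<integral>\<^sup>+ i. \<integral>\<^sup>+ m. emeasure \<mu> (cell i m) * (A i (m + l))\<^sup>2 \<partial>count_space UNIV \<partial>count_space UNIV)
    \<le> ennreal (4 * ((2 * real_of_int \<bar>l\<bar> + 1) * (4 * R ^ 3 * k))) * Q" for l
  proof -
    have bij: "bij_betw (\<lambda>m. m - l) UNIV UNIV" by (rule bij_betwI[where g = "\<lambda>m. m + l"]) auto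
    have "(\<integral>\<^sup>+ m. emeasure \<mu> (cell i m) * (A i (m + l))\<^sup>2 \<partial>count_space UNIV)
      = (\<integral>\<^sup>+ m. emeasure \<mu> (cell i (m - l)) * (A i m)\<^sup>2 \<partial>count_space UNIV)" for i
      by (subst nn_integral_bij_count_space[OF bij, symmetric]) simp
    moreover have "(\<integral>\<^sup>+ i. \<integral>\<^sup>+ m. emeasure \<mu> (cell i (m - l)) * (A i m)\<^sup>2 \<partial>count_space UNIV \<partial>count_space UNIV)
      \<le> ennreal (4 * ((2 * real_of_int \<bar>l\<bar> + 1) * (4 * R ^ 3 * k))) * Q"
      unfolding A_def Q_def
    proof (rule dyadic_carleson_measure)
      show "0 < (2 * real_of_int \<bar>l\<bar> + 1) * (4 * R ^ 3 * k)" using k R_ge_1 by (intro mult_pos_pos) auto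
      show "dyadic_box (2 ^ i) m \<in> sets ?M" for i m by (rule dyadic_box_in_sets)
      show "0 < emeasure ?M (dyadic_box (2 ^ i) m)" for i m
        using pos[of "2 ^ i"] by (simp add: emeasure_dyadic_box ennreal_zero_less_mult_iff)
      show "emeasure ?M (dyadic_box (2 ^ i) m) < \<infinity>" for i m
        using fin[of "2 ^ i"] by (simp add: emeasure_dyadic_box ennreal_mult_less_top)
      show "dyadic_box (2 ^ i) (2 * m) \<union> dyadic_box (2 ^ i) (2 * m + 1) \<subseteq> dyadic_box (2 ^ Suc i) m" for i m
        using dyadic_box_children[of "2 ^ i" m] by simp
      show "disjoint_family (dyadic_box (2 ^ i))" for i by (rule disjoint_family_dyadic_box) simp
      show "tree_sum (\<lambda>i m. emeasure \<mu> (cell i (m - l))) i m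
        \<le> ennreal ((2 * real_of_int \<bar>l\<bar> + 1) * (4 * R ^ 3 * k)) * emeasure ?M (dyadic_box (2 ^ i) m)" for i m
        using k by (intro shifted_cells_carleson[OF \<mu> _ bound]) simp
    qed auto
    ultimately show ?thesis by simp
  qed
  have "(\<integral>\<^sup>+ s. ennreal ((norm (laplace f (s + 2)))\<^sup>2) \<partial>\<mu>)
    \<le> (\<integral>\<^sup>+ s. \<integral>\<^sup>+ p. (?F s)\<^sup>2 * indicator (cell (fst p) (snd p)) s \<partial>count_space UNIV \<partial>\<mu>)"
  proof (rule nn_integral_mono)
    fix s assume "s \<in> space \<mu>"
    then have "0 < Re s" using sets_eq_imp_space_eq[OF \<mu>] by (simp add: space_restrict_space)
    then obtain i m where s: "s \<in> cell i m" using cell_exists by blast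
    have "ennreal ((norm (laplace f (s + 2)))\<^sup>2) = (?F s)\<^sup>2 * indicator (cell (fst (i, m)) (snd (i, m))) s"
      using s by (simp add: ennreal_power)
    also have "\<dots> \<le> (\<integral>\<^sup>+ p. (?F s)\<^sup>2 * indicator (cell (fst p) (snd p)) s \<partial>count_space UNIV)"
      by (rule nn_integral_ge_point) simp
    finally show "ennreal ((norm (laplace f (s + 2)))\<^sup>2)
      \<le> (\<integral>\<^sup>+ p. (?F s)\<^sup>2 * indicator (cell (fst p) (snd p)) s \<partial>count_space UNIV)" .
  qed
  also have "\<dots> = (\<integral>\<^sup>+ p. \<integral>\<^sup>+ s. (?F s)\<^sup>2 * indicator (cell (fst p) (snd p)) s \<partial>\<mu> \<partial>count_space UNIV)"
    by (rule nn_integral_count_space_nn_integral) auto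
  also have "\<dots> = (\<integral>\<^sup>+ i. \<integral>\<^sup>+ m. \<integral>\<^sup>+ s. (?F s)\<^sup>2 * indicator (cell i m) s \<partial>\<mu> \<partial>count_space UNIV \<partial>count_space UNIV)"
    by (subst nn_integral_fst_count_space[symmetric]) simp
  also have "\<dots> \<le> (\<integral>\<^sup>+ i. \<integral>\<^sup>+ m. S * (\<integral>\<^sup>+ l. ?w l * (emeasure \<mu> (cell i m) * (A i (m + l))\<^sup>2) \<partial>count_space UNIV) \<partial>count_space UNIV \<partial>count_space UNIV)"
  proof (intro nn_integral_mono)
    fix i m
    let ?V = "S * (\<integral>\<^sup>+ l. ?w l * (A i (m + l))\<^sup>2 \<partial>count_space UNIV)"
    have "(\<integral>\<^sup>+ s. (?F s)\<^sup>2 * indicator (cell i m) s \<partial>\<mu>) \<le> (\<integral>\<^sup>+ s. ?V * indicator (cell i m) s \<partial>\<mu>)"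
      using square by (intro nn_integral_mono) (auto simp: indicator_def)
    also have "\<dots> = ?V * emeasure \<mu> (cell i m)" by (rule nn_integral_cmult_indicator) simp
    also have "\<dots> = S * (emeasure \<mu> (cell i m) * (\<integral>\<^sup>+ l. ?w l * (A i (m + l))\<^sup>2 \<partial>count_space UNIV))"
      by (simp only: mult_ac)
    also have "\<dots> = S * (\<integral>\<^sup>+ l. ?w l * (emeasure \<mu> (cell i m) * (A i (m + l))\<^sup>2) \<partial>count_space UNIV)"
    proof -
      have "emeasure \<mu> (cell i m) * (\<integral>\<^sup>+ l. ?w l * (A i (m + l))\<^sup>2 \<partial>count_space UNIV)
        = (\<integral>\<^sup>+ l. emeasure \<mu> (cell i m) * (?w l * (A i (m + l))\<^sup>2) \<partial>count_space UNIV)"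
        by (rule nn_integral_cmult[symmetric]) simp
      then show ?thesis by (simp only: mult.left_commute)
    qed
    finally show "(\<integral>\<^sup>+ s. (?F s)\<^sup>2 * indicator (cell i m) s \<partial>\<mu>)
      \<le> S * (\<integral>\<^sup>+ l. ?w l * (emeasure \<mu> (cell i m) * (A i (m + l))\<^sup>2) \<partial>count_space UNIV)" .
  qed
  also have "\<dots> = S * (\<integral>\<^sup>+ i. \<integral>\<^sup>+ m. \<integral>\<^sup>+ l. ?w l * (emeasure \<mu> (cell i m) * (A i (m + l))\<^sup>2) \<partial>count_space UNIV \<partial>count_space UNIV \<partial>count_space UNIV)"
    by (simp add: nn_integral_cmult)
  also have "(\<integral>\<^sup>+ i. \<integral>\<^sup>+ m. \<integral>\<^sup>+ l. ?w l * (emeasure \<mu> (cell i m) * (A i (m + l))\<^sup>2) \<partial>count_space UNIV \<partial>count_space UNIV \<partial>count_space UNIV)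
    = (\<integral>\<^sup>+ i. \<integral>\<^sup>+ l. \<integral>\<^sup>+ m. ?w l * (emeasure \<mu> (cell i m) * (A i (m + l))\<^sup>2) \<partial>count_space UNIV \<partial>count_space UNIV \<partial>count_space UNIV)"
    by (intro nn_integral_cong nn_integral_count_space_nn_integral) auto
  also have "\<dots> = (\<integral>\<^sup>+ l. \<integral>\<^sup>+ i. \<integral>\<^sup>+ m. ?w l * (emeasure \<mu> (cell i m) * (A i (m + l))\<^sup>2) \<partial>count_space UNIV \<partial>count_space UNIV \<partial>count_space UNIV)"
    by (intro nn_integral_count_space_nn_integral) auto
  also have "\<dots> = (\<integral>\<^sup>+ l. ?w l * (\<integral>\<^sup>+ i. \<integral>\<^sup>+ m. emeasure \<mu> (cell i m) * (A i (m + l))\<^sup>2 \<partial>count_space UNIV \<partial>count_space UNIV) \<partial>count_space UNIV)"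
    by (simp add: nn_integral_cmult)
  also have "\<dots> \<le> (\<integral>\<^sup>+ l. ennreal (shift_weight l) * (ennreal (2048 * R ^ 3 * k) * Q) \<partial>count_space UNIV)"
  proof (rule nn_integral_mono)
    fix l
    let ?a = "2 * real_of_int \<bar>l\<bar> + 1"
    have "?w l * (\<integral>\<^sup>+ i. \<integral>\<^sup>+ m. emeasure \<mu> (cell i m) * (A i (m + l))\<^sup>2 \<partial>count_space UNIV \<partial>count_space UNIV)
      \<le> ?w l * (ennreal (4 * (?a * (4 * R ^ 3 * k))) * Q)"
      by (rule mult_left_mono[OF shifted]) simp
    also have "\<dots> = ennreal ((cell_coeff l)\<^sup>2 / shift_weight l * ?a * (16 * R ^ 3 * k)) * Q"
    proof -
      have "(cell_coeff l)\<^sup>2 / shift_weight l * (4 * (?a * (4 * R ^ 3 * k))) = (cell_coeff l)\<^sup>2 / shift_weight l * ?a * (16 * R ^ 3 * k)"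
        by simp
      moreover have "0 \<le> (cell_coeff l)\<^sup>2 / shift_weight l" "0 \<le> 4 * (?a * (4 * R ^ 3 * k))"
        using shift_weight_pos[of l] R_ge_1 k by simp_all
      ultimately show ?thesis by (simp only: ennreal_mult_assoc2)
    qed
    also have "\<dots> \<le> ennreal (128 * shift_weight l * (16 * R ^ 3 * k)) * Q"
      using cell_coeff_shift_weight[of l] R_ge_1 k by (intro mult_right_mono ennreal_leI) auto
    also have "\<dots> = ennreal (shift_weight l) * (ennreal (2048 * R ^ 3 * k) * Q)"
    proof -
      have "128 * shift_weight l * (16 * R ^ 3 * k) = shift_weight l * (2048 * R ^ 3 * k)" by simp
      moreover have "0 \<le> shift_weight l" "0 \<le> 2048 * R ^ 3 * k"
        using shift_weight_pos[of l] R_ge_1 k by simp_all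
      ultimately show ?thesis by (simp only: ennreal_mult_assoc2)
    qed
    finally show "?w l * (\<integral>\<^sup>+ i. \<integral>\<^sup>+ m. emeasure \<mu> (cell i m) * (A i (m + l))\<^sup>2 \<partial>count_space UNIV \<partial>count_space UNIV)
      \<le> ennreal (shift_weight l) * (ennreal (2048 * R ^ 3 * k) * Q)" .
  qed
  also have "\<dots> = S * (ennreal (2048 * R ^ 3 * k) * Q)"
    unfolding S_def by (rule nn_integral_multc) simp
  finally have "(\<integral>\<^sup>+ s. ennreal ((norm (laplace f (s + 2)))\<^sup>2) \<partial>\<mu>) \<le> S * (S * (ennreal (2048 * R ^ 3 * k) * Q))"
    by (simp add: mult_left_mono)
  also have "\<dots> \<le> S * (S * (ennreal (2048 * R ^ 3 * k) * (\<integral>\<^sup>+ t\<in>{0<..}. ennreal ((norm (f t))\<^sup>2) * laplace_weight \<nu> t \<partial>lborel)))"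
    unfolding Q_def by (intro mult_left_mono laplace_zen_norm_le f) auto
  finally show ?thesis by (simp only: mult.assoc)
qed

end

section \<open>Norms and test functions\<close>

lemma nn_integral_L2_norm:
  assumes "f \<in> L2_space M"
  shows "(\<integral>\<^sup>+ x. ennreal ((cmod (f x))\<^sup>2) \<partial>M) = ennreal ((L2_norm M f)\<^sup>2)"
  using assms unfolding L2_space_def L2_norm_def
  by (subst nn_integral_eq_integral) (auto intro!: Bochner_Integration.integral_nonneg)

lemma L2_norm_nonneg: "0 \<le> L2_norm M f"
  by (simp add: L2_norm_def)

lemma zero_in_L2_space: "(\<lambda>_. 0) \<in> L2_space M"
  by (simp add: L2_space_def)

lemma L2_norm_zero: "L2_norm M (\<lambda>_. 0) = 0"
  by (simp add: L2_norm_def)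

lemma L2_onorm_least:
  assumes "0 \<le> c" and le: "\<And>f. f \<in> L2_space M \<Longrightarrow> L2_norm N (F f) \<le> c * L2_norm M f"
  shows "L2_onorm M N F \<le> c"
  unfolding L2_onorm_def
proof (rule cSUP_least)
  show "L2_space M \<noteq> {}" using zero_in_L2_space[of M] by blast
  fix f assume f: "f \<in> L2_space M"
  show "L2_norm N (F f) / L2_norm M f \<le> c"
    using le[OF f] L2_norm_nonneg[of M f] assms(1) by (cases "L2_norm M f = 0") (auto simp: divide_le_eq)
qed

text \<open>A function of norm \<open>0\<close> does not contribute to the supremum, so for it the second inequality rests on the
  boundedness of \<open>F\<close>.\<close>

lemma L2_onorm_bounds:
  assumes F: "bounded_linear_L2 M N F"
  shows "0 \<le> L2_onorm M N F"
    and "f \<in> L2_space M \<Longrightarrow> L2_norm N (F f) \<le> L2_onorm M N F * L2_norm M f"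
proof -
  obtain C where C: "\<And>f. f \<in> L2_space M \<Longrightarrow> L2_norm N (F f) \<le> C * L2_norm M f"
    using F unfolding bounded_linear_L2_def by blast
  have bdd: "bdd_above ((\<lambda>f. L2_norm N (F f) / L2_norm M f) ` L2_space M)"
  proof (rule bdd_aboveI2)
    fix f assume "f \<in> L2_space M"
    then show "L2_norm N (F f) / L2_norm M f \<le> \<bar>C\<bar>"
      using C[of f] L2_norm_nonneg[of M f]
      by (cases "L2_norm M f = 0") (auto simp: divide_le_eq intro: order_trans mult_right_mono)
  qed
  have up: "L2_norm N (F f) / L2_norm M f \<le> L2_onorm M N F" if "f \<in> L2_space M" for f
    unfolding L2_onorm_def by (rule cSUP_upper[OF that bdd])
  from up[OF zero_in_L2_space] show "0 \<le> L2_onorm M N F" by (simp add: L2_norm_zero)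
  show "L2_norm N (F f) \<le> L2_onorm M N F * L2_norm M f" if f: "f \<in> L2_space M"
    using up[OF f] C[OF f] L2_norm_nonneg[of M f] L2_norm_nonneg[of N "F f"]
    by (cases "L2_norm M f = 0") (auto simp: divide_le_eq)
qed

lemma cos_ge_of_abs_le_half:
  fixes u :: real assumes "\<bar>u\<bar> \<le> 1 / 2" shows "7 / 8 \<le> cos u"
proof -
  have "\<bar>sin (u / 2)\<bar> \<le> 1 / 4" using abs_sin_x_le_abs_x[of "u / 2"] assms by simp
  then have "(sin (u / 2))\<^sup>2 \<le> (1 / 4)\<^sup>2" by (intro power2_le_iff_abs_le[THEN iffD2]) auto
  then show ?thesis using cos_double_sin[of "u / 2"] by (simp add: power2_eq_square)
qed

lemma Re_exp_ge:
  assumes "0 \<le> x * t" "x * t \<le> 1" "\<bar>(a - y) * t\<bar> \<le> 1 / 2"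
  shows "1 / 4 \<le> Re (exp (\<i> * of_real (a * t)) * exp (- (Complex x y * of_real t)))"
proof -
  have "exp (\<i> * of_real (a * t)) * exp (- (Complex x y * of_real t)) = exp (Complex (- (x * t)) ((a - y) * t))"
    by (simp add: exp_add[symmetric] Complex_eq algebra_simps)
  then have eq: "Re (exp (\<i> * of_real (a * t)) * exp (- (Complex x y * of_real t))) = exp (- (x * t)) * cos ((a - y) * t)"
    by (simp add: Re_exp)
  have "(1::real) / 3 \<le> exp (- 1)" using exp_le by (simp add: exp_minus field_simps)
  also have "\<dots> \<le> exp (- (x * t))" using assms by simp
  \<comment> \<open>The product \<open>7/24\<close> of the two bounds exceeds \<open>1/4\<close>.\<close>
  finally have "1 / 3 * (7 / 8) \<le> exp (- (x * t)) * cos ((a - y) * t)"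
    using cos_ge_of_abs_le_half[OF assms(3)] by (intro mult_mono) auto
  then show ?thesis unfolding eq by simp
qed

text \<open>For \<open>s = x + i y\<close> in the square and \<open>t \<le> \<delta>/h\<close> both \<open>x t\<close> and \<open>2 \<bar>a - y\<bar> t\<close> are at most \<open>1\<close>. Hence the integrand does
  not oscillate: its real part is at least \<open>1/4\<close> on an interval of length \<open>\<delta>/2h\<close>.\<close>

lemma laplace_wave_packet_ge:
  assumes \<delta>: "0 < \<delta>" "\<delta> \<le> 1" and h: "0 < h" and s: "s \<in> carleson_square a h"
  shows "\<delta> / (8 * h) \<le> norm (laplace (\<lambda>t. indicator {\<delta> / (2 * h)..\<delta> / h} t *\<^sub>R exp (\<i> * of_real (a * t))) s)"
proof -
  let ?J = "{\<delta> / (2 * h)..\<delta> / h}"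
  let ?e = "\<lambda>t. exp (\<i> * of_real (a * t)) * exp (- (s * of_real t))"
  have J0: "0 < \<delta> / (2 * h)" "\<delta> / (2 * h) \<le> \<delta> / h" using \<delta> h by (simp_all add: field_simps)
  have int: "integrable lborel (\<lambda>t. indicat_real ?J t *\<^sub>R ?e t)"
    using borel_integrable_atLeastAtMost'[of "\<delta> / (2 * h)" "\<delta> / h" ?e] unfolding set_integrable_def
    by (simp add: continuous_intros)
  have eq: "laplace (\<lambda>t. indicator ?J t *\<^sub>R exp (\<i> * of_real (a * t))) s = (LINT t|lborel. indicat_real ?J t *\<^sub>R ?e t)"
    unfolding laplace_def set_lebesgue_integral_def
    using J0 by (intro Bochner_Integration.integral_cong) (auto simp: indicator_def)
  have pt: "1 / 4 \<le> Re (?e t)" if t: "t \<in> ?J" for t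
  proof -
    have t0: "0 \<le> t" "t \<le> \<delta> / h" using t J0 by auto
    have th: "h * t \<le> 1" using t0(2) h \<delta> by (simp add: field_simps)
    have s': "0 \<le> Re s" "Re s \<le> h" "a - h / 2 \<le> Im s" "Im s \<le> a + h / 2"
      using s by (auto simp: carleson_square_def)
    then have im: "\<bar>a - Im s\<bar> \<le> h / 2" by linarith
    have "Re s * t \<le> h * t" using s' t0 by (intro mult_right_mono) auto
    moreover have "\<bar>a - Im s\<bar> * t \<le> h / 2 * t" using im t0 by (intro mult_right_mono) auto
    ultimately show ?thesis
      using Re_exp_ge[of "Re s" t a "Im s"] s' t0 th by (simp add: abs_mult)
  qed
  have "\<delta> / (8 * h) = (LINT t|lborel. indicat_real ?J t * (1 / 4))"
    using J0 h by (simp add: field_simps)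
  also have "\<dots> \<le> (LINT t|lborel. Re (indicat_real ?J t *\<^sub>R ?e t))"
  proof (rule integral_mono)
    show "integrable lborel (\<lambda>t. indicat_real ?J t * (1 / 4))"
      by (intro integrable_mult_left integrable_real_indicator) (auto simp: emeasure_lborel_Icc_eq)
    show "integrable lborel (\<lambda>t. Re (indicat_real ?J t *\<^sub>R ?e t))" using int by (rule integrable_Re)
    show "indicat_real ?J t * (1 / 4) \<le> Re (indicat_real ?J t *\<^sub>R ?e t)" for t
      using pt[of t] by (cases "t \<in> ?J") auto
  qed
  also have "\<dots> = Re (LINT t|lborel. indicat_real ?J t *\<^sub>R ?e t)" using int by (rule integral_Re)
  also have "\<dots> \<le> norm (LINT t|lborel. indicat_real ?J t *\<^sub>R ?e t)" by (rule complex_Re_le_cmod)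
  finally show ?thesis unfolding eq .
qed

lemma times_exp_measurable:
  fixes f :: "real \<Rightarrow> complex"
  assumes [measurable]: "f \<in> borel_measurable borel"
  shows "(\<lambda>t. indicat_real {0<..} t *\<^sub>R (f t * exp (- (s * of_real t)))) \<in> borel_measurable borel"
    and "(\<lambda>t. indicat_real {0<..} t *\<^sub>R (of_real (exp (c * t)) * f t)) \<in> borel_measurable borel"
  by measurable

context doubling_measure begin

abbreviation "W T \<equiv> weighted_interval T (laplace_weight \<nu>)"

lemma sets_W: "sets (W T) = sets (restrict_space borel {0..T})"
  by (simp add: weighted_interval_def cong: sets_restrict_space_cong)

lemma nn_integral_W:
  assumes "g \<in> borel_measurable (W T)"
  shows "(\<integral>\<^sup>+ t. g t \<partial>W T) = (\<integral>\<^sup>+ t. laplace_weight \<nu> t * g t * indicator {0..T} t \<partial>lborel)"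
proof -
  have "g \<in> borel_measurable (restrict_space lborel {0..T})"
    using assms by (simp add: weighted_interval_def)
  moreover have "laplace_weight \<nu> \<in> borel_measurable (restrict_space lborel {0..T})"
    by (rule measurable_restrict_space1) simp
  ultimately show ?thesis
    unfolding weighted_interval_def
    by (simp add: nn_integral_density nn_integral_restrict_space)
qed

lemma zero_ext_measurable:
  assumes "f \<in> borel_measurable (W T)"
  shows "zero_ext T f \<in> borel_measurable borel"
proof -
  have "f \<in> borel_measurable (restrict_space borel {0..T})"
    using assms by (subst (asm) measurable_cong_sets[OF sets_W refl])
  then have "(\<lambda>t. indicat_real {0..T} t *\<^sub>R f t) \<in> borel_measurable borel"
    by (subst (asm) borel_measurable_restrict_space_iff) auto
  moreover have "(\<lambda>t. indicat_real {0..T} t *\<^sub>R f t) = zero_ext T f"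
    by (auto simp: zero_ext_def indicator_def)
  ultimately show ?thesis by simp
qed

text \<open>The weight decreases and is positive at \<open>T\<close>, so square integrability against it on \<open>[0, T]\<close> implies
  ordinary square integrability there, hence integrability.\<close>

lemma integrable_zero_ext:
  assumes T: "0 < T" and f: "f \<in> L2_space (W T)"
  shows "integrable lborel (zero_ext T f)"
proof -
  have fm: "f \<in> borel_measurable (W T)" using f by (simp add: L2_space_def)
  have [measurable]: "zero_ext T f \<in> borel_measurable borel" by (rule zero_ext_measurable[OF fm])
  have "laplace_weight \<nu> T * (\<integral>\<^sup>+ t. ennreal ((norm (zero_ext T f t))\<^sup>2) \<partial>lborel)
    = (\<integral>\<^sup>+ t. laplace_weight \<nu> T * ennreal ((norm (zero_ext T f t))\<^sup>2) \<partial>lborel)"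
    by (rule nn_integral_cmult[symmetric]) simp
  also have "\<dots> \<le> (\<integral>\<^sup>+ t. laplace_weight \<nu> t * ennreal ((cmod (f t))\<^sup>2) * indicator {0..T} t \<partial>lborel)"
    by (intro nn_integral_mono) (auto simp: zero_ext_def indicator_def intro!: mult_right_mono laplace_weight_antimono)
  also have "\<dots> = ennreal ((L2_norm (W T) f)\<^sup>2)"
    using fm unfolding nn_integral_L2_norm[OF f, symmetric] by (intro nn_integral_W[symmetric]) auto
  also have "\<dots> < \<infinity>" by simp
  finally have "(\<integral>\<^sup>+ t. ennreal ((norm (zero_ext T f t))\<^sup>2) \<partial>lborel) < \<infinity>"
    using laplace_weight_pos[of T] T by (auto simp: ennreal_mult_less_top)
  then have sq: "integrable lborel (\<lambda>t. (norm (zero_ext T f t))\<^sup>2)"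
    by (intro integrableI_nonneg) auto
  show ?thesis
  proof (rule Bochner_Integration.integrable_bound)
    show "integrable lborel (\<lambda>t. indicat_real {0..T} t + (norm (zero_ext T f t))\<^sup>2)"
      using sq T by (intro Bochner_Integration.integrable_add integrable_real_indicator) auto
    show "AE t in lborel. norm (zero_ext T f t) \<le> norm (indicat_real {0..T} t + (norm (zero_ext T f t))\<^sup>2)"
    proof (rule AE_I2)
      fix t
      have "2 * norm (zero_ext T f t) * 1 \<le> (norm (zero_ext T f t))\<^sup>2 + 1\<^sup>2" by (rule sum_squares_bound)
      then have "norm (zero_ext T f t) \<le> 1 + (norm (zero_ext T f t))\<^sup>2"
        using norm_ge_zero[of "zero_ext T f t"] zero_le_power2[of "norm (zero_ext T f t)"]
        unfolding power_one mult_1_right by linarith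
      moreover have "zero_ext T f t = 0" if "t \<notin> {0..T}" using that by (simp only: zero_ext_def if_False)
      ultimately show "norm (zero_ext T f t) \<le> norm (indicat_real {0..T} t + (norm (zero_ext T f t))\<^sup>2)"
        by (cases "t \<in> {0..T}") (simp_all only: indicator_simps real_norm_def norm_zero abs_of_nonneg abs_ge_zero, simp_all)
    qed
  qed simp
qed

end

section \<open>The two directions of the equivalence\<close>

context doubling_measure begin

lemma nn_integral_W_square:
  assumes "f \<in> L2_space (W T)"
  shows "(\<integral>\<^sup>+ t. ennreal ((cmod (f t))\<^sup>2) \<partial>W T) = (\<integral>\<^sup>+ t. laplace_weight \<nu> t * ennreal ((cmod (f t))\<^sup>2) * indicator {0..T} t \<partial>lborel)"
  using assms by (intro nn_integral_W) (auto simp: L2_space_def)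

lemma laplace_exists_zero_ext:
  assumes T: "0 < T" and f: "f \<in> L2_space (W T)" and s: "0 \<le> Re s"
  shows "laplace_exists (zero_ext T f) s"
  unfolding laplace_exists_def set_integrable_def
proof (rule Bochner_Integration.integrable_bound)
  show i: "integrable lborel (zero_ext T f)" by (rule integrable_zero_ext[OF T f])
  show "(\<lambda>t. indicat_real {0<..} t *\<^sub>R (zero_ext T f t * exp (- (s * of_real t)))) \<in> borel_measurable lborel"
    using borel_measurable_integrable[OF i] unfolding measurable_lborel2 by (rule times_exp_measurable)
  show "AE t in lborel. norm (indicat_real {0<..} t *\<^sub>R (zero_ext T f t * exp (- (s * of_real t)))) \<le> norm (zero_ext T f t)"
    using s by (auto simp: indicator_def norm_mult norm_exp_eq_Re mult_left_le)
qed

lemma laplace_zero_ext_measurable: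
  assumes \<mu>: "sets \<mu> = sets (restrict_space borel \<complex>\<^sub>+)" and T: "0 < T" and f: "f \<in> L2_space (W T)"
  shows "laplace (zero_ext T f) \<in> borel_measurable \<mu>"
proof -
  have "set_integrable lborel {0<..} (zero_ext T f)"
    unfolding set_integrable_def by (intro integrable_mult_indicator integrable_zero_ext T f) simp
  then show ?thesis
    by (subst measurable_cong_sets[OF \<mu> refl]) (intro measurable_restrict_space1 laplace_measurable)
qed

text \<open>Multiplication by \<open>exp (2 t)\<close> translates the transform by \<open>2\<close>, away from the imaginary axis, where the
  Carleson condition gives no information at scales below \<open>1\<close>. On \<open>[0, T]\<close> it multiplies squared norms by at
  most \<open>exp (4 T)\<close>; this is where the compact support is used.\<close>

lemma embedding_of_carleson:
  assumes T: "0 < T"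
  obtains C where "0 < C"
    "\<And>\<mu> k f. sets \<mu> = sets (restrict_space borel \<complex>\<^sub>+) \<Longrightarrow> 0 < k \<Longrightarrow> carleson_bound (half_plane_measure \<nu>) \<mu> k \<Longrightarrow>
      f \<in> L2_space (W T) \<Longrightarrow>
      (\<integral>\<^sup>+ s. ennreal ((cmod (laplace (zero_ext T f) s))\<^sup>2) \<partial>\<mu>) \<le> ennreal (C * k) * (\<integral>\<^sup>+ t. ennreal ((cmod (f t))\<^sup>2) \<partial>W T)"
proof -
  define S where "S = (\<integral>\<^sup>+ l. ennreal (shift_weight l) \<partial>count_space UNIV)"
  define S' where "S' = enn2real S"
  have SE: "S = ennreal S'" using nn_integral_shift_weight_finite by (simp add: S'_def S_def)
  have "ennreal (shift_weight 0) \<le> S" unfolding S_def by (rule nn_integral_ge_point) simp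
  then have S': "0 < S'" using shift_weight_pos[of 0] unfolding SE by (auto simp: S'_def)
  let ?C = "S' * S' * (2048 * R ^ 3) * exp (4 * T)"
  have "0 < ?C" using S' R_ge_1 by simp
  moreover have "(\<integral>\<^sup>+ s. ennreal ((cmod (laplace (zero_ext T f) s))\<^sup>2) \<partial>\<mu>) \<le> ennreal (?C * k) * (\<integral>\<^sup>+ t. ennreal ((cmod (f t))\<^sup>2) \<partial>W T)"
    if \<mu>: "sets \<mu> = sets (restrict_space borel \<complex>\<^sub>+)" and k: "0 < k"
      and bound: "carleson_bound (half_plane_measure \<nu>) \<mu> k" and f: "f \<in> L2_space (W T)" for \<mu> k f
  proof -
    define g where "g = (\<lambda>t. of_real (exp (2 * t)) * zero_ext T f t)"
    have i: "integrable lborel (zero_ext T f)" by (rule integrable_zero_ext[OF T f])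
    have [measurable]: "zero_ext T f \<in> borel_measurable lborel" using i by auto
    have g: "set_integrable lborel {0<..} g"
      unfolding set_integrable_def
    proof (rule Bochner_Integration.integrable_bound)
      show "integrable lborel (\<lambda>t. of_real (exp (2 * T)) * zero_ext T f t)" using i by simp
      show "(\<lambda>t. indicat_real {0<..} t *\<^sub>R g t) \<in> borel_measurable lborel"
        using borel_measurable_integrable[OF i] unfolding measurable_lborel2 g_def by (rule times_exp_measurable)
      show "AE t in lborel. norm (indicat_real {0<..} t *\<^sub>R g t) \<le> norm (of_real (exp (2 * T)) * zero_ext T f t)"
        by (auto simp: g_def norm_mult zero_ext_def indicator_def intro!: mult_right_mono)
    qed
    have shift: "laplace g (s + 2) = laplace (zero_ext T f) s" for s
      unfolding laplace_def set_lebesgue_integral_def g_def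
    proof (rule Bochner_Integration.integral_cong[OF refl])
      fix t :: real
      have "of_real (exp (2 * t)) * exp (- ((s + 2) * of_real t)) = exp (- (s * of_real t))"
        by (simp add: exp_of_real[symmetric] exp_add[symmetric] algebra_simps)
      then show "indicat_real {0<..} t *\<^sub>R (of_real (exp (2 * t)) * zero_ext T f t * exp (- ((s + 2) * of_real t)))
        = indicat_real {0<..} t *\<^sub>R (zero_ext T f t * exp (- (s * of_real t)))"
        by (simp add: mult_ac)
    qed
    have "(\<integral>\<^sup>+ t\<in>{0<..}. ennreal ((norm (g t))\<^sup>2) * laplace_weight \<nu> t \<partial>lborel)
      \<le> (\<integral>\<^sup>+ t. ennreal (exp (4 * T)) * (laplace_weight \<nu> t * ennreal ((cmod (f t))\<^sup>2) * indicator {0..T} t) \<partial>lborel)"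
    proof (rule nn_integral_mono)
      fix t :: real
      show "ennreal ((norm (g t))\<^sup>2) * laplace_weight \<nu> t * indicator {0<..} t
        \<le> ennreal (exp (4 * T)) * (laplace_weight \<nu> t * ennreal ((cmod (f t))\<^sup>2) * indicator {0..T} t)"
      proof (cases "t \<in> {0..T}")
        case True
        have "(exp (2 * t))\<^sup>2 = exp (4 * t)" by (simp add: power2_eq_square exp_add[symmetric])
        then have "(norm (g t))\<^sup>2 \<le> exp (4 * T) * (cmod (f t))\<^sup>2"
          using True by (simp add: g_def zero_ext_def norm_mult power_mult_distrib mult_right_mono)
        then have "ennreal ((norm (g t))\<^sup>2) \<le> ennreal (exp (4 * T)) * ennreal ((cmod (f t))\<^sup>2)"
          by (simp add: ennreal_mult[symmetric] ennreal_leI)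
        then have "ennreal ((norm (g t))\<^sup>2) * laplace_weight \<nu> t \<le> ennreal (exp (4 * T)) * ennreal ((cmod (f t))\<^sup>2) * laplace_weight \<nu> t"
          by (rule mult_right_mono) simp
        then show ?thesis using True by (simp add: indicator_def mult_ac)
      next
        case False
        then have "g t = 0" by (simp only: g_def zero_ext_def if_False mult_zero_right)
        then show ?thesis by simp
      qed
    qed
    also have "\<dots> = ennreal (exp (4 * T)) * (\<integral>\<^sup>+ t. ennreal ((cmod (f t))\<^sup>2) \<partial>W T)"
    proof -
      have "(\<lambda>t. laplace_weight \<nu> t * ennreal ((cmod (f t))\<^sup>2) * indicator {0..T} t)
        = (\<lambda>t. laplace_weight \<nu> t * ennreal ((cmod (zero_ext T f t))\<^sup>2) * indicator {0..T} t)"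
        by (auto simp: zero_ext_def indicator_def)
      then have "(\<lambda>t. laplace_weight \<nu> t * ennreal ((cmod (f t))\<^sup>2) * indicator {0..T} t) \<in> borel_measurable lborel"
        by simp
      then show ?thesis unfolding nn_integral_W_square[OF f] by (rule nn_integral_cmult)
    qed
    finally have norm_g: "(\<integral>\<^sup>+ t\<in>{0<..}. ennreal ((norm (g t))\<^sup>2) * laplace_weight \<nu> t \<partial>lborel)
      \<le> ennreal (exp (4 * T)) * (\<integral>\<^sup>+ t. ennreal ((cmod (f t))\<^sup>2) \<partial>W T)" .
    have "(\<integral>\<^sup>+ s. ennreal ((cmod (laplace (zero_ext T f) s))\<^sup>2) \<partial>\<mu>) = (\<integral>\<^sup>+ s. ennreal ((norm (laplace g (s + 2)))\<^sup>2) \<partial>\<mu>)"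
      by (simp add: shift)
    also have "\<dots> \<le> S * S * ennreal (2048 * R ^ 3 * k) * (\<integral>\<^sup>+ t\<in>{0<..}. ennreal ((norm (g t))\<^sup>2) * laplace_weight \<nu> t \<partial>lborel)"
      unfolding S_def by (rule laplace_carleson_embedding[OF \<mu> k bound g])
    also have "\<dots> \<le> S * S * ennreal (2048 * R ^ 3 * k) * (ennreal (exp (4 * T)) * (\<integral>\<^sup>+ t. ennreal ((cmod (f t))\<^sup>2) \<partial>W T))"
      by (rule mult_left_mono[OF norm_g]) simp
    also have "\<dots> = ennreal (S' * S' * (2048 * R ^ 3 * k) * exp (4 * T)) * (\<integral>\<^sup>+ t. ennreal ((cmod (f t))\<^sup>2) \<partial>W T)"
      using S' R_ge_1 k unfolding SE by (simp add: ennreal_mult mult.assoc)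
    also have "S' * S' * (2048 * R ^ 3 * k) * exp (4 * T) = ?C * k" by simp
    finally show ?thesis .
  qed
  ultimately show ?thesis using that by blast
qed

text \<open>The test functions are wave packets at times \<open>t\<close> comparable to \<open>1/h\<close>. Their supports stay away from \<open>0\<close>, near which the
  weight need not be integrable, and lie in \<open>[0, T]\<close> since \<open>h \<ge> 1\<close> and \<open>\<delta> \<le> T\<close>. Being decreasing, the weight
  is at most its value at \<open>\<delta>/2h\<close> on the support.\<close>

lemma carleson_of_embedding:
  assumes T: "0 < T"
  obtains C where "0 < C"
    "\<And>\<mu> N. sets \<mu> = sets (restrict_space borel \<complex>\<^sub>+) \<Longrightarrow> 0 \<le> N \<Longrightarrow>
      (\<And>f. f \<in> L2_space (W T) \<Longrightarrow>
        (\<integral>\<^sup>+ s. ennreal ((cmod (laplace (zero_ext T f) s))\<^sup>2) \<partial>\<mu>) \<le> ennreal N * (\<integral>\<^sup>+ t. ennreal ((cmod (f t))\<^sup>2) \<partial>W T)) \<Longrightarrow>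
      carleson_bound (half_plane_measure \<nu>) \<mu> (C * N)"
proof -
  define \<delta> where "\<delta> = min 1 T"
  have \<delta>: "0 < \<delta>" "\<delta> \<le> 1" "\<delta> \<le> T" using T by (auto simp: \<delta>_def)
  obtain D where D: "0 < D" "\<And>h. 0 < h \<Longrightarrow> (\<integral>\<^sup>+ r. ennreal (exp (- (\<delta> * r / h))) \<partial>\<nu>) \<le> ennreal D * emeasure \<nu> {0..<h}"
    using exp_integral_le[OF \<delta>(1)] by blast
  let ?C = "64 * pi * D / \<delta>"
  have "0 < ?C" using D \<delta> by simp
  moreover have "carleson_bound (half_plane_measure \<nu>) \<mu> (?C * N)"
    if \<mu>: "sets \<mu> = sets (restrict_space borel \<complex>\<^sub>+)" and N: "0 \<le> N"
      and emb: "\<And>f. f \<in> L2_space (W T) \<Longrightarrow>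
        (\<integral>\<^sup>+ s. ennreal ((cmod (laplace (zero_ext T f) s))\<^sup>2) \<partial>\<mu>) \<le> ennreal N * (\<integral>\<^sup>+ t. ennreal ((cmod (f t))\<^sup>2) \<partial>W T)" for \<mu> N
    unfolding carleson_bound_def
  proof (intro allI impI)
    fix a h :: real assume h1: "1 \<le> h"
    then have h: "0 < h" by simp
    let ?J = "{\<delta> / (2 * h)..\<delta> / h}"
    let ?Q = "carleson_square a h"
    define f where "f = (\<lambda>t. indicat_real ?J t *\<^sub>R exp (\<i> * complex_of_real (a * t)))"
    have J: "?J \<subseteq> {0..T}"
    proof -
      have "\<delta> / h \<le> \<delta> / 1" using h1 \<delta> by (intro divide_left_mono) auto
      then show ?thesis using \<delta> h by auto
    qed
    have f_norm: "(cmod (f t))\<^sup>2 = indicat_real ?J t" for t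
      by (auto simp: f_def indicator_def norm_exp_eq_Re)
    have ext: "zero_ext T f = f"
    proof
      fix t
      show "zero_ext T f t = f t"
      proof (cases "t \<in> ?J")
        case True
        then have "t \<in> {0..T}" using J by blast
        then show ?thesis by (simp only: zero_ext_def if_True)
      next
        case False
        then have "f t = 0" by (simp add: f_def del: atLeastAtMost_iff)
        then show ?thesis by (simp only: zero_ext_def if_cancel)
      qed
    qed
    have "f \<in> borel_measurable borel" unfolding f_def by measurable
    then have fm: "f \<in> borel_measurable (W T)"
      by (subst measurable_cong_sets[OF sets_W refl]) (rule measurable_restrict_space1)
    have f_int: "(\<integral>\<^sup>+ t. ennreal ((cmod (f t))\<^sup>2) \<partial>W T) \<le> ennreal (pi * D * \<delta> / h) * emeasure \<nu> {0..<h}"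
    proof -
      have "(\<integral>\<^sup>+ t. ennreal ((cmod (f t))\<^sup>2) \<partial>W T) = (\<integral>\<^sup>+ t. laplace_weight \<nu> t * ennreal ((cmod (f t))\<^sup>2) * indicator {0..T} t \<partial>lborel)"
        using fm by (intro nn_integral_W) auto
      also have "\<dots> \<le> (\<integral>\<^sup>+ t. laplace_weight \<nu> (\<delta> / (2 * h)) * indicator ?J t \<partial>lborel)"
        unfolding f_norm by (intro nn_integral_mono) (auto simp: indicator_def intro!: laplace_weight_antimono)
      also have "\<dots> = laplace_weight \<nu> (\<delta> / (2 * h)) * ennreal (\<delta> / (2 * h))"
        using h \<delta> by (subst nn_integral_cmult_indicator) (auto simp: field_simps)
      also have "laplace_weight \<nu> (\<delta> / (2 * h)) \<le> ennreal (2 * pi) * (ennreal D * emeasure \<nu> {0..<h})"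
        unfolding laplace_weight_def using D(2)[OF h] by (intro mult_left_mono) (simp_all add: mult_ac)
      also have "ennreal (2 * pi) * (ennreal D * emeasure \<nu> {0..<h}) * ennreal (\<delta> / (2 * h))
        = ennreal (2 * pi * D * (\<delta> / (2 * h))) * emeasure \<nu> {0..<h}"
      proof -
        have "ennreal (2 * pi) * (ennreal D * emeasure \<nu> {0..<h}) * ennreal (\<delta> / (2 * h))
          = ennreal (2 * pi) * (ennreal D * (ennreal (\<delta> / (2 * h)) * emeasure \<nu> {0..<h}))"
          by (simp only: mult.assoc mult.commute[of "emeasure \<nu> {0..<h}"])
        then show ?thesis using D(1) \<delta> h by (subst (asm) ennreal_mult_assoc3) auto
      qed
      also have "2 * pi * D * (\<delta> / (2 * h)) = pi * D * \<delta> / h" using h by simp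
      finally show ?thesis by (simp add: mult_right_mono)
    qed
    have "(\<integral>\<^sup>+ t. ennreal ((cmod (f t))\<^sup>2) \<partial>W T) < \<infinity>"
      by (rule order.strict_trans1[OF f_int]) (use fin[of h] in \<open>simp add: ennreal_mult_less_top\<close>)
    then have fL2: "f \<in> L2_space (W T)"
      unfolding L2_space_def using fm by (auto intro!: integrableI_nonneg)
    have sets: "?Q \<inter> \<complex>\<^sub>+ \<in> sets \<mu>"
    proof -
      have "closed ?Q"
        unfolding carleson_square_def by (intro closed_Collect_conj closed_Collect_le continuous_intros)
      moreover have o: "open \<complex>\<^sub>+" by (intro open_Collect_less continuous_intros)
      ultimately have "?Q \<inter> \<complex>\<^sub>+ \<in> sets borel" by (intro sets.Int borel_closed borel_open)
      then show ?thesis unfolding \<mu> using o by (subst sets_restrict_space_iff) auto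
    qed
    let ?e = "(\<delta> / (8 * h))\<^sup>2"
    have "ennreal ?e * emeasure \<mu> (?Q \<inter> \<complex>\<^sub>+) = (\<integral>\<^sup>+ s. ennreal ?e * indicator (?Q \<inter> \<complex>\<^sub>+) s \<partial>\<mu>)"
      using sets by (simp add: nn_integral_cmult_indicator)
    also have "\<dots> \<le> (\<integral>\<^sup>+ s. ennreal ((cmod (laplace (zero_ext T f) s))\<^sup>2) \<partial>\<mu>)"
    proof (rule nn_integral_mono)
      fix s
      show "ennreal ?e * indicator (?Q \<inter> \<complex>\<^sub>+) s \<le> ennreal ((cmod (laplace (zero_ext T f) s))\<^sup>2)"
        using laplace_wave_packet_ge[OF \<delta>(1,2) h, of s a, folded f_def] \<delta> h unfolding ext
        by (cases "s \<in> ?Q \<inter> \<complex>\<^sub>+") (simp_all add: ennreal_leI power_mono)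
    qed
    also have "\<dots> \<le> ennreal N * (ennreal (pi * D * \<delta> / h) * emeasure \<nu> {0..<h})"
      by (rule order_trans[OF emb[OF fL2] mult_left_mono[OF f_int]]) simp
    finally have "ennreal (1 / ?e) * (ennreal ?e * emeasure \<mu> (?Q \<inter> \<complex>\<^sub>+))
      \<le> ennreal (1 / ?e) * (ennreal N * (ennreal (pi * D * \<delta> / h) * emeasure \<nu> {0..<h}))"
      by (rule mult_left_mono) simp
    moreover have "ennreal (1 / ?e) * (ennreal ?e * emeasure \<mu> (?Q \<inter> \<complex>\<^sub>+)) = emeasure \<mu> (?Q \<inter> \<complex>\<^sub>+)"
      using \<delta> h by (subst ennreal_mult_assoc2) auto
    moreover have "ennreal (1 / ?e) * (ennreal N * (ennreal (pi * D * \<delta> / h) * emeasure \<nu> {0..<h}))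
      = ennreal (1 / ?e * N * (pi * D * \<delta> / h)) * emeasure \<nu> {0..<h}"
      using D(1) \<delta> h N by (intro ennreal_mult_assoc3) auto
    moreover have "1 / ?e * N * (pi * D * \<delta> / h) = ?C * N * h"
      using \<delta> h by (simp add: field_simps power2_eq_square)
    ultimately have "emeasure \<mu> (?Q \<inter> \<complex>\<^sub>+) \<le> ennreal (?C * N * h) * emeasure \<nu> {0..<h}" by simp
    also have "\<dots> \<le> ennreal (?C * N * h) * emeasure \<nu> {0..h}"
      by (intro mult_left_mono emeasure_mono in_sets_\<nu>) auto
    also have "\<dots> = ennreal (?C * N) * emeasure (half_plane_measure \<nu>) ?Q"
    proof -
      have "0 \<le> ?C * N" using N D(1) \<delta> by simp
      then have "ennreal (?C * N * h) = ennreal (?C * N) * ennreal h" using h by (intro ennreal_mult) auto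
      then show ?thesis using h by (simp only: emeasure_carleson_square less_imp_le mult.assoc mult.commute[of "ennreal h"])
    qed
    finally show "emeasure \<mu> (?Q \<inter> \<complex>\<^sub>+) \<le> ennreal (?C * N) * emeasure (half_plane_measure \<nu>) ?Q" .
  qed
  ultimately show ?thesis using that by blast
qed

end

section \<open>Carleson embeddings of Laplace transforms\<close>

lemma doubling_measure_of_hypotheses:
  fixes \<nu> :: "real measure"
  assumes reg: "regular_borel_measure_on {0..} \<nu>"
    and supp: "0 \<in> measure_support \<nu>"
    and sup: "(SUP t\<in>{0<..}. emeasure \<nu> {0..<2 * t} / emeasure \<nu> {0..<t}) < \<infinity>"
  obtains R where "doubling_measure \<nu> R"
proof -
  let ?q = "\<lambda>t. emeasure \<nu> {0..<2 * t} / emeasure \<nu> {0..<t}"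
  \<comment> \<open>Adding \<open>1\<close> secures \<open>R \<ge> 1\<close>.\<close>
  define R where "R = enn2real (SUP t\<in>{0<..}. ?q t) + 1"
  have sets: "sets \<nu> = sets (restrict_space borel {0..})"
    and compact: "\<And>K. compact K \<Longrightarrow> K \<subseteq> {0..} \<Longrightarrow> emeasure \<nu> K < \<infinity>"
    using reg by (auto simp: regular_borel_measure_on_def)
  have space: "space \<nu> = {0..}"
    using sets_eq_imp_space_eq[OF sets] by (simp add: space_restrict_space)
  have in_sets: "A \<in> sets \<nu>" if "A \<in> sets borel" "A \<subseteq> {0..}" for A
    using that by (simp add: sets sets_restrict_space_iff)
  have fin: "emeasure \<nu> {0..<t} < \<infinity>" for t
  proof -
    have "emeasure \<nu> {0..<t} \<le> emeasure \<nu> {0..t}" by (intro emeasure_mono in_sets) auto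
    also have "\<dots> < \<infinity>" by (rule compact) auto
    finally show ?thesis .
  qed
  have pos: "0 < emeasure \<nu> {0..<t}" if "0 < t" for t
  proof -
    have "{0..<t} = {0..} \<inter> {..<t}" by auto
    then have "openin (top_of_set (space \<nu>)) {0..<t}"
      unfolding space by (simp add: openin_open_Int)
    then show ?thesis using supp that by (auto simp: measure_support_def)
  qed
  have "doubling_measure \<nu> R"
  proof
    show "1 \<le> R" by (simp add: R_def)
    show "emeasure \<nu> {0..<2 * t} \<le> ennreal R * emeasure \<nu> {0..<t}" if t: "0 < t" for t
    proof -
      have "?q t \<le> (SUP t\<in>{0<..}. ?q t)" using t by (intro SUP_upper) auto
      also have "\<dots> \<le> ennreal R" using sup by (simp add: R_def ennreal_plus)
      finally have "?q t * emeasure \<nu> {0..<t} \<le> ennreal R * emeasure \<nu> {0..<t}" by (rule mult_right_mono) simp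
      then show ?thesis using pos[OF t] fin[of t]
        by (simp add: ennreal_divide_times ennreal_mult_divide_eq divide_mult_eq less_top)
    qed
  qed (use sets pos fin in auto)
  then show ?thesis using that by blast
qed

context doubling_measure begin

abbreviation "L T f \<equiv> laplace (zero_ext T f)"

lemma laplace_embedding_boundedI:
  assumes \<mu>: "sets \<mu> = sets (restrict_space borel \<complex>\<^sub>+)" and T: "0 < T" and c: "0 \<le> c"
    and emb: "\<And>f. f \<in> L2_space (W T) \<Longrightarrow>
      (\<integral>\<^sup>+ s. ennreal ((cmod (L T f s))\<^sup>2) \<partial>\<mu>) \<le> ennreal c * (\<integral>\<^sup>+ t. ennreal ((cmod (f t))\<^sup>2) \<partial>W T)"
  shows "laplace_embedding_bounded T (laplace_weight \<nu>) \<mu>"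
    and "(laplace_embedding_norm T (laplace_weight \<nu>) \<mu>)\<^sup>2 \<le> c"
proof -
  have space: "s \<in> \<complex>\<^sub>+" if "s \<in> space \<mu>" for s
    using that sets_eq_imp_space_eq[OF \<mu>] by (simp add: space_restrict_space)
  have ex: "laplace_exists (zero_ext T f) s" if "f \<in> L2_space (W T)" "0 < Re s" for f s
    using laplace_exists_zero_ext[OF T that(1)] that(2) by simp
  have L2: "L T f \<in> L2_space \<mu>" if f: "f \<in> L2_space (W T)" for f
  proof -
    have "ennreal c * (\<integral>\<^sup>+ t. ennreal ((cmod (f t))\<^sup>2) \<partial>W T) < \<infinity>"
      unfolding nn_integral_L2_norm[OF f] by (simp add: ennreal_mult_less_top)
    with emb[OF f] have "(\<integral>\<^sup>+ s. ennreal ((cmod (L T f s))\<^sup>2) \<partial>\<mu>) < \<infinity>" by (rule order.strict_trans1)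
    then show ?thesis unfolding L2_space_def
      using laplace_zero_ext_measurable[OF \<mu> T f] by (auto intro!: integrableI_nonneg)
  qed
  have norm: "L2_norm \<mu> (L T f) \<le> sqrt c * L2_norm (W T) f" if f: "f \<in> L2_space (W T)" for f
  proof -
    have "ennreal ((L2_norm \<mu> (L T f))\<^sup>2) \<le> ennreal c * ennreal ((L2_norm (W T) f)\<^sup>2)"
      using emb[OF f] unfolding nn_integral_L2_norm[OF f] nn_integral_L2_norm[OF L2[OF f]] .
    then have "(L2_norm \<mu> (L T f))\<^sup>2 \<le> c * (L2_norm (W T) f)\<^sup>2"
      using c by (simp add: ennreal_mult[symmetric])
    also have "\<dots> = (sqrt c * L2_norm (W T) f)\<^sup>2" using c by (simp add: power_mult_distrib)
    finally show ?thesis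
      by (rule power2_le_imp_le) (use c L2_norm_nonneg[of "W T" f] in auto)
  qed
  have add: "L T (\<lambda>x. f x + g x) s = L T f s + L T g s"
    if f: "f \<in> L2_space (W T)" and g: "g \<in> L2_space (W T)" and s: "0 < Re s" for f g s
  proof -
    have "zero_ext T (\<lambda>x. f x + g x) t = zero_ext T f t + zero_ext T g t" for t by (simp add: zero_ext_def)
    then show ?thesis using ex[OF f s] ex[OF g s]
      unfolding laplace_exists_def laplace_def by (simp add: distrib_right set_integral_add)
  qed
  have scale: "L T (\<lambda>x. b * f x) s = b * L T f s" for b f s
  proof -
    have "zero_ext T (\<lambda>x. b * f x) t = b * zero_ext T f t" for t by (simp add: zero_ext_def)
    then show ?thesis unfolding laplace_def by (simp add: mult.assoc)
  qed
  show "laplace_embedding_bounded T (laplace_weight \<nu>) \<mu>"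
    unfolding laplace_embedding_bounded_def bounded_linear_L2_def
  proof (intro conjI ballI allI)
    show "\<exists>C. \<forall>f\<in>L2_space (W T). L2_norm \<mu> (L T f) \<le> C * L2_norm (W T) f" using norm by blast
  qed (use ex L2 add scale space in \<open>auto intro!: AE_I2\<close>)
  have N0: "0 \<le> laplace_embedding_norm T (laplace_weight \<nu>) \<mu>"
    using \<open>laplace_embedding_bounded T (laplace_weight \<nu>) \<mu>\<close> L2_onorm_bounds(1)
    unfolding laplace_embedding_bounded_def laplace_embedding_norm_def by blast
  have "laplace_embedding_norm T (laplace_weight \<nu>) \<mu> \<le> sqrt c"
    unfolding laplace_embedding_norm_def using c norm by (intro L2_onorm_least) auto
  from power_mono[OF this N0, of 2] show "(laplace_embedding_norm T (laplace_weight \<nu>) \<mu>)\<^sup>2 \<le> c"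
    using c by simp
qed

lemma laplace_embedding_boundedD:
  assumes "laplace_embedding_bounded T (laplace_weight \<nu>) \<mu>" and f: "f \<in> L2_space (W T)"
  shows "(\<integral>\<^sup>+ s. ennreal ((cmod (L T f s))\<^sup>2) \<partial>\<mu>)
    \<le> ennreal ((laplace_embedding_norm T (laplace_weight \<nu>) \<mu>)\<^sup>2) * (\<integral>\<^sup>+ t. ennreal ((cmod (f t))\<^sup>2) \<partial>W T)"
proof -
  let ?N = "laplace_embedding_norm T (laplace_weight \<nu>) \<mu>"
  have bl: "bounded_linear_L2 (W T) \<mu> (L T)" using assms(1) by (simp add: laplace_embedding_bounded_def)
  then have L2: "L T f \<in> L2_space \<mu>" using f by (simp add: bounded_linear_L2_def)
  have "L2_norm \<mu> (L T f) \<le> ?N * L2_norm (W T) f"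
    unfolding laplace_embedding_norm_def by (rule L2_onorm_bounds(2)[OF bl f])
  then have "(L2_norm \<mu> (L T f))\<^sup>2 \<le> (?N * L2_norm (W T) f)\<^sup>2"
    by (rule power_mono) (rule L2_norm_nonneg)
  then show ?thesis unfolding nn_integral_L2_norm[OF f] nn_integral_L2_norm[OF L2]
    by (simp add: power_mult_distrib ennreal_mult[symmetric] ennreal_leI)
qed

end

theorem theorem3p1:
  fixes \<nu>t :: "real measure" and T :: real
  assumes "regular_borel_measure_on {0..} \<nu>t"
    and "0 \<in> measure_support \<nu>t"
    and "(SUP t\<in>{0<..}. emeasure \<nu>t {0..<2 * t} / emeasure \<nu>t {0..<t}) < \<infinity>"
    and "0 < T"
  shows "(\<forall>\<mu>. regular_borel_measure_on \<complex>\<^sub>+ \<mu> \<longrightarrow>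
            (laplace_embedding_bounded T (laplace_weight \<nu>t) \<mu> \<longleftrightarrow>
             (\<exists>k>0. carleson_bound (half_plane_measure \<nu>t) \<mu> k))) \<and>
         (\<exists>c\<^sub>1>0. \<exists>c\<^sub>2>0. \<forall>\<mu>. regular_borel_measure_on \<complex>\<^sub>+ \<mu> \<longrightarrow>
            laplace_embedding_bounded T (laplace_weight \<nu>t) \<mu> \<longrightarrow>
            (let N = laplace_embedding_norm T (laplace_weight \<nu>t) \<mu>;
                 k = Inf {k. 0 < k \<and> carleson_bound (half_plane_measure \<nu>t) \<mu> k}
             in c\<^sub>1 * k \<le> N\<^sup>2 \<and> N\<^sup>2 \<le> c\<^sub>2 * k))"
proof -
  obtain R where "doubling_measure \<nu>t R"
    using doubling_measure_of_hypotheses[OF assms(1-3)] .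
  then interpret doubling_measure \<nu>t R .
  note T = \<open>0 < T\<close>
  let ?bounded = "\<lambda>\<mu>. laplace_embedding_bounded T (laplace_weight \<nu>t) \<mu>"
  let ?N = "\<lambda>\<mu>. laplace_embedding_norm T (laplace_weight \<nu>t) \<mu>"
  let ?carleson = "carleson_bound (half_plane_measure \<nu>t)"
  obtain C where C: "0 < C"
    and upper: "\<And>\<mu> k f. sets \<mu> = sets (restrict_space borel \<complex>\<^sub>+) \<Longrightarrow> 0 < k \<Longrightarrow> ?carleson \<mu> k \<Longrightarrow>
      f \<in> L2_space (W T) \<Longrightarrow>
      (\<integral>\<^sup>+ s. ennreal ((cmod (L T f s))\<^sup>2) \<partial>\<mu>) \<le> ennreal (C * k) * (\<integral>\<^sup>+ t. ennreal ((cmod (f t))\<^sup>2) \<partial>W T)"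
    using embedding_of_carleson[OF T] by metis
  obtain D where D: "0 < D"
    and lower: "\<And>\<mu> N. sets \<mu> = sets (restrict_space borel \<complex>\<^sub>+) \<Longrightarrow> 0 \<le> N \<Longrightarrow>
      (\<And>f. f \<in> L2_space (W T) \<Longrightarrow>
        (\<integral>\<^sup>+ s. ennreal ((cmod (L T f s))\<^sup>2) \<partial>\<mu>) \<le> ennreal N * (\<integral>\<^sup>+ t. ennreal ((cmod (f t))\<^sup>2) \<partial>W T)) \<Longrightarrow>
      ?carleson \<mu> (D * N)"
    using carleson_of_embedding[OF T] by metis
  have sets: "sets \<mu> = sets (restrict_space borel \<complex>\<^sub>+)" if "regular_borel_measure_on \<complex>\<^sub>+ \<mu>" for \<mu>
    using that by (simp add: regular_borel_measure_on_def)
  have suff: "?bounded \<mu>" "(?N \<mu>)\<^sup>2 \<le> C * k" if "regular_borel_measure_on \<complex>\<^sub>+ \<mu>" "0 < k" "?carleson \<mu> k" for \<mu> k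
    using laplace_embedding_boundedI[OF sets[OF that(1)] T _ upper[OF sets[OF that(1)] that(2,3)]] C that(2) by auto
  \<comment> \<open>The slack \<open>\<epsilon>\<close> keeps the constant positive when the embedding has norm \<open>0\<close>.\<close>
  have nec: "?carleson \<mu> (D * (?N \<mu>)\<^sup>2 + \<epsilon>)" if "regular_borel_measure_on \<complex>\<^sub>+ \<mu>" "?bounded \<mu>" "0 < \<epsilon>" for \<mu> \<epsilon>
  proof -
    have "?carleson \<mu> (D * (?N \<mu>)\<^sup>2)"
      by (rule lower[OF sets[OF that(1)] _ laplace_embedding_boundedD[OF that(2)]]) simp
    moreover have "ennreal (D * (?N \<mu>)\<^sup>2) \<le> ennreal (D * (?N \<mu>)\<^sup>2 + \<epsilon>)" using that(3) by (intro ennreal_leI) simp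
    ultimately show ?thesis unfolding carleson_bound_def by (blast intro: order_trans mult_right_mono[OF _ zero_le])
  qed
  have pos: "0 < D * (?N \<mu>)\<^sup>2 + \<epsilon>" if "0 < \<epsilon>" for \<mu> \<epsilon>
    using D that by (simp add: add_nonneg_pos)
  have equiv: "?bounded \<mu> \<longleftrightarrow> (\<exists>k>0. ?carleson \<mu> k)" if "regular_borel_measure_on \<complex>\<^sub>+ \<mu>" for \<mu>
    using suff(1)[OF that] nec[OF that _ zero_less_one] pos[OF zero_less_one] by blast
  have norms: "1 / D * Inf {k. 0 < k \<and> ?carleson \<mu> k} \<le> (?N \<mu>)\<^sup>2 \<and> (?N \<mu>)\<^sup>2 \<le> C * Inf {k. 0 < k \<and> ?carleson \<mu> k}"
    if \<mu>: "regular_borel_measure_on \<complex>\<^sub>+ \<mu>" and b: "?bounded \<mu>" for \<mu>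
  proof -
    let ?K = "{k. 0 < k \<and> ?carleson \<mu> k}"
    have bdd: "bdd_below ?K" by (rule bdd_belowI[of _ 0]) auto
    have ne: "?K \<noteq> {}" using nec[OF \<mu> b zero_less_one] pos[OF zero_less_one] by blast
    have "Inf ?K \<le> D * (?N \<mu>)\<^sup>2"
    proof (rule field_le_epsilon)
      fix \<epsilon> :: real assume "0 < \<epsilon>"
      then show "Inf ?K \<le> D * (?N \<mu>)\<^sup>2 + \<epsilon>" using nec[OF \<mu> b] pos by (intro cInf_lower[OF _ bdd]) auto
    qed
    moreover have "(?N \<mu>)\<^sup>2 / C \<le> Inf ?K"
      using suff(2)[OF \<mu>] C by (intro cInf_greatest[OF ne]) (auto simp: divide_le_eq mult.commute)
    ultimately show ?thesis using C D by (simp add: field_simps)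
  qed
  show ?thesis
  proof (intro conjI)
    show "\<forall>\<mu>. regular_borel_measure_on \<complex>\<^sub>+ \<mu> \<longrightarrow> (?bounded \<mu> \<longleftrightarrow> (\<exists>k>0. ?carleson \<mu> k))"
      using equiv by blast
    show "\<exists>c\<^sub>1>0. \<exists>c\<^sub>2>0. \<forall>\<mu>. regular_borel_measure_on \<complex>\<^sub>+ \<mu> \<longrightarrow> ?bounded \<mu> \<longrightarrow>
        (let N = ?N \<mu>; k = Inf {k. 0 < k \<and> ?carleson \<mu> k} in c\<^sub>1 * k \<le> N\<^sup>2 \<and> N\<^sup>2 \<le> c\<^sub>2 * k)"
      unfolding Let_def
      by (rule exI[of _ "1 / D"], intro conjI exI[of _ C]) (use C D norms in auto)
  qed
qed

end
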